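(* Let $B$ be a stationary ordered Bratteli diagram such that the tail equivalence relation $\mathcal R$ is aperiodic and the incidence matrix $F$ satisfies condition (P), let $\varphi$ be its Vershik map, and let $\mu_\alpha$ be the ergodic $\mathcal R$-invariant probability measure determined by a distinguished vertex $\alpha$ of $R(A)$, $A=F^T$. A complex number $\gamma$ is an eigenvalue for the finite measure-preserving system $(X_B,\varphi,\mu_\alpha)$ if and only if for every diamond $(\overline\omega,\overline\omega')\in\mathcal D_\alpha$, $$\gamma^{P_n(\overline\omega,\overline\omega')}\to1\quad\text{as } n\to\infty.$$ Moreover, if the diagram satisfies condition (P$'$), then for $\gamma$ to be an eigenvalue it is sufficient that this convergence holds for all diamonds of length $k\le2$ in $\mathcal D_\alpha$.
   Context: A Bratteli diagram $B=(V,E)$ is an infinite graph with $V=\bigsqcup_{i\ge 0}V_i$, $E=\bigsqcup_{i\ge1}E_i$, all $V_i,E_i$ finite, $V_0=\{v_0\}$, with range and source maps $r,s$ such that $r(E_i)=V_i$, $s(E_i)=V_{i-1}$, $s^{-1}(v)\ne\emptyset$ for all $v\in V$, $r^{-1}(v')\neq\emptyset$ for all $v'\ne v_0$. $X_B$ is the space of infinite paths $x=(x_i)_{i\ge1}$, $x_i\in E_i$, $r(x_i)=s(x_{i+1})$, with the cylinder topology; it is assumed to have no isolated points. For a finite path $\overline e$ from $v_0$, $[\overline e]$ is the cylinder set of infinite paths starting with $\overline e$. $F_n$ ($n\ge1$) is the matrix whose $(v,w)$ entry, $v\in V_{n+1},w\in V_n$, is the number of edges from $w$ to $v$. $B$ is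 stationary if $F_n=F$ for all $n\ge1$; then $V_n$, $n\ge1$, is identified with $\{1,\dots,N\}$. $h^{(1)}_w$ is the number of edges from $v_0$ to $w\in V_1$. $B$ is ordered if each $r^{-1}(v)$, $v\ne v_0$, is linearly ordered; stationary ordered if it is stationary and the order on $E_n$, $n\ge 2$, does not depend on $n$. A path is maximal (minimal) if all its edges are maximal (minimal) in $r^{-1}(r(x_i))$. $\mathcal R$: $x,y$ are tail equivalent if $x_i=y_i$ for all large $i$; $\mathcal R$ is aperiodic if all classes are infinite. Vershik map $\varphi$ (defined outside the paths tail equivalent to maximal or minimal infinite paths, a countable null set): if $k$ is the least index with $x_k$ not maximal, $\varphi(x)=(x^0_1,\dots,x^0_{k-1},\overline{x_k},x_{k+1},\dots)$ where $\overline{x_k}$ is the successor of $x_k$ in $r^{-1}(r(x_k))$ and $(x^0_1,\dots,x^0_{k-1})$ is the minimal path from $v_0$ to $s(\overline{x_k})$. $\gamma$ is an eigenvalue if there is a measurable $f$, not a.e. zero, with $f\circ\varphi=\gamma f$ $\mu_\alpha$-a.e. Let $G(A)$ be the directed graph on $\{1,\dots,N\}$ with $i\to j$ iff $A_{ij}>0$; vertices $i,j$ are equivalent if $i=j$ or there are paths both ways; $\mathcal E_1,\dots,\mathcal E_m$ are the classes (vertices of the reduced graph $R(A)$), $F_\alpha$ is $F$ restricted to $\mathcal E_\alpha$, $A_\alpha=F_\alpha^T$, $\rho_\alpha$ its spectral radius. $\beta$ has access to $\alpha$ in $R(A)$ if $\beta=\alpha$ or there is a path in $G(A)$ from $\mathcal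 E_\beta$ to $\mathcal E_\alpha$; $\alpha$ is distinguished if $\rho_\alpha>\rho_\beta$ for every $\beta\ne\alpha$ with access to $\alpha$. Condition (P): vertices and classes are numbered so that $F$ is block lower triangular with diagonal blocks $F_1,\dots,F_m$, exactly the first $s$ classes being those to which no other class has access in $R(A)$, and every nonzero $F_\alpha$ is primitive. Condition (P$'$): the same, with every nonzero $F_\alpha$ strictly positive. For $\alpha$ distinguished, $\lambda_\alpha:=\rho_\alpha$ and $\xi_\alpha$ is the unique non-negative eigenvector of $A$ for $\lambda_\alpha$ with $\xi_\alpha(i)>0$ iff the class of $i$ has access to $\alpha$, normalized by $\sum_{w\in V_1}h^{(1)}_w\xi_\alpha(w)=1$; $\mu_\alpha$ is the ($\mathcal R$-invariant, ergodic) probability measure with $\mu_\alpha([\overline e])=\xi_\alpha(v)/\lambda_\alpha^{n-1}$ for every path $\overline e$ of length $n$ from $v_0$ to $v\in V_n$. Diamonds: a diamond is a pair $(\overline\omega,\overline\omega')$ of distinct finite paths, starting at a level $\ge1$, with the same source vertex and the same range vertex; its length is the common number of edges. $\mathcal D_\alpha$ is the set of diamonds whose two paths only pass through vertices in the class $\mathcal E_\alpha$. $S$ is the vertical shift sending each edge of $E_n$ ($n\ge2$) to the corresponding edge of $E_{n+1}$ (same source and range indices, same position in the order), extended to finite paths. For a diamond, $P(\overline\omega,\overline\omega')\in\mathbb Z$ is the integer with $\varphi^{P(\overline\omega,\overline\omega')}[\overline\tau\,\overline\omega]=[\overline\tau\,\overline\omega']$ for all paths $\overline\tau$ from $v_0$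 to $s(\overline\omega)$ (concatenations); equivalently, it is the signed number of steps from $\overline\tau\,\overline\omega$ to $\overline\tau\,\overline\omega'$ in the order on paths from $v_0$ to $r(\overline\omega)$ where the last differing edge decides. It is independent of $\overline\tau$. $P_n(\overline\omega,\overline\omega'):=P(S^n\overline\omega,S^n\overline\omega')$. *)

theory Defs
  imports
    "HOL-Probability.Probability"
    "Jordan_Normal_Form.Spectral_Radius"
    "Jordan_Normal_Form.DL_Submatrix"
begin

section \<open>Bratteli diagrams and their orders\<close>

text \<open>The disjoint unions \<open>V = \<Squnion>\<^sub>n V\<^sub>n\<close> and \<open>E = \<Squnion>\<^sub>n E\<^sub>n\<close> are represented by families of sets
  indexed by the level; the source, the range and the order are therefore given level by level,
  and the same element may be reused at different levels. \<open>edges B 0\<close> is irrelevant.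
  \<open>edge_ord B n v\<close> is the (reflexive) order on the edges of \<open>E\<^sub>n\<close> with range \<open>v\<close>.\<close>

record ('v, 'e) bratteli =
  verts :: "nat \<Rightarrow> 'v set"
  edges :: "nat \<Rightarrow> 'e set"
  src :: "nat \<Rightarrow> 'e \<Rightarrow> 'v"
  rng :: "nat \<Rightarrow> 'e \<Rightarrow> 'v"
  edge_ord :: "nat \<Rightarrow> 'v \<Rightarrow> 'e rel"

text \<open>The two image equations already say that every vertex has an outgoing edge and that each
  vertex other than \<open>v\<^sub>0\<close> has an incoming edge.\<close>

definition bratteli_diagram :: "('v, 'e) bratteli \<Rightarrow> bool" where
  "bratteli_diagram B \<longleftrightarrow>
     (\<exists>v\<^sub>0. verts B 0 = {v\<^sub>0}) \<and>
     (\<forall>n. finite (verts B n)) \<and>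
     (\<forall>n\<ge>1. finite (edges B n) \<and> rng B n ` edges B n = verts B n
            \<and> src B n ` edges B n = verts B (n - 1))"

definition edges_into :: "('v, 'e) bratteli \<Rightarrow> nat \<Rightarrow> 'v \<Rightarrow> 'e set" where
  "edges_into B n v = {e \<in> edges B n. rng B n e = v}"

definition ordered_diagram :: "('v, 'e) bratteli \<Rightarrow> bool" where
  "ordered_diagram B \<longleftrightarrow>
     bratteli_diagram B \<and>
     (\<forall>n\<ge>1. \<forall>v\<in>verts B n. linear_order_on (edges_into B n v) (edge_ord B n v))"

definition edge_less :: "('v, 'e) bratteli \<Rightarrow> nat \<Rightarrow> 'e \<Rightarrow> 'e \<Rightarrow> bool" where
  "edge_less B n e e' \<longleftrightarrow>
     e \<in> edges B n \<and> e' \<in> edges B n \<and> rng B n e = rng B n e' \<and>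
     (e, e') \<in> edge_ord B n (rng B n e) \<and> e \<noteq> e'"

definition edge_succ :: "('v, 'e) bratteli \<Rightarrow> nat \<Rightarrow> 'e \<Rightarrow> 'e \<Rightarrow> bool" where
  "edge_succ B n e e' \<longleftrightarrow>
     edge_less B n e e' \<and> \<not> (\<exists>d. edge_less B n e d \<and> edge_less B n d e')"

definition max_edge :: "('v, 'e) bratteli \<Rightarrow> nat \<Rightarrow> 'e \<Rightarrow> bool" where
  "max_edge B n e \<longleftrightarrow> e \<in> edges B n \<and> \<not> (\<exists>e'. edge_less B n e e')"

definition min_edge :: "('v, 'e) bratteli \<Rightarrow> nat \<Rightarrow> 'e \<Rightarrow> bool" where
  "min_edge B n e \<longleftrightarrow> e \<in> edges B n \<and> \<not> (\<exists>e'. edge_less B n e' e)"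

section \<open>Finite and infinite paths\<close>

text \<open>A path from level \<open>a\<close> to level \<open>b\<close> uses one edge of each \<open>E\<^sub>i\<close> with \<open>a < i \<le> b\<close>; it is a
  function on these \<open>i\<close>, extended by \<open>undefined\<close> so that equality of paths is equality of
  functions. Infinite paths are indexed by \<open>i \<ge> 1\<close> in the same way.\<close>

definition fin_paths :: "('v, 'e) bratteli \<Rightarrow> nat \<Rightarrow> nat \<Rightarrow> (nat \<Rightarrow> 'e) set" where
  "fin_paths B a b =
     {p \<in> (\<Pi>\<^sub>E i\<in>{a<..b}. edges B i). \<forall>i. a < i \<and> i < b \<longrightarrow> rng B i (p i) = src B (Suc i) (p (Suc i))}"

definition inf_paths :: "('v, 'e) bratteli \<Rightarrow> (nat \<Rightarrow> 'e) set" where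
  "inf_paths B =
     {x \<in> (\<Pi>\<^sub>E i\<in>{1..}. edges B i). \<forall>i\<ge>1. rng B i (x i) = src B (Suc i) (x (Suc i))}"

text \<open>The concatenation of a path ending at level \<open>a\<close> with a path starting there.\<close>

definition path_append :: "nat \<Rightarrow> (nat \<Rightarrow> 'e) \<Rightarrow> (nat \<Rightarrow> 'e) \<Rightarrow> nat \<Rightarrow> 'e" where
  "path_append a p q = (\<lambda>i. if i \<le> a then p i else q i)"

definition cylinder :: "('v, 'e) bratteli \<Rightarrow> nat \<Rightarrow> (nat \<Rightarrow> 'e) \<Rightarrow> (nat \<Rightarrow> 'e) set" where
  "cylinder B n p = {x \<in> inf_paths B. \<forall>i\<in>{1..n}. x i = p i}"

definition path_topology :: "('v, 'e) bratteli \<Rightarrow> (nat \<Rightarrow> 'e) topology" where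
  "path_topology B = topology_generated_by {cylinder B n p | n p. p \<in> fin_paths B 0 n}"

definition path_borel :: "('v, 'e) bratteli \<Rightarrow> (nat \<Rightarrow> 'e) measure" where
  "path_borel B = sigma (inf_paths B) {U. openin (path_topology B) U}"

definition no_isolated_points :: "('v, 'e) bratteli \<Rightarrow> bool" where
  "no_isolated_points B \<longleftrightarrow> (\<forall>x\<in>inf_paths B. \<not> openin (path_topology B) {x})"

definition tail_equivalent :: "(nat \<Rightarrow> 'e) \<Rightarrow> (nat \<Rightarrow> 'e) \<Rightarrow> bool" where
  "tail_equivalent x y \<longleftrightarrow> (\<exists>n. \<forall>i\<ge>n. x i = y i)"

definition tail_aperiodic :: "('v, 'e) bratteli \<Rightarrow> bool" where
  "tail_aperiodic B \<longleftrightarrow> (\<forall>x\<in>inf_paths B. infinite {y \<in> inf_paths B. tail_equivalent x y})"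

section \<open>The Vershik map and its eigenvalues\<close>

definition max_path :: "('v, 'e) bratteli \<Rightarrow> (nat \<Rightarrow> 'e) \<Rightarrow> bool" where
  "max_path B x \<longleftrightarrow> x \<in> inf_paths B \<and> (\<forall>i\<ge>1. max_edge B i (x i))"

definition min_path :: "('v, 'e) bratteli \<Rightarrow> (nat \<Rightarrow> 'e) \<Rightarrow> bool" where
  "min_path B x \<longleftrightarrow> x \<in> inf_paths B \<and> (\<forall>i\<ge>1. min_edge B i (x i))"

definition vershik_domain :: "('v, 'e) bratteli \<Rightarrow> (nat \<Rightarrow> 'e) set" where
  "vershik_domain B =
     {x \<in> inf_paths B. \<not> (\<exists>y. (max_path B y \<or> min_path B y) \<and> tail_equivalent x y)}"

definition vershik :: "('v, 'e) bratteli \<Rightarrow> (nat \<Rightarrow> 'e) \<Rightarrow> (nat \<Rightarrow> 'e)" where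
  "vershik B = (\<lambda>x\<in>vershik_domain B.
     let k = (LEAST k. 1 \<le> k \<and> \<not> max_edge B k (x k))
     in THE y. y \<in> inf_paths B \<and> (\<forall>i\<in>{1..<k}. min_edge B i (y i)) \<and>
               edge_succ B k (x k) (y k) \<and> (\<forall>i>k. y i = x i))"

definition vershik_eigenvalue ::
  "('v, 'e) bratteli \<Rightarrow> (nat \<Rightarrow> 'e) measure \<Rightarrow> complex \<Rightarrow> bool" where
  "vershik_eigenvalue B M \<gamma> \<longleftrightarrow>
     (\<exists>f \<in> borel_measurable M. \<not> (AE x in M. f x = 0) \<and> (AE x in M. f (vershik B x) = \<gamma> * f x))"

section \<open>Stationary ordered diagrams\<close>

definition incidence :: "('v, 'e) bratteli \<Rightarrow> nat \<Rightarrow> 'v \<Rightarrow> 'v \<Rightarrow> nat" where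
  "incidence B n v w = card {e \<in> edges B (Suc n). src B (Suc n) e = w \<and> rng B (Suc n) e = v}"

definition root_edges :: "('v, 'e) bratteli \<Rightarrow> 'v \<Rightarrow> nat" where
  "root_edges B w = card (edges_into B 1 w)"

text \<open>The \<open>N\<close> vertices of each level \<open>n \<ge> 1\<close> are numbered from \<open>0\<close> to \<open>N - 1\<close>, as are the rows
  and columns of matrices.\<close>

definition stationary :: "(nat, 'e) bratteli \<Rightarrow> nat mat \<Rightarrow> bool" where
  "stationary B F \<longleftrightarrow>
     square_mat F \<and>
     (\<forall>n\<ge>1. verts B n = {..<dim_row F} \<and>
            (\<forall>v<dim_row F. \<forall>w<dim_row F. incidence B n v w = F $$ (v, w)))"

text \<open>The edge sets of different levels are unrelated sets, so independence of the order from
  the level is expressed by an isomorphism between consecutive levels.\<close>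

definition stationary_ordered :: "(nat, 'e) bratteli \<Rightarrow> nat mat \<Rightarrow> bool" where
  "stationary_ordered B F \<longleftrightarrow>
     ordered_diagram B \<and> stationary B F \<and>
     (\<forall>n\<ge>2. \<exists>f. bij_betw f (edges B n) (edges B (Suc n)) \<and>
        (\<forall>e\<in>edges B n. src B (Suc n) (f e) = src B n e \<and> rng B (Suc n) (f e) = rng B n e) \<and>
        (\<forall>e\<in>edges B n. \<forall>e'\<in>edges B n. edge_less B (Suc n) (f e) (f e') \<longleftrightarrow> edge_less B n e e'))"

section \<open>Classes of vertices and condition (P)\<close>

definition mat_graph :: "nat mat \<Rightarrow> nat rel" where
  "mat_graph A = {(i, j). i < dim_row A \<and> j < dim_col A \<and> A $$ (i, j) > 0}"

definition vertex_equiv :: "nat mat \<Rightarrow> nat rel" where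
  "vertex_equiv A = {(i, j). i < dim_row A \<and> j < dim_row A \<and>
     (i = j \<or> ((i, j) \<in> (mat_graph A)\<^sup>+ \<and> (j, i) \<in> (mat_graph A)\<^sup>+))}"

definition vertex_classes :: "nat mat \<Rightarrow> nat set set" where
  "vertex_classes A = {..<dim_row A} // vertex_equiv A"

definition has_access :: "nat mat \<Rightarrow> nat set \<Rightarrow> nat set \<Rightarrow> bool" where
  "has_access A \<beta> \<alpha> \<longleftrightarrow> \<beta> = \<alpha> \<or> (\<exists>i\<in>\<beta>. \<exists>j\<in>\<alpha>. (i, j) \<in> (mat_graph A)\<^sup>+)"

definition class_block :: "nat mat \<Rightarrow> nat set \<Rightarrow> nat mat" where
  "class_block F \<alpha> = submatrix F \<alpha> \<alpha>"

definition class_radius :: "nat mat \<Rightarrow> nat set \<Rightarrow> real" where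
  "class_radius F \<alpha> = spectral_radius (map_mat of_nat (transpose_mat (class_block F \<alpha>)))"

definition distinguished :: "nat mat \<Rightarrow> nat set \<Rightarrow> bool" where
  "distinguished F \<alpha> \<longleftrightarrow>
     \<alpha> \<in> vertex_classes (transpose_mat F) \<and>
     (\<forall>\<beta>\<in>vertex_classes (transpose_mat F).
        \<beta> \<noteq> \<alpha> \<and> has_access (transpose_mat F) \<beta> \<alpha> \<longrightarrow> class_radius F \<beta> < class_radius F \<alpha>)"

definition positive_mat :: "nat mat \<Rightarrow> bool" where
  "positive_mat A \<longleftrightarrow> (\<forall>i<dim_row A. \<forall>j<dim_col A. A $$ (i, j) > 0)"

definition primitive_mat :: "nat mat \<Rightarrow> bool" where
  "primitive_mat A \<longleftrightarrow> square_mat A \<and> (\<exists>k\<ge>1. positive_mat (A ^\<^sub>m k))"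

text \<open>Block lower triangular form with diagonal blocks the matrices of the classes: the classes
  are the consecutive intervals \<open>{b \<alpha>..<b (\<alpha> + 1)}\<close>, \<open>\<alpha> < m\<close>, and precisely the first \<open>s\<close> of
  them are not accessed from any other class. \<open>Q\<close> is required of the nonzero diagonal blocks.\<close>

definition class_form :: "(nat mat \<Rightarrow> bool) \<Rightarrow> nat mat \<Rightarrow> bool" where
  "class_form Q F \<longleftrightarrow>
     (\<exists>(m::nat) (s::nat) (b :: nat \<Rightarrow> nat).
        b 0 = 0 \<and> b m = dim_row F \<and> (\<forall>\<alpha><m. b \<alpha> < b (Suc \<alpha>)) \<and> s \<le> m \<and>
        (let \<E> = (\<lambda>\<alpha>. {b \<alpha>..<b (Suc \<alpha>)}) in
           vertex_classes (transpose_mat F) = \<E> ` {..<m} \<and>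
           (\<forall>\<alpha><m. \<forall>\<beta><m. \<alpha> < \<beta> \<longrightarrow> (\<forall>v\<in>\<E> \<alpha>. \<forall>w\<in>\<E> \<beta>. F $$ (v, w) = 0)) \<and>
           (\<forall>\<alpha><m. \<alpha> < s \<longleftrightarrow> \<not> (\<exists>\<beta><m. \<beta> \<noteq> \<alpha> \<and> has_access (transpose_mat F) (\<E> \<beta>) (\<E> \<alpha>))) \<and>
           (\<forall>\<alpha><m. (\<exists>v\<in>\<E> \<alpha>. \<exists>w\<in>\<E> \<alpha>. F $$ (v, w) \<noteq> 0) \<longrightarrow> Q (class_block F (\<E> \<alpha>)))))"

definition condition_P :: "nat mat \<Rightarrow> bool" where
  "condition_P F \<longleftrightarrow> class_form primitive_mat F"

definition condition_P' :: "nat mat \<Rightarrow> bool" where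
  "condition_P' F \<longleftrightarrow> class_form positive_mat F"

section \<open>The measure of a distinguished class\<close>

definition class_eigenvector :: "(nat, 'e) bratteli \<Rightarrow> nat mat \<Rightarrow> nat set \<Rightarrow> real vec \<Rightarrow> bool" where
  "class_eigenvector B F \<alpha> \<xi> \<longleftrightarrow>
     eigenvector (map_mat real (transpose_mat F)) \<xi> (class_radius F \<alpha>) \<and>
     (\<forall>i<dim_row F. vec_index \<xi> i \<ge> 0) \<and>
     (\<forall>\<beta>\<in>vertex_classes (transpose_mat F). \<forall>i\<in>\<beta>.
        vec_index \<xi> i > 0 \<longleftrightarrow> has_access (transpose_mat F) \<beta> \<alpha>) \<and>
     (\<Sum>w\<in>verts B 1. real (root_edges B w) * vec_index \<xi> w) = 1"

definition class_measure ::
  "(nat, 'e) bratteli \<Rightarrow> nat mat \<Rightarrow> nat set \<Rightarrow> (nat \<Rightarrow> 'e) measure \<Rightarrow> bool" where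
  "class_measure B F \<alpha> M \<longleftrightarrow>
     prob_space M \<and> sets M = sets (path_borel B) \<and>
     (\<exists>\<xi>. class_eigenvector B F \<alpha> \<xi> \<and>
        (\<forall>n\<ge>1. \<forall>p\<in>fin_paths B 0 n.
           measure M (cylinder B n p) = vec_index \<xi> (rng B n (p n)) / class_radius F \<alpha> ^ (n - 1)))"

section \<open>Diamonds\<close>

definition diamond ::
  "('v, 'e) bratteli \<Rightarrow> nat \<Rightarrow> nat \<Rightarrow> (nat \<Rightarrow> 'e) \<Rightarrow> (nat \<Rightarrow> 'e) \<Rightarrow> bool" where
  "diamond B a b \<omega> \<omega>' \<longleftrightarrow>
     1 \<le> a \<and> a < b \<and> \<omega> \<in> fin_paths B a b \<and> \<omega>' \<in> fin_paths B a b \<and> \<omega> \<noteq> \<omega>' \<and>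
     src B (Suc a) (\<omega> (Suc a)) = src B (Suc a) (\<omega>' (Suc a)) \<and>
     rng B b (\<omega> b) = rng B b (\<omega>' b)"

definition passes_within ::
  "('v, 'e) bratteli \<Rightarrow> 'v set \<Rightarrow> nat \<Rightarrow> nat \<Rightarrow> (nat \<Rightarrow> 'e) \<Rightarrow> bool" where
  "passes_within B \<alpha> a b \<omega> \<longleftrightarrow>
     (\<forall>i\<in>{a<..b}. src B i (\<omega> i) \<in> \<alpha> \<and> rng B i (\<omega> i) \<in> \<alpha>)"

text \<open>The diamonds in the class \<open>\<alpha>\<close> from level \<open>a\<close> to level \<open>b\<close>; their length is \<open>b - a\<close>.\<close>

definition class_diamond ::
  "('v, 'e) bratteli \<Rightarrow> 'v set \<Rightarrow> nat \<Rightarrow> nat \<Rightarrow> (nat \<Rightarrow> 'e) \<Rightarrow> (nat \<Rightarrow> 'e) \<Rightarrow> bool" where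
  "class_diamond B \<alpha> a b \<omega> \<omega>' \<longleftrightarrow>
     diamond B a b \<omega> \<omega>' \<and> passes_within B \<alpha> a b \<omega> \<and> passes_within B \<alpha> a b \<omega>'"

definition edge_position :: "('v, 'e) bratteli \<Rightarrow> nat \<Rightarrow> 'e \<Rightarrow> nat" where
  "edge_position B n e = card {d. edge_less B n d e}"

definition shift_edge :: "('v, 'e) bratteli \<Rightarrow> nat \<Rightarrow> 'e \<Rightarrow> 'e" where
  "shift_edge B n e = (THE e'. e' \<in> edges B (Suc n) \<and> src B (Suc n) e' = src B n e \<and>
     rng B (Suc n) e' = rng B n e \<and> edge_position B (Suc n) e' = edge_position B n e)"

definition shift_path :: "('v, 'e) bratteli \<Rightarrow> nat \<Rightarrow> nat \<Rightarrow> (nat \<Rightarrow> 'e) \<Rightarrow> nat \<Rightarrow> 'e" where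
  "shift_path B a b \<omega> = (\<lambda>j\<in>{Suc a<..Suc b}. shift_edge B (j - 1) (\<omega> (j - 1)))"

primrec shift_iter :: "('v, 'e) bratteli \<Rightarrow> nat \<Rightarrow> nat \<Rightarrow> nat \<Rightarrow> (nat \<Rightarrow> 'e) \<Rightarrow> nat \<Rightarrow> 'e" where
  "shift_iter B a b 0 \<omega> = \<omega>"
| "shift_iter B a b (Suc n) \<omega> = shift_path B (a + n) (b + n) (shift_iter B a b n \<omega>)"

text \<open>The order on the paths from \<open>v\<^sub>0\<close> to a fixed vertex of level \<open>n\<close>: the last differing edge
  decides.\<close>

definition path_less :: "('v, 'e) bratteli \<Rightarrow> nat \<Rightarrow> (nat \<Rightarrow> 'e) \<Rightarrow> (nat \<Rightarrow> 'e) \<Rightarrow> bool" where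
  "path_less B n p q \<longleftrightarrow> (\<exists>i\<in>{1..n}. edge_less B i (p i) (q i) \<and> (\<forall>j\<in>{i<..n}. p j = q j))"

definition path_rank :: "('v, 'e) bratteli \<Rightarrow> nat \<Rightarrow> (nat \<Rightarrow> 'e) \<Rightarrow> nat" where
  "path_rank B n p = card {q \<in> fin_paths B 0 n. rng B n (q n) = rng B n (p n) \<and> path_less B n q p}"

text \<open>The integer \<open>P(\<omega>, \<omega>')\<close> is the number of steps of the Vershik map that carries \<open>\<tau>\<omega>z\<close> to
  \<open>\<tau>\<omega>'z\<close> for every infinite continuation \<open>z\<close> in the domain, that is, the signed number of
  steps from \<open>\<tau>\<omega>\<close> to \<open>\<tau>\<omega>'\<close> in the order of the paths from \<open>v\<^sub>0\<close> to the common range. The equality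
  of sets \<open>\<phi>\<^sup>P[\<tau>\<omega>] = [\<tau>\<omega>']\<close> alone does not determine \<open>P\<close>: in the dyadic odometer \<open>\<phi>\<close> and
  \<open>\<phi>\<^sup>-\<^sup>1\<close> both map \<open>[0]\<close> onto \<open>[1]\<close>.\<close>

definition diamond_steps ::
  "('v, 'e) bratteli \<Rightarrow> nat \<Rightarrow> nat \<Rightarrow> (nat \<Rightarrow> 'e) \<Rightarrow> (nat \<Rightarrow> 'e) \<Rightarrow> int" where
  "diamond_steps B a b \<omega> \<omega>' = (THE d. \<forall>\<tau>\<in>fin_paths B 0 a.
     rng B a (\<tau> a) = src B (Suc a) (\<omega> (Suc a)) \<longrightarrow>
     d = int (path_rank B b (path_append a \<tau> \<omega>')) - int (path_rank B b (path_append a \<tau> \<omega>)))"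

definition diamond_steps_shift ::
  "('v, 'e) bratteli \<Rightarrow> nat \<Rightarrow> nat \<Rightarrow> nat \<Rightarrow> (nat \<Rightarrow> 'e) \<Rightarrow> (nat \<Rightarrow> 'e) \<Rightarrow> int" where
  "diamond_steps_shift B n a b \<omega> \<omega>' =
     diamond_steps B (a + n) (b + n) (shift_iter B a b n \<omega>) (shift_iter B a b n \<omega>')"

end

theory Submission
  imports
    Defs
    "HOL-Computational_Algebra.Fundamental_Theorem_Algebra"
begin

text \<open>The rank of a path to a fixed vertex is a sum of weights of its edges, and the Vershik map
  raises the rank by one. Hence \<open>P\<close> of a diamond is a difference of sums of edge weights, and by
  stationarity \<open>P\<^sub>n\<close> is an integer combination of entries of the path count vectors, which satisfy
  the linear recurrence given by the characteristic polynomial of \<open>F\<close>.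

  If \<open>f\<close> is an eigenfunction, take a set \<open>A\<close> of positive measure on which \<open>f\<close> is almost constant.
  By primitivity of the class, for every large \<open>n\<close> and every vertex of the class some path to this
  vertex at level \<open>n\<close> has a cylinder that is almost filled by \<open>A\<close>; so exchanging the two sides of
  the shifted diamond maps some point of \<open>A\<close> to \<open>A\<close>, and \<open>\<gamma>\<close> to the power \<open>P\<^sub>n\<close> is close to \<open>1\<close>.

  Conversely, if these powers tend to \<open>1\<close>, the recurrence forces them to do so geometrically
  fast, and \<open>f x\<close> is obtained as the limit over \<open>n\<close> of \<open>\<gamma>\<close> to the number of steps from a reference
  path in the class to the initial segment of \<open>x\<close>.\<close>

text \<open>Mere convergence of the powers is not enough for the converse, because the limit that
  defines \<open>f\<close> needs summable increments. All increments come from finitely many pairs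
  of class paths of one fixed length, moved up by the vertical shift, so geometric decay for each
  pair suffices. Decay is obtained by splitting off the complex roots of the characteristic
  polynomial one at a time: a root inside the unit disc damps the sequence, and for a root of
  modulus at least 1 the recurrence is solved backwards from infinity, where the sequence is known
  to vanish. The modulus of \<gamma> is not prescribed; it is forced to be 1 by a diamond of the
  class, which exists because aperiodicity gives \<rho> > 1.

  In the other direction the dense cylinder must end at the source of the given diamond, on every
  large level, and this vertex cannot be chosen. The measure of a cylinder depends only on its
  length and end vertex, so an extension by boundedly many edges keeps a fixed proportion of it. A
  defect of \<open>A\<close> at one vertex of the class on infinitely many levels would therefore
  take a fixed proportion out of every cylinder and make \<open>A\<close> null.\<close>

section \<open>Linear recurrences\<close>

text \<open>The \<open>n\<close>-th term of p(S) s, where S is the shift operator on sequences.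
  Sequences become a module over the polynomials, and \<open>seq_apply p s = 0\<close> is the linear
  recurrence with characteristic polynomial \<open>p\<close>.\<close>

definition seq_apply :: "'a::comm_ring_1 poly \<Rightarrow> (nat \<Rightarrow> 'a) \<Rightarrow> nat \<Rightarrow> 'a" where
  "seq_apply p s n = (\<Sum>k\<le>degree p. coeff p k * s (n + k))"

lemma seq_apply_ge:
  assumes "degree p \<le> d"
  shows "seq_apply p s n = (\<Sum>k\<le>d. coeff p k * s (n + k))"
  unfolding seq_apply_def
  by (rule sum.mono_neutral_left) (use assms in \<open>auto simp: coeff_eq_0\<close>)

lemma seq_apply_0 [simp]: "seq_apply 0 s n = 0"
  by (simp add: seq_apply_def)

lemma seq_apply_pCons: "seq_apply (pCons a p) s n = a * s n + seq_apply p s (Suc n)"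
proof -
  have "seq_apply (pCons a p) s n = (\<Sum>k\<le>Suc (degree p). coeff (pCons a p) k * s (n + k))"
    by (rule seq_apply_ge) (simp add: degree_pCons_le)
  also have "\<dots> = a * s n + seq_apply p s (Suc n)"
    by (subst sum.atMost_Suc_shift) (simp add: seq_apply_def)
  finally show ?thesis .
qed

lemma seq_apply_const: "seq_apply [:c:] s n = c * s n"
  by (simp add: seq_apply_pCons)

lemma seq_apply_add: "seq_apply (p + q) s n = seq_apply p s n + seq_apply q s n"
proof -
  define d where "d = max (degree p) (degree q)"
  have "degree (p + q) \<le> d" "degree p \<le> d" "degree q \<le> d"
    by (auto simp: d_def degree_add_le_max)
  then show ?thesis
    by (simp add: seq_apply_ge algebra_simps sum.distrib)
qed

lemma seq_apply_smult: "seq_apply (Polynomial.smult c p) s n = c * seq_apply p s n"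
proof -
  have "seq_apply (Polynomial.smult c p) s n = (\<Sum>k\<le>degree p. coeff (Polynomial.smult c p) k * s (n + k))"
    by (rule seq_apply_ge) (rule degree_smult_le)
  then show ?thesis by (simp add: seq_apply_def sum_distrib_left algebra_simps)
qed

lemma seq_apply_sum: "seq_apply (\<Sum>i\<in>I. p i) s n = (\<Sum>i\<in>I. seq_apply (p i) s n)"
  by (induction I rule: infinite_finite_induct) (simp_all add: seq_apply_add)

text \<open>Products of polynomials act as compositions of operators, so a recurrence can be treated
  one linear factor at a time.\<close>

lemma seq_apply_mult: "seq_apply (p * q) s n = seq_apply p (seq_apply q s) n"
proof (induction p arbitrary: n)
  case (pCons a p)
  then show ?case
    by (simp add: seq_apply_pCons seq_apply_add seq_apply_smult)
qed simp

lemma seq_apply_linear: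
  "seq_apply p (\<lambda>n. a * s n + b * t n) n = a * seq_apply p s n + b * seq_apply p t n"
  by (simp add: seq_apply_def sum_distrib_left sum.distrib algebra_simps)

lemma seq_apply_sum_right:
  "seq_apply p (\<lambda>n. \<Sum>i\<in>I. s i n) n = (\<Sum>i\<in>I. seq_apply p (s i) n)"
  unfolding seq_apply_def by (simp add: sum_distrib_left sum.swap[of _ I])

text \<open>Links the two roles of the characteristic polynomial: over the complex numbers it has
  roots, over the integers it keeps integer sequences integral.\<close>

lemma seq_apply_map_of_int:
  "seq_apply (map_poly of_int p :: 'a :: {comm_ring_1,ring_char_0} poly) (\<lambda>n. of_int (s n)) n
     = of_int (seq_apply p s n)"
  by (simp add: seq_apply_def)

lemma seq_apply_offset: "seq_apply p (\<lambda>n. s (n + k)) n = seq_apply p s (n + k)"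
  by (simp add: seq_apply_def add.commute add.left_commute)

lemma seq_apply_tendsto_0:
  fixes s :: "nat \<Rightarrow> 'a :: {comm_ring_1, real_normed_algebra}"
  assumes "s \<longlonglongrightarrow> 0"
  shows "seq_apply p s \<longlonglongrightarrow> 0"
proof -
  have "(\<lambda>n. \<Sum>k\<le>degree p. coeff p k * s (n + k)) \<longlonglongrightarrow> (\<Sum>k\<le>degree p. coeff p k * 0)"
    by (intro tendsto_sum tendsto_mult tendsto_const LIMSEQ_ignore_initial_segment[OF assms])
  then show ?thesis by (simp add: seq_apply_def[abs_def])
qed

text \<open>The shift \<open>S\<close> acts on the sequence \<open>h\<close> by the matrix \<open>A\<close>, so multiplying \<open>(S - A) h = 0\<close> by
  the adjugate of \<open>S - A\<close> gives the Cayley--Hamilton relation.\<close>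

lemma seq_apply_char_poly:
  fixes A :: "'a::comm_ring_1 mat"
  assumes A: "A \<in> carrier_mat N N"
    and rec: "\<And>n v. v < N \<Longrightarrow> h (Suc n) v = (\<Sum>w<N. A $$ (v, w) * h n w)"
    and u: "u < N"
  shows "seq_apply (char_poly A) (\<lambda>n. h n u) n = 0"
proof -
  define C where "C = char_poly_matrix A"
  have C: "C \<in> carrier_mat N N" using A by (simp add: C_def)
  have Cvw: "C $$ (v, w) = [:0,1:] * [:of_bool (v = w):] + [:- (A $$ (v, w)):]"
    if "v < N" "w < N" for v w
    using A that by (auto simp: C_def char_poly_matrix_def)
  \<comment> \<open>Row \<open>v\<close> of (S - A) h = 0, with the entries of the characteristic
    matrix read as operators on sequences.\<close>
  have row: "(\<Sum>w<N. seq_apply (C $$ (v, w)) (\<lambda>n. h n w) n) = 0" if v: "v < N" for v n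
  proof -
    have "(\<Sum>w<N. seq_apply (C $$ (v, w)) (\<lambda>n. h n w) n)
        = (\<Sum>w<N. of_bool (v = w) * h (Suc n) w - A $$ (v, w) * h n w)"
      by (rule sum.cong)
        (use v in \<open>auto simp: Cvw seq_apply_add seq_apply_mult seq_apply_pCons seq_apply_const\<close>)
    also have "\<dots> = h (Suc n) v - (\<Sum>w<N. A $$ (v, w) * h n w)"
      using v by (simp add: sum_subtractf of_bool_def if_distrib[of "\<lambda>x. x * _"] cong: if_cong)
    finally show ?thesis using rec[OF v] by simp
  qed
  let ?D = "adj_mat C"
  have D: "?D \<in> carrier_mat N N" "?D * C = det C \<cdot>\<^sub>m 1\<^sub>m N" using adj_mat[OF C] by auto
  have DC: "(\<Sum>v<N. ?D $$ (u, v) * C $$ (v, w)) = (if u = w then char_poly A else 0)" if "w < N" for w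
  proof -
    have "(\<Sum>v<N. ?D $$ (u, v) * C $$ (v, w)) = (?D * C) $$ (u, w)"
      using D(1) C that u by (auto simp: scalar_prod_def atLeast0LessThan intro!: sum.cong)
    also have "\<dots> = (if u = w then char_poly A else 0)"
      unfolding D(2) using that u by (auto simp: char_poly_def C_def)
    finally show ?thesis .
  qed
  have "seq_apply (char_poly A) (\<lambda>n. h n u) n
      = (\<Sum>w<N. seq_apply (if u = w then char_poly A else 0) (\<lambda>n. h n w) n)"
    using u by (simp add: if_distrib[of "\<lambda>x. seq_apply x _ _"] cong: if_cong)
  also have "\<dots> = (\<Sum>w<N. seq_apply (\<Sum>v<N. ?D $$ (u, v) * C $$ (v, w)) (\<lambda>n. h n w) n)"
    by (rule sum.cong) (simp_all add: DC)
  also have "\<dots> = (\<Sum>w<N. \<Sum>v<N. seq_apply (?D $$ (u, v)) (seq_apply (C $$ (v, w)) (\<lambda>n. h n w)) n)"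
    by (simp add: seq_apply_sum seq_apply_mult)
  also have "\<dots> = (\<Sum>v<N. seq_apply (?D $$ (u, v)) (\<lambda>n. \<Sum>w<N. seq_apply (C $$ (v, w)) (\<lambda>n. h n w) n) n)"
    unfolding seq_apply_sum_right by (rule sum.swap)
  also have "\<dots> = 0" by (simp add: row seq_apply_def[of "adj_mat C $$ _"])
  finally show ?thesis .
qed

section \<open>Geometric decay of null sequences that satisfy a recurrence\<close>

definition geometric_decay :: "(nat \<Rightarrow> complex) \<Rightarrow> bool" where
  "geometric_decay s \<longleftrightarrow> (\<exists>C r. 0 < r \<and> r < 1 \<and> (\<forall>n. norm (s n) \<le> C * r ^ n))"

text \<open>The finitely many exceptional terms are absorbed into the constant.\<close>

lemma geometric_decayI_eventually:
  assumes "0 < r" "r < 1" "\<forall>\<^sub>F n in sequentially. norm (s n) \<le> C * r ^ n"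
  shows "geometric_decay s"
proof -
  obtain N where N: "\<And>n. n \<ge> N \<Longrightarrow> norm (s n) \<le> C * r ^ n"
    using assms(3) by (auto simp: eventually_sequentially)
  define C' where "C' = \<bar>C\<bar> + (\<Sum>k<N. norm (s k) / r ^ k)"
  have S: "(\<Sum>k<N. norm (s k) / r ^ k) \<ge> 0" using assms by (intro sum_nonneg) auto
  have "norm (s n) \<le> C' * r ^ n" for n
  proof (cases "n < N")
    case True
    have "norm (s n) / r ^ n \<le> (\<Sum>k<N. norm (s k) / r ^ k)"
      by (rule member_le_sum) (use True assms in auto)
    then have "norm (s n) / r ^ n \<le> C'" by (simp add: C'_def)
    then show ?thesis using assms by (simp add: field_simps)
  next
    case False
    then have "norm (s n) \<le> C * r ^ n" using N by simp
    also have "\<dots> \<le> C' * r ^ n" using assms S by (intro mult_right_mono) (auto simp: C'_def)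
    finally show ?thesis .
  qed
  then show ?thesis using assms unfolding geometric_decay_def by blast
qed

text \<open>The case of one linear factor S - z. If z lies inside the unit disc, the recurrence is
  solved forwards. Otherwise the forward solution could grow, but since s tends to 0 it can be
  solved backwards: s n is bounded by the sum of all later errors, a geometric tail.\<close>

lemma geometric_decay_step:
  assumes decay: "geometric_decay (\<lambda>n. s (Suc n) - z * s n)" and lim: "s \<longlonglongrightarrow> 0"
  shows "geometric_decay s"
proof -
  obtain C r where r: "0 < r" "r < 1" and C: "\<And>n. norm (s (Suc n) - z * s n) \<le> C * r ^ n"
    using decay by (auto simp: geometric_decay_def)
  have C0: "C \<ge> 0" using order_trans[OF norm_ge_zero C[of 0]] by simp
  show ?thesis
  proof (cases "norm z < 1")
    case True
    define q where "q = max r (norm z)"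
    \<comment> \<open>Strictly larger than both rates, to cover the resonant case
      \<open>norm z = r\<close>, where terms like \<open>n * r ^ n\<close> occur. The constant
      \<open>C'\<close> is then chosen to make \<open>C + q * C' \<le> C' * q'\<close>.\<close>
    define q' where "q' = (1 + q) / 2"
    have q: "0 < q" "q < 1" "r \<le> q" "norm z \<le> q" using r True by (auto simp: q_def)
    then have q': "0 < q'" "q' < 1" "q < q'" by (auto simp: q'_def)
    define C' where "C' = max (norm (s 0)) (C / (q' - q))"
    have C': "C \<le> C' * (q' - q)"
      using q' by (simp add: C'_def pos_divide_le_eq[symmetric])
    have "norm (s n) \<le> C' * q' ^ n" for n
    proof (induction n)
      case 0 then show ?case by (simp add: C'_def)
    next
      case (Suc n)
      have "norm (s (Suc n)) \<le> norm (s (Suc n) - z * s n) + norm (z * s n)"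
        using norm_triangle_ineq[of "s (Suc n) - z * s n" "z * s n"] by simp
      also have "\<dots> \<le> C * r ^ n + norm z * norm (s n)" using C[of n] by (simp add: norm_mult)
      also have "\<dots> \<le> C * q' ^ n + q * (C' * q' ^ n)"
        using r q q' Suc C0 by (intro add_mono mult_mono mult_left_mono power_mono) auto
      also have "\<dots> = (C + q * C') * q' ^ n" by (simp add: algebra_simps)
      also have "\<dots> \<le> (C' * q') * q' ^ n"
        using C' q' by (intro mult_right_mono) (auto simp: algebra_simps)
      finally show ?case by (simp add: algebra_simps)
    qed
    then show ?thesis using q' unfolding geometric_decay_def by blast
  next
    case False
    have step: "norm (s n) \<le> norm (s (Suc n)) + C * r ^ n" for n
    proof -
      have "norm (s n) \<le> norm (z * s n)" using False by (simp add: norm_mult mult_le_cancel_right1)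
      also have "\<dots> \<le> norm (s (Suc n)) + norm (s (Suc n) - z * s n)"
        using norm_triangle_ineq4[of "s (Suc n)" "s (Suc n) - z * s n"] by simp
      finally show ?thesis using C[of n] by simp
    qed
    have many: "norm (s n) \<le> norm (s (n + m)) + C * r ^ n / (1 - r) * (1 - r ^ m)" for n m
    proof (induction m)
      case (Suc m)
      have "C * r ^ n / (1 - r) * (1 - r ^ m) + C * r ^ (n + m) = C * r ^ n / (1 - r) * (1 - r ^ Suc m)"
        using r by (simp add: field_simps power_add)
      then show ?case using Suc step[of "n + m"] by simp
    qed simp
    have "norm (s n) \<le> C / (1 - r) * r ^ n" for n
    proof (rule LIMSEQ_le_const)
      have "(\<lambda>m. norm (s (n + m)) + C * r ^ n / (1 - r) * (1 - r ^ m)) \<longlonglongrightarrow> norm (0::complex) + C * r ^ n / (1 - r) * (1 - 0)"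
        using LIMSEQ_ignore_initial_segment[OF lim, of n] r
        by (intro tendsto_intros LIMSEQ_power_zero) (auto simp: add.commute)
      then show "(\<lambda>m. norm (s (n + m)) + C * r ^ n / (1 - r) * (1 - r ^ m)) \<longlonglongrightarrow> C / (1 - r) * r ^ n"
        by (simp add: field_simps)
    qed (use many in auto)
    then show ?thesis using r unfolding geometric_decay_def by blast
  qed
qed

text \<open>Induction on the degree. A complex root z gives p = (S - z) q; the sequence (S - z) s is
  again null, so the induction hypothesis for q shows that it decays, and
  \<open>geometric_decay_step\<close> passes this on to s.\<close>

lemma geometric_decay_recurrence:
  assumes "p \<noteq> 0" "geometric_decay (seq_apply p s)" "s \<longlonglongrightarrow> 0"
  shows "geometric_decay s"
  using assms
proof (induction "degree p" arbitrary: p s)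
  case 0
  then obtain c where p: "p = [:c:]" "c \<noteq> 0" by (metis degree_eq_zeroE pCons_0_0)
  then obtain C r where r: "0 < r" "r < 1" "\<And>n. norm (c * s n) \<le> C * r ^ n"
    using 0 by (auto simp: geometric_decay_def seq_apply_const)
  have "norm (s n) \<le> C / norm c * r ^ n" for n
    using r(3)[of n] p(2) by (simp add: norm_mult field_simps)
  then show ?case using r unfolding geometric_decay_def by blast
next
  case (Suc d)
  have "\<not> constant (poly p)" using Suc by (simp add: constant_degree)
  then obtain z where "poly p z = 0" using fundamental_theorem_of_algebra by blast
  then obtain q where p: "p = [:-z, 1:] * q" by (auto simp: poly_eq_0_iff_dvd dvd_def)
  have q: "q \<noteq> 0" using Suc p by auto
  then have "degree p = degree [:-z, 1:] + degree q" unfolding p by (intro degree_mult_eq) auto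
  then have d: "degree q = d" using Suc(2) by simp
  define t where "t = seq_apply [:-z, 1:] s"
  have t: "t = (\<lambda>n. s (Suc n) - z * s n)" by (auto simp: t_def seq_apply_pCons)
  have "seq_apply p s = seq_apply q t" by (metis ext p seq_apply_mult t_def mult.commute)
  moreover have "t \<longlonglongrightarrow> 0" unfolding t_def using Suc by (intro seq_apply_tendsto_0)
  ultimately have "geometric_decay t" using Suc q d by metis
  then show ?case using geometric_decay_step Suc t by metis
qed

text \<open>With \<open>\<gamma> = exp g\<close>, the sequence \<open>Ln (\<gamma> ^ P n)\<close> differs from \<open>g * P n\<close> by integer multiples of
  \<open>2 \<pi> \<i>\<close>; the recurrence applied to it gives integer multiples of \<open>2 \<pi> \<i>\<close> that tend to \<open>0\<close>,
  hence vanish eventually.\<close>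

lemma powi_geometric_decay:
  fixes P :: "nat \<Rightarrow> int" and p :: "int poly" and \<gamma> :: complex
  assumes p: "p \<noteq> 0" and rec: "\<And>n. seq_apply p P n = 0" and \<gamma>: "\<gamma> \<noteq> 0"
    and lim: "(\<lambda>n. \<gamma> powi P n) \<longlonglongrightarrow> 1"
  shows "geometric_decay (\<lambda>n. \<gamma> powi P n - 1)"
proof -
  define e where "e = (\<lambda>n. Ln (\<gamma> powi P n))"
  define g where "g = Ln \<gamma>"
  \<comment> \<open>The branch cut of \<open>Ln\<close> stays away from 1, so the logarithms of the
    powers tend to 0.\<close>
  have "isCont Ln 1" by (rule continuous_at_Ln) auto
  then have e0: "e \<longlonglongrightarrow> 0"
    unfolding e_def using isCont_tendsto_compose[OF _ lim] by fastforce
  have exp_e: "exp (e n) = \<gamma> powi P n" for n using \<gamma> by (simp add: e_def)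
  have "\<exists>k::int. e n = of_int (P n) * g + of_int k * (2 * pi * \<i>)" for n
  proof -
    have "exp (e n) = exp (of_int (P n) * g)"
      unfolding exp_power_int[symmetric] using \<gamma> by (simp add: exp_e g_def)
    then obtain k :: int where "e n = of_int (P n) * g + (of_int (2 * k) * pi) * \<i>"
      using exp_eq by blast
    then show ?thesis by (intro exI[of _ k]) (simp add: algebra_simps)
  qed
  then obtain k :: "nat \<Rightarrow> int" where k: "\<And>n. e n = g * of_int (P n) + 2 * pi * \<i> * of_int (k n)"
    by (metis mult.commute)
  let ?p = "map_poly of_int p :: complex poly"
  have pe: "seq_apply ?p e n = 2 * pi * \<i> * of_int (seq_apply p k n)" for n
  proof -
    have "seq_apply ?p e n = g * of_int (seq_apply p P n) + 2 * pi * \<i> * of_int (seq_apply p k n)"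
      by (simp only: k seq_apply_linear seq_apply_map_of_int ext[of e "\<lambda>n. g * of_int (P n) + 2 * pi * \<i> * of_int (k n)"])
    then show ?thesis by (simp add: rec)
  qed
  have "seq_apply ?p e \<longlonglongrightarrow> 0" by (rule seq_apply_tendsto_0[OF e0])
  then have "\<forall>\<^sub>F n in sequentially. norm (seq_apply ?p e n) < 1"
    by (auto simp: tendsto_iff dist_norm elim!: allE[of _ "1::real"])
  \<comment> \<open>An integer multiple of \<open>2 * pi * \<i>\<close> of norm below 1 is 0. The
    bound with constant 0 is eventual vanishing, put in the form of
    \<open>geometric_decayI_eventually\<close>.\<close>
  then have "\<forall>\<^sub>F n in sequentially. norm (seq_apply ?p e n) \<le> 0 * (1/2) ^ n"
  proof eventually_elim
    case (elim n)
    have "2 * pi * \<bar>real_of_int (seq_apply p k n)\<bar> < 1"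
      using elim by (simp add: pe norm_mult)
    moreover have "2 * pi > 1" using pi_gt3 by simp
    ultimately have "\<bar>real_of_int (seq_apply p k n)\<bar> < 1"
      by (smt (verit, best) mult_less_cancel_right1)
    then have "seq_apply p k n = 0" by linarith
    then show ?case by (simp add: pe)
  qed
  then have "geometric_decay (seq_apply ?p e)"
    by (rule geometric_decayI_eventually[rotated 2]) auto
  then have "geometric_decay e"
    by (rule geometric_decay_recurrence[rotated]) (use p e0 in auto)
  then obtain C r where r: "0 < r" "r < 1" and C: "\<And>n. norm (e n) \<le> C * r ^ n"
    by (auto simp: geometric_decay_def)
  have "\<forall>\<^sub>F n in sequentially. norm (e n) < 1"
    using e0 by (auto simp: tendsto_iff dist_norm elim!: allE[of _ "1::real"])
  then have "\<forall>\<^sub>F n in sequentially. norm (\<gamma> powi P n - 1) \<le> (3 * C) * r ^ n"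
  proof eventually_elim
    case (elim n)
    \<comment> \<open>The factor 3 bounds \<open>exp 1\<close>, since
      \<open>norm (e n) < 1\<close>.\<close>
    have "norm (exp (e n) - 1) \<le> exp (norm (e n)) * norm (e n)"
      using Taylor_exp_field[of "e n" 0] by simp
    also have "\<dots> \<le> 3 * norm (e n)"
      using elim exp_le by (intro mult_right_mono order_trans[OF _ exp_le]) auto
    finally have "norm (exp (e n) - 1) \<le> 3 * norm (e n)" .
    then show ?case using C[of n] by (simp add: exp_e)
  qed
  then show ?thesis using r by (intro geometric_decayI_eventually)
qed

section \<open>Ranks of paths\<close>

text \<open>The number of paths from the root to \<open>v\<close> (see
  \<open>card_paths_to\<close>), given by the recursion on which the incidence matrix acts.\<close>

primrec path_count :: "('v, 'e) bratteli \<Rightarrow> nat \<Rightarrow> 'v \<Rightarrow> nat" where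
  "path_count B 0 v = 1"
| "path_count B (Suc n) v = (\<Sum>e\<in>edges_into B (Suc n) v. path_count B n (src B (Suc n) e))"

text \<open>Counts the paths from the root whose last edge precedes \<open>e\<close>. All of them
  come before every path that ends with \<open>e\<close>, because the last differing edge
  decides.\<close>

definition edge_weight :: "('v, 'e) bratteli \<Rightarrow> nat \<Rightarrow> 'e \<Rightarrow> nat" where
  "edge_weight B i e = (\<Sum>d | edge_less B i d e. path_count B (i - 1) (src B i d))"

definition path_weight :: "('v, 'e) bratteli \<Rightarrow> nat \<Rightarrow> nat \<Rightarrow> (nat \<Rightarrow> 'e) \<Rightarrow> nat" where
  "path_weight B a b x = (\<Sum>i\<in>{a<..b}. edge_weight B i (x i))"

text \<open>In contrast to \<open>fin_paths\<close>, nothing is said about values outside the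
  interval of levels, so infinite paths and concatenations can be used directly as finite
  paths.\<close>

definition path_on :: "('v, 'e) bratteli \<Rightarrow> nat \<Rightarrow> nat \<Rightarrow> (nat \<Rightarrow> 'e) \<Rightarrow> bool" where
  "path_on B a b x \<longleftrightarrow> (\<forall>i\<in>{a<..b}. x i \<in> edges B i) \<and>
     (\<forall>i. a < i \<and> i < b \<longrightarrow> rng B i (x i) = src B (Suc i) (x (Suc i)))"

text \<open>At level 0 there is no last edge whose range could be compared with \<open>v\<close>;
  the empty path is counted there for every \<open>v\<close>.\<close>

definition paths_to :: "('v, 'e) bratteli \<Rightarrow> nat \<Rightarrow> 'v \<Rightarrow> (nat \<Rightarrow> 'e) set" where
  "paths_to B n v = {p \<in> fin_paths B 0 n. n = 0 \<or> rng B n (p n) = v}"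

lemma fin_paths_iff: "p \<in> fin_paths B a b \<longleftrightarrow> path_on B a b p \<and> p \<in> extensional {a<..b}"
  by (auto simp: fin_paths_def path_on_def PiE_iff)

lemma inf_paths_iff: "x \<in> inf_paths B \<longleftrightarrow> (\<forall>n. path_on B 0 n x) \<and> x \<in> extensional {1..}"
proof (intro iffI conjI)
  assume "(\<forall>n. path_on B 0 n x) \<and> x \<in> extensional {1..}"
  then have on: "path_on B 0 n x" and x: "x \<in> extensional {1..}" for n by auto
  have "x i \<in> edges B i \<and> rng B i (x i) = src B (Suc i) (x (Suc i))" if "i \<ge> 1" for i
    using on[of "Suc i"] that by (auto simp: path_on_def)
  then show "x \<in> inf_paths B" using x by (auto simp: inf_paths_def PiE_iff)
qed (auto simp: inf_paths_def path_on_def PiE_iff)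

lemma path_on_subset: "path_on B a b x \<Longrightarrow> a \<le> a' \<Longrightarrow> b' \<le> b \<Longrightarrow> path_on B a' b' x"
  by (auto simp: path_on_def)

lemma path_on_cong: "(\<And>i. a < i \<Longrightarrow> i \<le> b \<Longrightarrow> x i = y i) \<Longrightarrow> path_on B a b x \<longleftrightarrow> path_on B a b y"
  by (auto simp: path_on_def)

lemma path_on_Suc:
  assumes "a \<le> n"
  shows "path_on B a (Suc n) x \<longleftrightarrow> path_on B a n x \<and> x (Suc n) \<in> edges B (Suc n) \<and>
           (a < n \<longrightarrow> rng B n (x n) = src B (Suc n) (x (Suc n)))"
  using assms by (auto simp: path_on_def less_Suc_eq le_Suc_eq)

lemma path_on_append:
  assumes "path_on B a b x" "path_on B b c y" "a \<le> b" "b \<le> c"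
    and "a < b \<Longrightarrow> b < c \<Longrightarrow> rng B b (x b) = src B (Suc b) (y (Suc b))"
  shows "path_on B a c (path_append b x y)"
  using assms unfolding path_on_def path_append_def
  by (auto simp: not_le) (metis leD le_less_Suc_eq less_Suc_eq not_less_eq_eq nat_less_le)

lemma path_weight_refl [simp]: "path_weight B a a x = 0"
  by (simp add: path_weight_def)

lemma path_weight_Suc:
  "a \<le> n \<Longrightarrow> path_weight B a (Suc n) x = path_weight B a n x + edge_weight B (Suc n) (x (Suc n))"
proof -
  assume "a \<le> n"
  then have "{a<..Suc n} = insert (Suc n) {a<..n}" by auto
  then show ?thesis by (simp add: path_weight_def)
qed

lemma path_weight_split:
  assumes "a \<le> b" "b \<le> c"
  shows "path_weight B a c x = path_weight B a b x + path_weight B b c x"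
proof -
  have "{a<..c} = {a<..b} \<union> {b<..c}" using assms by auto
  then show ?thesis unfolding path_weight_def by (simp add: sum.union_disjoint)
qed

lemma path_weight_cong:
  "(\<And>i. a < i \<Longrightarrow> i \<le> b \<Longrightarrow> x i = y i) \<Longrightarrow> path_weight B a b x = path_weight B a b y"
  by (simp add: path_weight_def)

lemma path_weight_append:
  assumes "a \<le> b"
  shows "path_weight B 0 b (path_append a x y) = path_weight B 0 a x + path_weight B a b y"
proof -
  have "path_weight B 0 a (path_append a x y) = path_weight B 0 a x"
    "path_weight B a b (path_append a x y) = path_weight B a b y"
    by (intro path_weight_cong; simp add: path_append_def)+
  then show ?thesis using path_weight_split[of 0 a b B "path_append a x y"] assms by simp
qed

locale ordered_bratteli =
  fixes B :: "('v, 'e) bratteli"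
  assumes ordered: "ordered_diagram B"
begin

lemma bratteli: "bratteli_diagram B"
  using ordered by (simp add: ordered_diagram_def)

lemma finite_verts [simp]: "finite (verts B n)"
  using bratteli by (simp add: bratteli_diagram_def)

lemma finite_edges: "n \<ge> 1 \<Longrightarrow> finite (edges B n)"
  using bratteli by (simp add: bratteli_diagram_def)

lemma rng_in: "n \<ge> 1 \<Longrightarrow> e \<in> edges B n \<Longrightarrow> rng B n e \<in> verts B n"
  using bratteli by (auto simp: bratteli_diagram_def)

lemma src_in: "n \<ge> 1 \<Longrightarrow> e \<in> edges B n \<Longrightarrow> src B n e \<in> verts B (n - 1)"
  using bratteli by (auto simp: bratteli_diagram_def)

lemma incoming_edge:
  assumes "n \<ge> 1" "v \<in> verts B n"
  obtains e where "e \<in> edges B n" "rng B n e = v"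
  using bratteli assms unfolding bratteli_diagram_def by (metis imageE)

lemma edge_order:
  assumes "n \<ge> 1" "v \<in> verts B n"
  shows "linear_order_on (edges_into B n v) (edge_ord B n v)"
  using ordered assms by (simp add: ordered_diagram_def)

lemma edge_less_edges:
  assumes "edge_less B n e e'"
  shows "e \<in> edges B n" "e' \<in> edges B n" "rng B n e = rng B n e'"
  using assms by (auto simp: edge_less_def)

lemma edge_less_irrefl [simp]: "\<not> edge_less B n e e"
  by (simp add: edge_less_def)

lemma edge_less_trans:
  assumes "n \<ge> 1" "edge_less B n c d" "edge_less B n d e"
  shows "edge_less B n c e"
proof -
  let ?v = "rng B n d" let ?r = "edge_ord B n ?v"
  have v: "?v \<in> verts B n" using assms by (metis edge_less_edges(1) rng_in)
  have "linear_order_on (edges_into B n ?v) ?r" by (rule edge_order[OF assms(1) v])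
  then have "trans ?r" "antisym ?r"
    by (auto simp: linear_order_on_def partial_order_on_def preorder_on_def)
  moreover have "(c, d) \<in> ?r" "(d, e) \<in> ?r" "c \<noteq> d" using assms by (auto simp: edge_less_def)
  ultimately have "(c, e) \<in> ?r" "c \<noteq> e" by (auto dest: transD antisymD)
  then show ?thesis using assms by (auto simp: edge_less_def)
qed

lemma edge_less_total:
  assumes "n \<ge> 1" "e \<in> edges B n" "e' \<in> edges B n" "rng B n e = rng B n e'" "e \<noteq> e'"
  shows "edge_less B n e e' \<or> edge_less B n e' e"
proof -
  have "total_on (edges_into B n (rng B n e)) (edge_ord B n (rng B n e))"
    using edge_order[OF assms(1) rng_in[OF assms(1,2)]] by (simp add: linear_order_on_def)
  then show ?thesis using assms by (auto simp: edge_less_def total_on_def edges_into_def)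
qed

lemma finite_edge_less: "n \<ge> 1 \<Longrightarrow> finite {d. edge_less B n d e}"
  by (rule finite_subset[OF _ finite_edges[of n]]) (auto simp: edge_less_def)

lemma finite_edges_into: "n \<ge> 1 \<Longrightarrow> finite (edges_into B n v)"
  using finite_edges by (simp add: edges_into_def)

text \<open>The gap has room for all paths that end with \<open>d\<close>. Together with
  \<open>path_weight_less\<close> this prevents lower edges from outweighing the last differing
  edge.\<close>

lemma edge_weight_less:
  assumes "edge_less B (Suc n) d e"
  shows "edge_weight B (Suc n) d + path_count B n (src B (Suc n) d) \<le> edge_weight B (Suc n) e"
proof -
  have "(\<Sum>c\<in>insert d {c. edge_less B (Suc n) c d}. path_count B n (src B (Suc n) c))
      \<le> (\<Sum>c | edge_less B (Suc n) c e. path_count B n (src B (Suc n) c))"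
    using assms edge_less_trans[of "Suc n"] by (intro sum_mono2 finite_edge_less) auto
  then show ?thesis by (simp add: edge_weight_def finite_edge_less)
qed

lemma edge_weight_bound:
  assumes "e \<in> edges B (Suc n)"
  shows "edge_weight B (Suc n) e + path_count B n (src B (Suc n) e)
     \<le> path_count B (Suc n) (rng B (Suc n) e)"
proof -
  have "(\<Sum>c\<in>insert e {c. edge_less B (Suc n) c e}. path_count B n (src B (Suc n) c))
      \<le> (\<Sum>c\<in>edges_into B (Suc n) (rng B (Suc n) e). path_count B n (src B (Suc n) c))"
    using assms by (intro sum_mono2 finite_edges_into) (auto simp: edges_into_def edge_less_def)
  then show ?thesis by (simp add: edge_weight_def finite_edge_less)
qed

text \<open>Below a maximal edge, together with it, lie all edges with the same range, so
  \<open>edge_weight_bound\<close> becomes an equality.\<close>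

lemma edge_weight_max:
  assumes "max_edge B (Suc n) e"
  shows "edge_weight B (Suc n) e + path_count B n (src B (Suc n) e) = path_count B (Suc n) (rng B (Suc n) e)"
proof -
  have "edges_into B (Suc n) (rng B (Suc n) e) = insert e {c. edge_less B (Suc n) c e}"
    using assms edge_less_total[of "Suc n" e] unfolding max_edge_def edges_into_def
    by (auto dest: edge_less_edges)
  then show ?thesis by (simp add: edge_weight_def finite_edge_less)
qed

lemma edge_weight_min: "min_edge B n e \<Longrightarrow> edge_weight B n e = 0"
  by (auto simp: min_edge_def edge_weight_def)

text \<open>No edge lies strictly between, so the gap of \<open>edge_weight_less\<close> is
  attained. This exactness makes the Vershik map raise the weight by 1 and not by more.\<close>

lemma edge_weight_succ:
  assumes "edge_succ B (Suc n) d e"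
  shows "edge_weight B (Suc n) e = edge_weight B (Suc n) d + path_count B n (src B (Suc n) d)"
proof -
  have de: "edge_less B (Suc n) d e" and no: "\<And>c. edge_less B (Suc n) d c \<Longrightarrow> \<not> edge_less B (Suc n) c e"
    using assms by (auto simp: edge_succ_def)
  have "{c. edge_less B (Suc n) c e} = insert d {c. edge_less B (Suc n) c d}"
  proof (intro equalityI subsetI)
    fix c assume "c \<in> {c. edge_less B (Suc n) c e}"
    then have c: "edge_less B (Suc n) c e" by simp
    then have "c = d \<or> edge_less B (Suc n) c d \<or> edge_less B (Suc n) d c"
      using edge_less_total[of "Suc n" c d] de by (metis edge_less_edges le_add1 plus_1_eq_Suc)
    then show "c \<in> insert d {c. edge_less B (Suc n) c d}" using no c by auto
  qed (use de edge_less_trans[of "Suc n"] in auto)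
  then show ?thesis by (simp add: edge_weight_def finite_edge_less)
qed

text \<open>As in a mixed radix expansion, the lower digits add up to less than one unit of the next
  position. The bound refers to the source of the next edge because at \<open>n = 0\<close> there is
  no edge whose range is the root.\<close>

lemma path_weight_less:
  assumes "path_on B 0 (Suc n) x"
  shows "path_weight B 0 n x < path_count B n (src B (Suc n) (x (Suc n)))"
  using assms
proof (induction n)
  case (Suc n)
  have "path_weight B 0 n x < path_count B n (src B (Suc n) (x (Suc n)))"
    using Suc by (simp add: path_on_Suc)
  moreover have "x (Suc n) \<in> edges B (Suc n)" using Suc by (simp add: path_on_Suc)
  ultimately have "path_weight B 0 (Suc n) x < path_count B (Suc n) (rng B (Suc n) (x (Suc n)))"
    using edge_weight_bound[of "x (Suc n)" n] by (simp add: path_weight_Suc)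
  then show ?case using Suc by (simp add: path_on_Suc)
qed simp

lemma path_weight_less_end:
  assumes "path_on B 0 (Suc n) x"
  shows "path_weight B 0 (Suc n) x < path_count B (Suc n) (rng B (Suc n) (x (Suc n)))"
  using path_weight_less[OF assms] edge_weight_bound[of "x (Suc n)" n] assms
  by (simp add: path_weight_Suc path_on_Suc)

lemma path_weight_strict_mono:
  assumes "path_on B 0 n p" "path_on B 0 n q" "path_less B n p q"
  shows "path_weight B 0 n p < path_weight B 0 n q"
proof -
  obtain i where i: "i \<in> {1..n}" "edge_less B i (p i) (q i)" "\<forall>j\<in>{i<..n}. p j = q j"
    using assms(3) by (auto simp: path_less_def)
  then obtain k where k: "i = Suc k" by (cases i) auto
  have "path_on B 0 (Suc k) p" using assms i k by (auto elim: path_on_subset)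
  then have "path_weight B 0 i p < path_weight B 0 i q"
    using path_weight_less[of k p] edge_weight_less[of k "p i" "q i"] i k
    by (simp add: path_weight_Suc)
  moreover have "path_weight B i n p = path_weight B i n q"
    using i by (intro path_weight_cong) auto
  ultimately show ?thesis
    using path_weight_split[of 0 i n B p] path_weight_split[of 0 i n B q] i by simp
qed

lemma path_less_total:
  assumes "path_on B 0 n p" "path_on B 0 n q" "rng B n (p n) = rng B n (q n)" "i \<in> {1..n}" "p i \<noteq> q i"
  shows "path_less B n p q \<or> path_less B n q p"
proof -
  define D where "D = {i \<in> {1..n}. p i \<noteq> q i}"
  define m where "m = Max D"
  have D: "finite D" "D \<noteq> {}" using assms by (auto simp: D_def)
  have m: "m \<in> {1..n}" "p m \<noteq> q m" using Max_in[OF D] by (auto simp: m_def D_def)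
  have eq: "p j = q j" if "m < j" "j \<le> n" for j
  proof (rule ccontr)
    assume "p j \<noteq> q j"
    then have "j \<in> D" using that m by (auto simp: D_def)
    then have "j \<le> m" using D by (simp add: m_def)
    then show False using that by simp
  qed
  \<comment> \<open>Edges are comparable only if their ranges agree. Above \<open>m\<close> the two
    paths coincide, which settles \<open>m < n\<close>; for \<open>m = n\<close> it is the
    hypothesis on the ends.\<close>
  have "rng B m (p m) = rng B m (q m)"
  proof (cases "m = n")
    case False
    then have mn: "0 < m \<and> m < n" using m by simp
    then have "p (Suc m) = q (Suc m)" using eq by simp
    moreover have "rng B m (p m) = src B (Suc m) (p (Suc m))" "rng B m (q m) = src B (Suc m) (q (Suc m))"
      using assms(1,2) mn by (simp_all add: path_on_def)
    ultimately show ?thesis by simp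
  qed (use assms in simp)
  then have "edge_less B m (p m) (q m) \<or> edge_less B m (q m) (p m)"
    using m assms by (intro edge_less_total) (auto simp: path_on_def)
  then show ?thesis using m eq unfolding path_less_def by (metis greaterThanAtMost_iff)
qed

text \<open>Different paths with the same end are comparable, and the weight is strictly monotone.
  All later identifications of paths compare an end vertex and a number.\<close>

lemma path_weight_inj:
  assumes "path_on B 0 n p" "path_on B 0 n q" "rng B n (p n) = rng B n (q n)"
    "path_weight B 0 n p = path_weight B 0 n q" "1 \<le> i" "i \<le> n"
  shows "p i = q i"
  using path_less_total[OF assms(1-3), of i] path_weight_strict_mono assms
  by (metis atLeastAtMost_iff less_irrefl)

lemma path_less_iff_weight:
  assumes "path_on B 0 n p" "path_on B 0 n q" "rng B n (p n) = rng B n (q n)"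
  shows "path_less B n p q \<longleftrightarrow> path_weight B 0 n p < path_weight B 0 n q"
proof
  assume less: "path_weight B 0 n p < path_weight B 0 n q"
  then obtain i where "i \<in> {1..n}" "p i \<noteq> q i"
    using path_weight_cong[of 0 n p q B] by (metis atLeastAtMost_iff less_irrefl Suc_leI One_nat_def)
  then have "path_less B n p q \<or> path_less B n q p" using path_less_total assms by blast
  then show "path_less B n p q" using path_weight_strict_mono[OF assms(2,1)] less by auto
qed (use path_weight_strict_mono assms in blast)

lemma finite_fin_paths: "finite (fin_paths B a b)"
  by (rule finite_subset[of _ "\<Pi>\<^sub>E i\<in>{a<..b}. edges B i"])
    (auto simp: fin_paths_def intro!: finite_PiE finite_edges)

lemma card_paths_to: "card (paths_to B n v) = path_count B n v"
proof (induction n arbitrary: v)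
  case 0
  have "fin_paths B 0 0 = {\<lambda>_. undefined}"
    by (auto simp: fin_paths_def)
  then show ?case by (simp add: paths_to_def)
next
  case (Suc n)
  let ?E = "edges_into B (Suc n) v"
  let ?S = "Sigma ?E (\<lambda>e. paths_to B n (src B (Suc n) e))"
  have "bij_betw (\<lambda>(e, p). p(Suc n := e)) ?S (paths_to B (Suc n) v)"
  proof (rule bij_betw_byWitness[where f' = "\<lambda>p. (p (Suc n), restrict p {0<..n})"])
    show "\<forall>a\<in>?S. (\<lambda>p. (p (Suc n), restrict p {0<..n})) ((\<lambda>(e, p). p(Suc n := e)) a) = a"
      by (auto simp: paths_to_def fin_paths_iff extensional_def restrict_def fun_eq_iff)
    show "\<forall>p\<in>paths_to B (Suc n) v. (\<lambda>(e, p). p(Suc n := e)) (p (Suc n), restrict p {0<..n}) = p"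
      by (auto simp: paths_to_def fin_paths_iff extensional_def fun_eq_iff)
    have upd: "path_on B 0 (Suc n) (p(Suc n := e)) \<longleftrightarrow> path_on B 0 n p \<and> e \<in> edges B (Suc n) \<and>
        (0 < n \<longrightarrow> rng B n (p n) = src B (Suc n) e)" for p e
      using path_on_cong[of 0 n "p(Suc n := e)" p B] by (auto simp: path_on_Suc)
    show "(\<lambda>(e, p). p(Suc n := e)) ` ?S \<subseteq> paths_to B (Suc n) v"
    proof (clarify)
      fix e p assume e: "e \<in> ?E" and p: "p \<in> paths_to B n (src B (Suc n) e)"
      have "path_on B 0 (Suc n) (p(Suc n := e))"
        unfolding upd using e p by (auto simp: edges_into_def paths_to_def fin_paths_iff)
      then show "p(Suc n := e) \<in> paths_to B (Suc n) v"
        using e p by (auto simp: edges_into_def paths_to_def fin_paths_iff extensional_def)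
    qed
    have restr: "path_on B 0 n (restrict p {0<..n}) = path_on B 0 n p" for p
      by (rule path_on_cong) auto
    show "(\<lambda>p. (p (Suc n), restrict p {0<..n})) ` paths_to B (Suc n) v \<subseteq> ?S"
    proof (rule image_subsetI, intro SigmaI)
      fix p assume p: "p \<in> paths_to B (Suc n) v"
      then show "p (Suc n) \<in> ?E" by (auto simp: paths_to_def fin_paths_iff path_on_Suc edges_into_def)
      have "path_on B 0 n (restrict p {0<..n})"
        unfolding restr using p by (simp add: paths_to_def fin_paths_iff path_on_Suc)
      then show "restrict p {0<..n} \<in> paths_to B n (src B (Suc n) (p (Suc n)))"
        using p by (auto simp: paths_to_def fin_paths_iff path_on_Suc)
    qed
  qed
  then have "card (paths_to B (Suc n) v) = card ?S" by (metis bij_betw_same_card)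
  also have "\<dots> = (\<Sum>e\<in>?E. card (paths_to B n (src B (Suc n) e)))"
    by (rule card_SigmaI) (auto simp: finite_edges_into paths_to_def finite_fin_paths)
  finally show ?case by (simp add: Suc.IH)
qed

lemma path_count_pos:
  assumes "v \<in> verts B n"
  shows "path_count B n v > 0"
  using assms
proof (induction n arbitrary: v)
  case (Suc n)
  obtain e where e: "e \<in> edges B (Suc n)" "rng B (Suc n) e = v"
    by (rule incoming_edge[OF _ Suc.prems]) auto
  then have "path_count B n (src B (Suc n) e) > 0" using src_in[of "Suc n" e] Suc.IH by simp
  then have "0 < edge_weight B (Suc n) e + path_count B n (src B (Suc n) e)" by simp
  also have "\<dots> \<le> path_count B (Suc n) v" using edge_weight_bound[OF e(1)] e by simp
  finally show ?case .
qed simp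

text \<open>The weights of the paths to \<open>v\<close> are distinct and smaller than the number of
  these paths, so they fill an initial segment of the naturals. In such a set the number of smaller
  elements is the element itself.\<close>

lemma path_rank_eq:
  assumes p: "p \<in> fin_paths B 0 n" and n: "n \<ge> 1"
  shows "path_rank B n p = path_weight B 0 n p"
proof -
  define v where "v = rng B n (p n)"
  let ?w = "path_weight B 0 n"
  have on: "path_on B 0 n q" "rng B n (q n) = v" "q \<in> extensional {0<..n}" if "q \<in> paths_to B n v" for q
    using that n by (auto simp: paths_to_def fin_paths_iff)
  have pv: "p \<in> paths_to B n v" using p by (simp add: paths_to_def v_def)
  have inj: "inj_on ?w (paths_to B n v)"
  proof (rule inj_onI)
    fix q r assume q: "q \<in> paths_to B n v" and r: "r \<in> paths_to B n v" and eq: "?w q = ?w r"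
    show "q = r"
    proof (rule extensionalityI[OF on(3)[OF q] on(3)[OF r]])
      fix i assume "i \<in> {0<..n}"
      then show "q i = r i"
        using path_weight_inj[of n q r i] on[OF q] on[OF r] eq by simp
    qed
  qed
  have sub: "?w ` paths_to B n v \<subseteq> {..<path_count B n v}"
    using on path_weight_less_end[of "n - 1"] n by fastforce
  have img: "?w ` paths_to B n v = {..<path_count B n v}"
    by (rule card_subset_eq[OF _ sub]) (simp_all add: card_image[OF inj] card_paths_to)
  let ?Q = "{q \<in> fin_paths B 0 n. rng B n (q n) = rng B n (p n) \<and> path_less B n q p}"
  have Q: "?Q = {q \<in> paths_to B n v. ?w q < ?w p}"
  proof (intro Collect_cong)
    fix q
    have "q \<in> paths_to B n v \<Longrightarrow> path_less B n q p \<longleftrightarrow> ?w q < ?w p"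
      using path_less_iff_weight[of n q p] on[of q] on[of p] pv by simp
    moreover have "q \<in> paths_to B n v \<longleftrightarrow> q \<in> fin_paths B 0 n \<and> rng B n (q n) = rng B n (p n)"
      using n by (auto simp: paths_to_def v_def)
    ultimately show "q \<in> fin_paths B 0 n \<and> rng B n (q n) = rng B n (p n) \<and> path_less B n q p \<longleftrightarrow>
        q \<in> paths_to B n v \<and> ?w q < ?w p" by blast
  qed
  have wp: "?w p < path_count B n v" using sub pv by auto
  have "?w ` ?Q = {..<?w p}"
  proof (intro equalityI subsetI)
    fix k assume k: "k \<in> {..<?w p}"
    then have "k \<in> ?w ` paths_to B n v" using img wp by auto
    then show "k \<in> ?w ` ?Q" using k unfolding Q by auto
  qed (auto simp: Q)
  moreover have "inj_on ?w ?Q" by (rule inj_on_subset[OF inj]) (auto simp: Q)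
  then have "card (?w ` ?Q) = card ?Q" by (rule card_image)
  ultimately show ?thesis by (simp add: path_rank_def)
qed

lemma exists_path_to:
  assumes "v \<in> verts B n"
  obtains p where "p \<in> paths_to B n v"
proof -
  have "card (paths_to B n v) > 0" using path_count_pos[OF assms] by (simp add: card_paths_to)
  then have "paths_to B n v \<noteq> {}" by (metis card.empty less_irrefl)
  then show ?thesis using that by auto
qed

text \<open>The initial path \<tau> adds the same weight to both sides and cancels, which also shows
  that the steps do not depend on \<tau>.\<close>

lemma diamond_steps_eq:
  assumes a: "1 \<le> a" "a < b" and w: "\<omega> \<in> fin_paths B a b" "\<omega>' \<in> fin_paths B a b"
    and s: "src B (Suc a) (\<omega> (Suc a)) = src B (Suc a) (\<omega>' (Suc a))"
  shows "diamond_steps B a b \<omega> \<omega>' = int (path_weight B a b \<omega>') - int (path_weight B a b \<omega>)"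
proof -
  have rank: "path_rank B b (path_append a \<tau> \<eta>) = path_weight B 0 a \<tau> + path_weight B a b \<eta>"
    if t: "\<tau> \<in> fin_paths B 0 a" and "rng B a (\<tau> a) = src B (Suc a) (\<omega> (Suc a))"
      and \<eta>: "\<eta> \<in> {\<omega>, \<omega>'}" for \<tau> \<eta>
  proof -
    have "path_append a \<tau> \<eta> \<in> fin_paths B 0 b"
      unfolding fin_paths_iff
    proof
      show "path_on B 0 b (path_append a \<tau> \<eta>)"
        by (rule path_on_append) (use that a w s in \<open>auto simp: fin_paths_iff\<close>)
      show "path_append a \<tau> \<eta> \<in> extensional {0<..b}"
        using t \<eta> w a by (auto simp: fin_paths_iff extensional_def path_append_def)
    qed
    then have "path_rank B b (path_append a \<tau> \<eta>) = path_weight B 0 b (path_append a \<tau> \<eta>)"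
      using a by (intro path_rank_eq) auto
    also have "\<dots> = path_weight B 0 a \<tau> + path_weight B a b \<eta>"
      using a by (intro path_weight_append) simp
    finally show ?thesis .
  qed
  \<comment> \<open>Some \<tau> must exist, since otherwise every integer would satisfy the definite
    description.\<close>
  have "src B (Suc a) (\<omega> (Suc a)) \<in> verts B a"
    using src_in[of "Suc a" "\<omega> (Suc a)"] w a by (auto simp: fin_paths_iff path_on_def)
  then obtain \<tau> where "\<tau> \<in> paths_to B a (src B (Suc a) (\<omega> (Suc a)))" by (rule exists_path_to)
  then have t: "\<tau> \<in> fin_paths B 0 a" "rng B a (\<tau> a) = src B (Suc a) (\<omega> (Suc a))"
    using a by (auto simp: paths_to_def)
  show ?thesis unfolding diamond_steps_def
  proof (rule the_equality)
    show "\<forall>\<tau>\<in>fin_paths B 0 a. rng B a (\<tau> a) = src B (Suc a) (\<omega> (Suc a)) \<longrightarrow>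
      int (path_weight B a b \<omega>') - int (path_weight B a b \<omega>) =
      int (path_rank B b (path_append a \<tau> \<omega>')) - int (path_rank B b (path_append a \<tau> \<omega>))"
      by (simp add: rank)
  next
    fix d assume d: "\<forall>\<tau>\<in>fin_paths B 0 a. rng B a (\<tau> a) = src B (Suc a) (\<omega> (Suc a)) \<longrightarrow>
      d = int (path_rank B b (path_append a \<tau> \<omega>')) - int (path_rank B b (path_append a \<tau> \<omega>))"
    show "d = int (path_weight B a b \<omega>') - int (path_weight B a b \<omega>)"
      unfolding d[rule_format, OF t] by (simp add: rank[OF t])
  qed
qed

end

section \<open>The Vershik map\<close>

context ordered_bratteli
begin

lemma edge_weight_strict_mono:
  assumes "n \<ge> 1" "edge_less B n d e"
  shows "edge_weight B n d < edge_weight B n e"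
proof -
  obtain m where n: "n = Suc m" using assms by (cases n) auto
  have "src B n d \<in> verts B m"
    using src_in[of n d] edge_less_edges[OF assms(2)] n by simp
  then show ?thesis using path_count_pos[of "src B n d" m] edge_weight_less[of m d e] assms n by simp
qed

text \<open>Weights increase strictly along the order, so a minimizer of the weight over a finite
  set of edges is minimal for the order.\<close>

lemma least_edge:
  assumes "n \<ge> 1" "S \<subseteq> edges_into B n v" "S \<noteq> {}"
  obtains m where "m \<in> S" "\<And>d. d \<in> S \<Longrightarrow> \<not> edge_less B n d m"
proof -
  have "finite S" using assms finite_edges_into finite_subset by blast
  then have "arg_min_on (edge_weight B n) S \<in> S"
    "\<not> (\<exists>d\<in>S. edge_weight B n d < edge_weight B n (arg_min_on (edge_weight B n) S))"
    using arg_min_if_finite[of S "edge_weight B n"] assms by auto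
  then show ?thesis using that edge_weight_strict_mono[OF assms(1)] by blast
qed

lemma min_edge_exists:
  assumes "n \<ge> 1" "v \<in> verts B n"
  obtains e where "min_edge B n e" "rng B n e = v"
proof -
  have ne: "edges_into B n v \<noteq> {}"
    by (rule incoming_edge[OF assms]) (auto simp: edges_into_def)
  obtain m where m: "m \<in> edges_into B n v" "\<And>d. d \<in> edges_into B n v \<Longrightarrow> \<not> edge_less B n d m"
    using least_edge[OF assms(1) order_refl ne] by blast
  then have "min_edge B n m" unfolding min_edge_def
    by (auto simp: edges_into_def dest: edge_less_edges)
  then show ?thesis using that m by (auto simp: edges_into_def)
qed

lemma min_edge_unique:
  assumes "n \<ge> 1" "min_edge B n d" "min_edge B n e" "rng B n d = rng B n e"
  shows "d = e"
  using assms edge_less_total[of n d e] by (auto simp: min_edge_def)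

lemma max_edge_unique:
  assumes "n \<ge> 1" "max_edge B n d" "max_edge B n e" "rng B n d = rng B n e"
  shows "d = e"
  using assms edge_less_total[of n d e] by (auto simp: max_edge_def)

lemma edge_succ_exists:
  assumes "n \<ge> 1" "e \<in> edges B n" "\<not> max_edge B n e"
  obtains e' where "edge_succ B n e e'"
proof -
  let ?S = "{d. edge_less B n e d}"
  have S: "?S \<subseteq> edges_into B n (rng B n e)" by (auto simp: edge_less_def edges_into_def)
  have "?S \<noteq> {}" using assms by (auto simp: max_edge_def)
  then obtain m where "m \<in> ?S" "\<And>d. d \<in> ?S \<Longrightarrow> \<not> edge_less B n d m"
    using least_edge[OF assms(1) S] by blast
  then show ?thesis using that by (auto simp: edge_succ_def)
qed

lemma edge_succ_unique:
  assumes "n \<ge> 1" "edge_succ B n e d" "edge_succ B n e d'"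
  shows "d = d'"
proof -
  have "edge_less B n e d" "edge_less B n e d'" using assms by (auto simp: edge_succ_def)
  then have "d = d' \<or> edge_less B n d d' \<or> edge_less B n d' d"
    using edge_less_total[OF assms(1), of d d'] by (metis edge_less_edges)
  then show ?thesis using assms by (auto simp: edge_succ_def)
qed

lemma min_fin_path_exists:
  "v \<in> verts B n \<Longrightarrow>
     \<exists>p. path_on B 0 n p \<and> (n > 0 \<longrightarrow> rng B n (p n) = v) \<and> (\<forall>i\<in>{1..n}. min_edge B i (p i))"
proof (induction n arbitrary: v)
  case 0
  then show ?case by (auto simp: path_on_def)
next
  case (Suc n)
  obtain e where e: "min_edge B (Suc n) e" "rng B (Suc n) e = v"
    by (rule min_edge_exists[OF _ Suc.prems]) auto
  then have "e \<in> edges B (Suc n)" by (simp add: min_edge_def)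
  moreover from this have "src B (Suc n) e \<in> verts B n" using src_in[of "Suc n" e] by simp
  then obtain p where p: "path_on B 0 n p" "n > 0 \<longrightarrow> rng B n (p n) = src B (Suc n) e"
      "\<forall>i\<in>{1..n}. min_edge B i (p i)"
    using Suc.IH by blast
  moreover have "path_on B 0 n (p(Suc n := e)) = path_on B 0 n p" by (rule path_on_cong) auto
  ultimately have "path_on B 0 (Suc n) (p(Suc n := e))" by (auto simp: path_on_Suc)
  moreover have "\<forall>i\<in>{1..Suc n}. min_edge B i ((p(Suc n := e)) i)" using p e by (auto simp: le_Suc_eq)
  ultimately show ?case using e by (intro exI[of _ "p(Suc n := e)"]) (simp del: fun_upd_apply, simp)
qed

text \<open>Minimal edges have weight 0, so both paths have weight 0 and
  \<open>path_weight_inj\<close> applies.\<close>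

lemma min_fin_path_unique:
  assumes "path_on B 0 n p" "path_on B 0 n q" "n > 0 \<longrightarrow> rng B n (p n) = rng B n (q n)"
    "\<forall>i\<in>{1..n}. min_edge B i (p i)" "\<forall>i\<in>{1..n}. min_edge B i (q i)" "1 \<le> i" "i \<le> n"
  shows "p i = q i"
proof (rule path_weight_inj[of n])
  have "path_weight B 0 n r = 0" if "\<forall>i\<in>{1..n}. min_edge B i (r i)" for r
    using that by (auto simp: path_weight_def edge_weight_min)
  then show "path_weight B 0 n p = path_weight B 0 n q" using assms by simp
qed (use assms in auto)

text \<open>A path of maximal edges is the last one to its vertex, and ranks start at 0; this
  accounts for the \<open>Suc\<close>.\<close>

lemma path_weight_all_max:
  "path_on B 0 (Suc n) x \<Longrightarrow> \<forall>i\<in>{1..n}. max_edge B i (x i) \<Longrightarrow>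
     Suc (path_weight B 0 n x) = path_count B n (src B (Suc n) (x (Suc n)))"
proof (induction n)
  case (Suc n)
  then have "Suc (path_weight B 0 n x) = path_count B n (src B (Suc n) (x (Suc n)))"
    by (simp add: path_on_Suc)
  moreover have "max_edge B (Suc n) (x (Suc n))" using Suc by simp
  ultimately have "Suc (path_weight B 0 (Suc n) x) = path_count B (Suc n) (rng B (Suc n) (x (Suc n)))"
    using edge_weight_max[of n "x (Suc n)"] by (simp add: path_weight_Suc)
  then show ?case using Suc by (simp add: path_on_Suc)
qed simp

lemma inf_path_on: "x \<in> inf_paths B \<Longrightarrow> path_on B a n x"
  by (auto simp: inf_paths_iff elim: path_on_subset)

lemma inf_path_rng: "x \<in> inf_paths B \<Longrightarrow> n \<ge> 1 \<Longrightarrow> rng B n (x n) = src B (Suc n) (x (Suc n))"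
  by (auto simp: inf_paths_def)

lemma inf_path_edge: "x \<in> inf_paths B \<Longrightarrow> n \<ge> 1 \<Longrightarrow> x n \<in> edges B n"
  by (auto simp: inf_paths_def)

text \<open>Index 0 of the concatenation is taken from \<open>p\<close>, whereas infinite paths are
  \<open>undefined\<close> there.\<close>

lemma inf_pathsI_append:
  assumes p: "path_on B 0 n p" and x: "x \<in> inf_paths B" and p0: "p 0 = undefined"
    and r: "n > 0 \<Longrightarrow> rng B n (p n) = src B (Suc n) (x (Suc n))"
  shows "path_append n p x \<in> inf_paths B"
  unfolding inf_paths_iff
proof (intro conjI allI)
  show "path_append n p x \<in> extensional {1..}"
    using x p0 by (auto simp: inf_paths_iff extensional_def path_append_def not_le)
  fix m
  have "path_on B 0 (max m n) (path_append n p x)"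
    using r by (intro path_on_append[OF p inf_path_on[OF x]]) auto
  then show "path_on B 0 m (path_append n p x)" by (rule path_on_subset) auto
qed

text \<open>A carry: below the first nonmaximal level \<open>k\<close> the last path, of weight one
  less than the path count, is replaced by the first path, of weight 0, while the edge at
  \<open>k\<close> gains exactly that path count. The net change is 1.\<close>

lemma vershik_step:
  assumes x: "x \<in> vershik_domain B"
  shows "\<exists>k\<ge>1. vershik B x \<in> inf_paths B \<and> (\<forall>i>k. vershik B x i = x i) \<and>
           path_weight B 0 k (vershik B x) = Suc (path_weight B 0 k x)"
proof -
  define k where "k = (LEAST k. 1 \<le> k \<and> \<not> max_edge B k (x k))"
  have xi: "x \<in> inf_paths B" using x by (simp add: vershik_domain_def)
  have "\<not> max_path B x" using x by (auto simp: vershik_domain_def tail_equivalent_def)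
  then have "\<exists>k. 1 \<le> k \<and> \<not> max_edge B k (x k)" using xi by (auto simp: max_path_def)
  then have k: "1 \<le> k" "\<not> max_edge B k (x k)"
    using LeastI_ex[of "\<lambda>k. 1 \<le> k \<and> \<not> max_edge B k (x k)"] by (auto simp: k_def)
  have below: "max_edge B i (x i)" if "1 \<le> i" "i < k" for i
    using not_less_Least[of i "\<lambda>k. 1 \<le> k \<and> \<not> max_edge B k (x k)"] that by (auto simp: k_def)
  obtain e where e: "edge_succ B k (x k) e"
    using edge_succ_exists[OF k(1) inf_path_edge[OF xi k(1)] k(2)] by blast
  then have less: "edge_less B k (x k) e" by (simp add: edge_succ_def)
  obtain m where m: "k = Suc m" using k by (cases k) auto
  have ee: "e \<in> edges B k" "rng B k e = rng B k (x k)" using edge_less_edges[OF less] by auto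
  have "src B k e \<in> verts B m" using src_in[OF k(1) ee(1)] m by simp
  then obtain p where p: "path_on B 0 m p" "m > 0 \<longrightarrow> rng B m (p m) = src B k e"
      "\<forall>i\<in>{1..m}. min_edge B i (p i)"
    using min_fin_path_exists by blast
  define q where "q = p(k := e, 0 := undefined)"
  have "path_on B 0 m q = path_on B 0 m p" by (rule path_on_cong) (auto simp: q_def m)
  then have q: "path_on B 0 k q"
    using p ee unfolding m by (auto simp: path_on_Suc) (auto simp: q_def m)
  define y where "y = path_append k q x"
  have y: "y \<in> inf_paths B" unfolding y_def
    by (rule inf_pathsI_append) (use q xi k ee inf_path_rng[OF xi k(1)] in \<open>auto simp: q_def\<close>)
  let ?Y = "\<lambda>y. y \<in> inf_paths B \<and> (\<forall>i\<in>{1..<k}. min_edge B i (y i)) \<and>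
      edge_succ B k (x k) (y k) \<and> (\<forall>i>k. y i = x i)"
  have Y: "?Y y" using y p e by (auto simp: y_def path_append_def q_def m)
  have "z = y" if z: "?Y z" for z
  proof (rule extensionalityI[of _ "{1..}"])
    fix i :: nat assume i: "i \<in> {1..}"
    have zk: "z k = y k" using z Y edge_succ_unique[OF k(1)] by blast
    have "z i = y i" if "i < k"
    proof (rule min_fin_path_unique[of m])
      show "0 < m \<longrightarrow> rng B m (z m) = rng B m (y m)"
        using zk inf_path_rng[of z m] inf_path_rng[of y m] z y m by auto
    qed (use z Y that i m in \<open>auto intro: inf_path_on\<close>)
    moreover have "z i = y i" if "i > k" using z Y that by simp
    ultimately show "z i = y i" using zk by (cases i k rule: linorder_cases) auto
  qed (use z Y in \<open>auto simp: inf_paths_iff\<close>)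
  then have "(THE y. ?Y y) = y" using Y by (intro the_equality)
  then have "vershik B x = y"
    using x by (simp only: vershik_def k_def[symmetric] Let_def restrict_apply' simp_thms)
  moreover have "path_weight B 0 k y = Suc (path_weight B 0 k x)"
  proof -
    have "path_weight B 0 m y = 0"
      using Y by (auto simp: path_weight_def m intro!: edge_weight_min)
    moreover have "Suc (path_weight B 0 m x) = path_count B m (src B (Suc m) (x (Suc m)))"
      using below by (intro path_weight_all_max inf_path_on[OF xi]) (auto simp: m)
    moreover have "edge_weight B (Suc m) (y (Suc m)) =
        edge_weight B (Suc m) (x (Suc m)) + path_count B m (src B (Suc m) (x (Suc m)))"
      using edge_weight_succ Y m by blast
    ultimately show ?thesis by (simp add: m path_weight_Suc)
  qed
  ultimately show ?thesis using Y k by auto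
qed

lemma vershik_domain_tail:
  assumes "x \<in> vershik_domain B" "y \<in> inf_paths B" "\<And>i. i > n \<Longrightarrow> y i = x i"
  shows "y \<in> vershik_domain B"
proof -
  have "tail_equivalent x z" if z: "tail_equivalent y z" for z
  proof -
    obtain m where "\<forall>i\<ge>m. y i = z i" using z by (auto simp: tail_equivalent_def)
    then have "\<forall>i\<ge>max m (Suc n). x i = z i" using assms(3) by (metis max.bounded_iff Suc_le_lessD)
    then show ?thesis unfolding tail_equivalent_def by blast
  qed
  then show ?thesis using assms(1,2) unfolding vershik_domain_def by blast
qed

text \<open>Each step changes only finitely many edges, so after \<open>d\<close> steps there is a
  level above which nothing has changed; from there on the weights differ by exactly
  \<open>d\<close>.\<close>

lemma vershik_iterate:
  assumes x: "x \<in> vershik_domain B"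
  shows "(vershik B ^^ d) x \<in> vershik_domain B \<and>
     (\<exists>m. \<forall>n\<ge>m. path_weight B 0 n ((vershik B ^^ d) x) = path_weight B 0 n x + d \<and>
        (\<forall>i>n. (vershik B ^^ d) x i = x i))"
proof (induction d)
  case (Suc d)
  let ?z = "(vershik B ^^ d) x"
  obtain m where z: "?z \<in> vershik_domain B" and m: "\<And>n. n \<ge> m \<Longrightarrow>
      path_weight B 0 n ?z = path_weight B 0 n x + d \<and> (\<forall>i>n. ?z i = x i)"
    using Suc by blast
  obtain k where k: "vershik B ?z \<in> inf_paths B" "\<And>i. i > k \<Longrightarrow> vershik B ?z i = ?z i"
      "path_weight B 0 k (vershik B ?z) = Suc (path_weight B 0 k ?z)"
    using vershik_step[OF z] by blast
  have "path_weight B 0 n (vershik B ?z) = Suc (path_weight B 0 n ?z)" if "n \<ge> k" for n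
  proof -
    have "path_weight B k n (vershik B ?z) = path_weight B k n ?z"
      by (rule path_weight_cong) (use k in auto)
    then show ?thesis using k(3) that by (simp add: path_weight_split[of 0 k n])
  qed
  then have "\<forall>n\<ge>max m k. path_weight B 0 n (vershik B ?z) = path_weight B 0 n x + Suc d \<and>
      (\<forall>i>n. vershik B ?z i = x i)"
    using m k(2) by auto
  then have "\<exists>m. \<forall>n\<ge>m. path_weight B 0 n (vershik B ?z) = path_weight B 0 n x + Suc d \<and>
      (\<forall>i>n. vershik B ?z i = x i)" by blast
  moreover have "vershik B ?z \<in> vershik_domain B" by (rule vershik_domain_tail[OF z k(1,2)])
  ultimately show ?case by simp
qed (use x in auto)

text \<open>Turns a difference of weights into an orbit relation. The iterate and \<open>y\<close>
  agree above some common level; below it they have the same end and the same weight, hence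
  coincide.\<close>

lemma vershik_iterate_eq:
  assumes x: "x \<in> vershik_domain B" and y: "y \<in> inf_paths B" and tail: "\<And>i. i > n \<Longrightarrow> y i = x i"
    and d: "path_weight B 0 n y = path_weight B 0 n x + d"
  shows "(vershik B ^^ d) x = y"
proof -
  let ?z = "(vershik B ^^ d) x"
  obtain m where z: "?z \<in> vershik_domain B" and m: "\<And>n. n \<ge> m \<Longrightarrow>
      path_weight B 0 n ?z = path_weight B 0 n x + d \<and> (\<forall>i>n. ?z i = x i)"
    using vershik_iterate[OF x] by blast
  define k where "k = Suc (max m n)"
  have zi: "?z \<in> inf_paths B" using z by (simp add: vershik_domain_def)
  have "path_weight B n k y = path_weight B n k x" by (rule path_weight_cong) (use tail in auto)
  then have "path_weight B 0 k y = path_weight B 0 k x + d"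
    using d path_weight_split[of 0 n k B] by (simp add: k_def)
  then have w: "path_weight B 0 k ?z = path_weight B 0 k y" using m[of k] by (simp add: k_def)
  have r: "rng B k (?z k) = rng B k (y k)"
    using m[of k] tail inf_path_rng[OF zi, of k] inf_path_rng[OF y, of k] by (simp add: k_def)
  show ?thesis
  proof (rule extensionalityI[of _ "{1..}"])
    fix i :: nat assume "i \<in> {1..}"
    then show "?z i = y i"
      using path_weight_inj[OF inf_path_on[OF zi] inf_path_on[OF y] r w, of i] m[of k] tail
      by (cases "i \<le> k") (auto simp: k_def)
  qed (use zi y in \<open>auto simp: inf_paths_iff\<close>)
qed

end

section \<open>Stationary diagrams and the vertical shift\<close>

declare path_count.simps(2) [simp del]

primrec edge_shift :: "('v, 'e) bratteli \<Rightarrow> nat \<Rightarrow> nat \<Rightarrow> 'e \<Rightarrow> 'e" where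
  "edge_shift B i 0 e = e"
| "edge_shift B i (Suc n) e = shift_edge B (i + n) (edge_shift B i n e)"

lemma shift_iter_apply:
  "a < i \<Longrightarrow> i \<le> b \<Longrightarrow> shift_iter B a b n \<omega> (i + n) = edge_shift B i n (\<omega> i)"
  by (induction n) (auto simp: shift_path_def)

text \<open>For a diamond this is \<open>P\<^sub>n(\<omega>, \<omega>')\<close>, but it is defined for equal paths, too.\<close>

definition pair_steps ::
  "('v, 'e) bratteli \<Rightarrow> nat \<Rightarrow> nat \<Rightarrow> (nat \<Rightarrow> 'e) \<Rightarrow> (nat \<Rightarrow> 'e) \<Rightarrow> nat \<Rightarrow> int" where
  "pair_steps B a b \<omega> \<omega>' n =
     int (path_weight B (a + n) (b + n) (shift_iter B a b n \<omega>')) -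
     int (path_weight B (a + n) (b + n) (shift_iter B a b n \<omega>))"

lemma path_weight_shift_iter:
  "path_weight B (a + n) (b + n) (shift_iter B a b n \<omega>)
     = (\<Sum>i\<in>{a<..b}. edge_weight B (i + n) (edge_shift B i n (\<omega> i)))"
  unfolding path_weight_def
proof (rule sum.reindex_bij_witness[where i = "\<lambda>i. i + n" and j = "\<lambda>i. i - n"])
  fix j assume "j \<in> {a + n<..b + n}"
  then show "edge_weight B (j - n + n) (edge_shift B (j - n) n (\<omega> (j - n))) = edge_weight B j (shift_iter B a b n \<omega> j)"
    using shift_iter_apply[of a "j - n" b B n \<omega>] by auto
qed auto

locale stationary_bratteli =
  fixes B :: "(nat, 'e) bratteli" and F :: "nat mat"
  assumes stationary_ordered: "stationary_ordered B F"

sublocale stationary_bratteli \<subseteq> ordered_bratteli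
  by unfold_locales (use stationary_ordered in \<open>simp add: stationary_ordered_def\<close>)

context stationary_bratteli
begin

lemma stationary: "stationary B F"
  using stationary_ordered by (simp add: stationary_ordered_def)

lemma dim_col_F [simp]: "dim_col F = dim_row F"
  using stationary by (auto simp: stationary_def)

lemma map_F_carrier: "map_mat f F \<in> carrier_mat (dim_row F) (dim_row F)"
  by (rule carrier_matI) simp_all

lemma verts_eq: "n \<ge> 1 \<Longrightarrow> verts B n = {..<dim_row F}"
  using stationary by (simp add: stationary_def)

lemma card_edges_between:
  assumes "n \<ge> 1" "v < dim_row F" "w < dim_row F"
  shows "card {e \<in> edges_into B (Suc n) v. src B (Suc n) e = w} = F $$ (v, w)"
proof -
  have "{e \<in> edges_into B (Suc n) v. src B (Suc n) e = w}
      = {e \<in> edges B (Suc n). src B (Suc n) e = w \<and> rng B (Suc n) e = v}"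
    by (auto simp: edges_into_def)
  then show ?thesis using stationary assms by (simp add: stationary_def incidence_def)
qed

text \<open>Only from level 1 on are the edges counted by \<open>F\<close>; the edges out of the
  root follow their own numbers.\<close>

lemma path_count_Suc:
  assumes "n \<ge> 1" "v < dim_row F"
  shows "path_count B (Suc n) v = (\<Sum>w<dim_row F. F $$ (v, w) * path_count B n w)"
proof -
  let ?E = "edges_into B (Suc n) v"
  let ?s = "src B (Suc n)"
  have img: "?s ` ?E \<subseteq> {..<dim_row F}"
  proof (rule image_subsetI)
    fix e assume "e \<in> ?E"
    then have "?s e \<in> verts B n" using src_in[of "Suc n" e] by (simp add: edges_into_def)
    then show "?s e \<in> {..<dim_row F}" unfolding verts_eq[OF assms(1)] .
  qed
  have "path_count B (Suc n) v = (\<Sum>e\<in>?E. path_count B n (?s e))" by (simp add: path_count.simps)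
  also have "\<dots> = (\<Sum>w<dim_row F. \<Sum>e | e \<in> ?E \<and> ?s e = w. path_count B n (?s e))"
    by (rule sum.group[symmetric, OF _ _ img]) (simp_all add: finite_edges_into)
  also have "\<dots> = (\<Sum>w<dim_row F. F $$ (v, w) * path_count B n w)"
  proof (rule sum.cong[OF refl])
    fix w assume w: "w \<in> {..<dim_row F}"
    have "(\<Sum>e | e \<in> ?E \<and> ?s e = w. path_count B n (?s e)) = card {e \<in> ?E. ?s e = w} * path_count B n w"
      by simp
    then show "(\<Sum>e | e \<in> ?E \<and> ?s e = w. path_count B n (?s e)) = F $$ (v, w) * path_count B n w"
      using card_edges_between[OF assms, of w] w by simp
  qed
  finally show ?thesis .
qed

lemma seq_apply_path_count:
  assumes v: "v < dim_row F" and k: "k \<ge> 1"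
  shows "seq_apply (char_poly (map_mat int F)) (\<lambda>n. int (path_count B (n + k) v)) n = 0"
proof -
  \<comment> \<open>Starts at level 1, where the recursion by \<open>F\<close> begins.\<close>
  define h where "h = (\<lambda>n v. int (path_count B (Suc n) v))"
  have zero: "seq_apply (char_poly (map_mat int F)) (\<lambda>n. h n v) m = 0" for m
  proof (rule seq_apply_char_poly[where h = h, OF _ _ v])
    show "map_mat int F \<in> carrier_mat (dim_row F) (dim_row F)" by (rule map_F_carrier)
    show "h (Suc n) u = (\<Sum>w<dim_row F. map_mat int F $$ (u, w) * h n w)" if "u < dim_row F" for u n
    proof -
      have "h (Suc n) u = int (\<Sum>w<dim_row F. F $$ (u, w) * path_count B (Suc n) w)"
        unfolding h_def by (subst path_count_Suc) (use that in auto)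
      also have "\<dots> = (\<Sum>w<dim_row F. map_mat int F $$ (u, w) * h n w)"
        unfolding of_nat_sum of_nat_mult h_def
        by (rule sum.cong) (use that in auto)
      finally show ?thesis .
    qed
  qed
  obtain m where m: "k = Suc m" using k by (cases k) auto
  have "(\<lambda>n. int (path_count B (n + k) v)) = (\<lambda>n. h (n + m) v)"
    unfolding h_def m add_Suc_right ..
  then show ?thesis using seq_apply_offset[of _ "\<lambda>n. h n v" m n] zero by simp
qed

lemma char_poly_nonzero: "char_poly (map_mat int F) \<noteq> 0"
  using degree_monic_char_poly[OF map_F_carrier, of int] by auto

text \<open>Stationarity provides some isomorphism \<open>f\<close>, whereas
  \<open>shift_edge\<close> is described by positions. Since \<open>f\<close> preserves the order it
  preserves positions, and range and position determine an edge; hence the two maps agree.\<close>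

lemma shift_edge_iso:
  assumes n: "n \<ge> 2"
  shows "bij_betw (shift_edge B n) (edges B n) (edges B (Suc n))"
    and "\<And>e. e \<in> edges B n \<Longrightarrow> src B (Suc n) (shift_edge B n e) = src B n e"
    and "\<And>e. e \<in> edges B n \<Longrightarrow> rng B (Suc n) (shift_edge B n e) = rng B n e"
    and "\<And>e e'. e \<in> edges B n \<Longrightarrow> e' \<in> edges B n \<Longrightarrow>
           edge_less B (Suc n) (shift_edge B n e) (shift_edge B n e') \<longleftrightarrow> edge_less B n e e'"
proof -
  obtain f where f: "bij_betw f (edges B n) (edges B (Suc n))"
    and "\<forall>e\<in>edges B n. src B (Suc n) (f e) = src B n e \<and> rng B (Suc n) (f e) = rng B n e"
    and "\<forall>e\<in>edges B n. \<forall>e'\<in>edges B n. edge_less B (Suc n) (f e) (f e') \<longleftrightarrow> edge_less B n e e'"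
    using stationary_ordered n unfolding stationary_ordered_def by blast
  then have sr: "\<And>e. e \<in> edges B n \<Longrightarrow> src B (Suc n) (f e) = src B n e \<and> rng B (Suc n) (f e) = rng B n e"
    and less: "\<And>e e'. e \<in> edges B n \<Longrightarrow> e' \<in> edges B n \<Longrightarrow>
        edge_less B (Suc n) (f e) (f e') \<longleftrightarrow> edge_less B n e e'"
    by auto
  have inj: "inj_on f (edges B n)" and img: "f ` edges B n = edges B (Suc n)"
    using f by (auto simp: bij_betw_def)
  have pos: "edge_position B (Suc n) (f e) = edge_position B n e" if e: "e \<in> edges B n" for e
  proof -
    have "{d. edge_less B (Suc n) d (f e)} = f ` {d. edge_less B n d e}"
    proof (intro equalityI subsetI)
      fix d assume d: "d \<in> {d. edge_less B (Suc n) d (f e)}"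
      then have "d \<in> f ` edges B n" using img edge_less_edges by auto
      then show "d \<in> f ` {d. edge_less B n d e}" using d less e by auto
    qed (use less e edge_less_edges(1) in auto)
    moreover have "inj_on f {d. edge_less B n d e}"
      by (rule inj_on_subset[OF inj]) (auto simp: edge_less_def)
    ultimately show ?thesis by (simp add: edge_position_def card_image)
  qed
  have pos_inj: "d = e" if "d \<in> edges B (Suc n)" "e \<in> edges B (Suc n)" "rng B (Suc n) d = rng B (Suc n) e"
    "edge_position B (Suc n) d = edge_position B (Suc n) e" for d e
  proof (rule ccontr)
    have mono: "edge_position B (Suc n) c < edge_position B (Suc n) c'" if "edge_less B (Suc n) c c'" for c c'
      unfolding edge_position_def
    proof (rule psubset_card_mono)
      show "{d. edge_less B (Suc n) d c} \<subset> {d. edge_less B (Suc n) d c'}"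
      proof
        show "{d. edge_less B (Suc n) d c} \<noteq> {d. edge_less B (Suc n) d c'}"
          using that edge_less_irrefl[of "Suc n" c] by blast
      qed (use that edge_less_trans[of "Suc n"] in auto)
    qed (simp add: finite_edge_less)
    assume "d \<noteq> e"
    then show False using edge_less_total[of "Suc n" d e] that mono by fastforce
  qed
  have eq: "shift_edge B n e = f e" if e: "e \<in> edges B n" for e
    unfolding shift_edge_def
  proof (rule the_equality)
    show "f e \<in> edges B (Suc n) \<and> src B (Suc n) (f e) = src B n e \<and> rng B (Suc n) (f e) = rng B n e \<and>
        edge_position B (Suc n) (f e) = edge_position B n e"
      using e img sr pos by auto
    show "e' = f e" if "e' \<in> edges B (Suc n) \<and> src B (Suc n) e' = src B n e \<and> rng B (Suc n) e' = rng B n e \<and>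
        edge_position B (Suc n) e' = edge_position B n e" for e'
      using that e img sr pos by (intro pos_inj) auto
  qed
  show "bij_betw (shift_edge B n) (edges B n) (edges B (Suc n))"
    using bij_betw_cong[of "edges B n" "shift_edge B n" f] f eq by blast
  show "src B (Suc n) (shift_edge B n e) = src B n e" "rng B (Suc n) (shift_edge B n e) = rng B n e"
    if "e \<in> edges B n" for e
    using that by (simp_all add: eq sr)
  show "edge_less B (Suc n) (shift_edge B n e) (shift_edge B n e') \<longleftrightarrow> edge_less B n e e'"
    if "e \<in> edges B n" "e' \<in> edges B n" for e e'
    using that by (simp add: eq less)
qed

lemma edge_shift_iso:
  assumes i: "i \<ge> 2"
  shows "bij_betw (edge_shift B i n) (edges B i) (edges B (i + n)) \<and>
    (\<forall>e\<in>edges B i. src B (i + n) (edge_shift B i n e) = src B i e \<and>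
       rng B (i + n) (edge_shift B i n e) = rng B i e \<and>
       (\<forall>e'\<in>edges B i. edge_less B (i + n) (edge_shift B i n e) (edge_shift B i n e') \<longleftrightarrow> edge_less B i e e'))"
proof (induction n)
  case 0
  show ?case by (simp add: bij_betw_def inj_on_def)
next
  case (Suc n)
  have n2: "i + n \<ge> 2" using i by simp
  note iso = shift_edge_iso[OF n2]
  from Suc have "bij_betw (edge_shift B i n) (edges B i) (edges B (i + n))" by (rule conjunct1)
  from bij_betw_trans[OF this iso(1)]
  have bij: "bij_betw (shift_edge B (i + n) \<circ> edge_shift B i n) (edges B i) (edges B (i + Suc n))"
    by simp
  have comp: "edge_shift B i (Suc n) = shift_edge B (i + n) \<circ> edge_shift B i n"
    by (simp add: fun_eq_iff)
  have mem: "edge_shift B i n e \<in> edges B (i + n)" if "e \<in> edges B i" for e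
    using Suc that by (auto simp: bij_betw_def)
  show ?case
  proof (intro conjI)
    show "bij_betw (edge_shift B i (Suc n)) (edges B i) (edges B (i + Suc n))" unfolding comp by (rule bij)
  qed (use Suc in \<open>simp add: iso mem\<close>)
qed

lemma edge_shift_props:
  assumes "i \<ge> 2" "e \<in> edges B i"
  shows "edge_shift B i n e \<in> edges B (i + n)"
    and "src B (i + n) (edge_shift B i n e) = src B i e"
    and "rng B (i + n) (edge_shift B i n e) = rng B i e"
  using edge_shift_iso[OF assms(1), of n] assms by (auto simp: bij_betw_def)

text \<open>The shift carries the predecessors of \<open>e\<close> to those of its image and keeps
  their sources, so only the level of the path counts moves. The index is written in the form
  required by \<open>seq_apply_path_count\<close>.\<close>

lemma edge_weight_shift:
  assumes i: "i \<ge> 2" and e: "e \<in> edges B i"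
  shows "edge_weight B (i + n) (edge_shift B i n e)
       = (\<Sum>d | edge_less B i d e. path_count B (n + (i - 1)) (src B i d))"
proof -
  let ?f = "edge_shift B i n"
  have inj: "inj_on ?f (edges B i)" and img: "?f ` edges B i = edges B (i + n)"
    using edge_shift_iso[OF i, of n] by (auto simp: bij_betw_def)
  have less: "edge_less B (i + n) (?f c) (?f d) \<longleftrightarrow> edge_less B i c d" if "c \<in> edges B i" "d \<in> edges B i" for c d
    using edge_shift_iso[OF i, of n] that by blast
  have "{d. edge_less B (i + n) d (?f e)} = ?f ` {d. edge_less B i d e}"
  proof (intro equalityI subsetI)
    fix d assume d: "d \<in> {d. edge_less B (i + n) d (?f e)}"
    then have "d \<in> ?f ` edges B i" using img edge_less_edges by auto
    then show "d \<in> ?f ` {d. edge_less B i d e}" using d less e by auto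
  qed (use less e edge_less_edges(1) in auto)
  moreover have "inj_on ?f {d. edge_less B i d e}"
    by (rule inj_on_subset[OF inj]) (auto simp: edge_less_def)
  moreover have "src B (i + n) (?f d) = src B i d" if "edge_less B i d e" for d
    using edge_shift_props[OF i] that edge_less_edges(1) by blast
  moreover have "i + n - 1 = n + (i - 1)" using i by simp
  ultimately show ?thesis by (simp add: edge_weight_def sum.reindex)
qed

text \<open>Each shifted edge weight is a finite sum of path counts at levels \<open>n + k\<close>,
  where \<open>k \<ge> 1\<close> because diamonds start at level 1 or later; the characteristic
  polynomial annihilates every summand.\<close>

lemma seq_apply_pair_steps:
  assumes a: "1 \<le> a" and w: "\<omega> \<in> fin_paths B a b" "\<omega>' \<in> fin_paths B a b"
  shows "seq_apply (char_poly (map_mat int F)) (pair_steps B a b \<omega> \<omega>') n = 0"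
proof -
  let ?p = "char_poly (map_mat int F)"
  let ?W = "\<lambda>\<eta> n. int (path_weight B (a + n) (b + n) (shift_iter B a b n \<eta>))"
  have zero: "seq_apply ?p (?W \<eta>) n = 0" if \<eta>: "\<eta> \<in> fin_paths B a b" for \<eta>
  proof -
    have e: "\<eta> i \<in> edges B i" if "i \<in> {a<..b}" for i
      using \<eta> that by (auto simp: fin_paths_iff path_on_def)
    have "?W \<eta> = (\<lambda>n. \<Sum>i\<in>{a<..b}. \<Sum>d | edge_less B i d (\<eta> i). int (path_count B (n + (i - 1)) (src B i d)))"
      using a e by (simp add: path_weight_shift_iter edge_weight_shift)
    moreover have "src B i d < dim_row F" if "i \<in> {a<..b}" "edge_less B i d (\<eta> i)" for i d
      using src_in[of i d] verts_eq[of "i - 1"] that a edge_less_edges(1)[OF that(2)] by auto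
    ultimately show ?thesis
      using a by (simp only: seq_apply_sum_right) (intro sum.neutral ballI seq_apply_path_count, auto)
  qed
  have "pair_steps B a b \<omega> \<omega>' = (\<lambda>n. 1 * ?W \<omega>' n + (- 1) * ?W \<omega> n)"
    by (simp add: pair_steps_def fun_eq_iff)
  then show ?thesis by (simp only: seq_apply_linear zero[OF w(1)] zero[OF w(2)])
qed

section \<open>The vertical shift on finite paths\<close>

lemma shift_path_in:
  assumes a: "1 \<le> a" and w: "\<omega> \<in> fin_paths B a b"
  shows "shift_path B a b \<omega> \<in> fin_paths B (Suc a) (Suc b)"
  unfolding fin_paths_iff path_on_def
proof (intro conjI ballI allI impI)
  have e: "\<omega> i \<in> edges B i" if "a < i" "i \<le> b" for i
    using w that by (auto simp: fin_paths_iff path_on_def)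
  show "shift_path B a b \<omega> j \<in> edges B j" if j: "j \<in> {Suc a<..Suc b}" for j
  proof -
    obtain i where i: "j = Suc i" "a < i" "i \<le> b" using j by (cases j) auto
    have "bij_betw (shift_edge B i) (edges B i) (edges B j)"
      unfolding i(1) using i a by (intro shift_edge_iso) simp
    then show ?thesis using e[OF i(2,3)] i by (auto simp: shift_path_def bij_betw_def)
  qed
next
  fix j assume j: "Suc a < j \<and> j < Suc b"
  have e: "\<omega> i \<in> edges B i" if "a < i" "i \<le> b" for i
    using w that by (auto simp: fin_paths_iff path_on_def)
  obtain i where i: "j = Suc i" "a < i" "i < b" using j by (cases j) auto
  then show "rng B j (shift_path B a b \<omega> j) = src B (Suc j) (shift_path B a b \<omega> (Suc j))"
    using w a e[of i] e[of "Suc i"] shift_edge_iso(3)[of i "\<omega> i"] shift_edge_iso(2)[of "Suc i" "\<omega> (Suc i)"]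
    by (auto simp: shift_path_def fin_paths_iff path_on_def)
qed (simp add: shift_path_def)

lemma shift_iter_in:
  assumes "1 \<le> a" "\<omega> \<in> fin_paths B a b"
  shows "shift_iter B a b n \<omega> \<in> fin_paths B (a + n) (b + n)"
  using assms by (induction n) (auto intro: shift_path_in)

lemma shift_iter_ends:
  assumes a: "1 \<le> a" "a < b" and w: "\<omega> \<in> fin_paths B a b"
  shows "src B (Suc (a + n)) (shift_iter B a b n \<omega> (Suc (a + n))) = src B (Suc a) (\<omega> (Suc a))"
    and "rng B (b + n) (shift_iter B a b n \<omega> (b + n)) = rng B b (\<omega> b)"
proof -
  have "\<omega> i \<in> edges B i" if "a < i" "i \<le> b" for i
    using w that by (auto simp: fin_paths_iff path_on_def)
  moreover have "shift_iter B a b n \<omega> (Suc a + n) = edge_shift B (Suc a) n (\<omega> (Suc a))"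
    "shift_iter B a b n \<omega> (b + n) = edge_shift B b n (\<omega> b)"
    using a by (intro shift_iter_apply; simp)+
  ultimately show "src B (Suc (a + n)) (shift_iter B a b n \<omega> (Suc (a + n))) = src B (Suc a) (\<omega> (Suc a))"
    "rng B (b + n) (shift_iter B a b n \<omega> (b + n)) = rng B b (\<omega> b)"
    using edge_shift_props[of "Suc a" "\<omega> (Suc a)" n] edge_shift_props[of b "\<omega> b" n] a by simp_all
qed

lemma diamond_steps_shift_eq:
  assumes "diamond B a b \<omega> \<omega>'"
  shows "diamond_steps_shift B n a b \<omega> \<omega>' = pair_steps B a b \<omega> \<omega>' n"
proof -
  have d: "1 \<le> a" "a < b" "\<omega> \<in> fin_paths B a b" "\<omega>' \<in> fin_paths B a b"
    "src B (Suc a) (\<omega> (Suc a)) = src B (Suc a) (\<omega>' (Suc a))"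
    using assms by (auto simp: diamond_def)
  have "src B (Suc (a + n)) (shift_iter B a b n \<omega> (Suc (a + n)))
      = src B (Suc (a + n)) (shift_iter B a b n \<omega>' (Suc (a + n)))"
    using d shift_iter_ends(1)[OF d(1,2)] by simp
  then show ?thesis
    unfolding diamond_steps_shift_def pair_steps_def
    using d by (intro diamond_steps_eq shift_iter_in) auto
qed

text \<open>The shift is bijective on the edges of each level from 2 on, so a path can be moved down
  again. Later this reduces pairs of paths at all levels to finitely many pairs at level 1.\<close>

lemma shift_iter_surj:
  assumes a: "1 \<le> a" and \<eta>: "\<eta> \<in> fin_paths B (a + n) (b + n)"
  obtains \<omega> where "\<omega> \<in> fin_paths B a b" "shift_iter B a b n \<omega> = \<eta>"
    "\<And>i. a < i \<Longrightarrow> i \<le> b \<Longrightarrow> src B i (\<omega> i) = src B (i + n) (\<eta> (i + n)) \<and>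
       rng B i (\<omega> i) = rng B (i + n) (\<eta> (i + n))"
proof -
  define \<omega> where "\<omega> = (\<lambda>i\<in>{a<..b}. inv_into (edges B i) (edge_shift B i n) (\<eta> (i + n)))"
  have edge: "\<omega> i \<in> edges B i" "edge_shift B i n (\<omega> i) = \<eta> (i + n)" if "a < i" "i \<le> b" for i
  proof -
    have \<eta>i: "\<eta> (i + n) \<in> edge_shift B i n ` edges B i"
      using \<eta> that a edge_shift_iso[of i n] by (auto simp: bij_betw_def fin_paths_iff path_on_def)
    show "\<omega> i \<in> edges B i" "edge_shift B i n (\<omega> i) = \<eta> (i + n)"
      using that inv_into_into[OF \<eta>i] f_inv_into_f[OF \<eta>i] by (simp_all add: \<omega>_def)
  qed
  have sr: "src B i (\<omega> i) = src B (i + n) (\<eta> (i + n)) \<and> rng B i (\<omega> i) = rng B (i + n) (\<eta> (i + n))"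
    if "a < i" "i \<le> b" for i
    using edge_shift_props(2,3)[of i "\<omega> i" n] edge[OF that] that a by simp
  have in_paths: "\<omega> \<in> fin_paths B a b"
    unfolding fin_paths_iff path_on_def
  proof (intro conjI ballI allI impI)
    fix i assume i: "a < i \<and> i < b"
    then have "rng B (i + n) (\<eta> (i + n)) = src B (Suc (i + n)) (\<eta> (Suc (i + n)))"
      using \<eta> by (auto simp: fin_paths_iff path_on_def)
    then show "rng B i (\<omega> i) = src B (Suc i) (\<omega> (Suc i))" using sr[of i] sr[of "Suc i"] i by simp
  next
    show "\<omega> \<in> extensional {a<..b}" by (simp add: \<omega>_def)
    show "\<omega> i \<in> edges B i" if "i \<in> {a<..b}" for i using edge that by simp
  qed
  have "shift_iter B a b n \<omega> = \<eta>"
  proof (rule extensionalityI[of _ "{a + n<..b + n}"])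
    show "shift_iter B a b n \<omega> \<in> extensional {a + n<..b + n}" "\<eta> \<in> extensional {a + n<..b + n}"
      using shift_iter_in[OF a in_paths] \<eta> by (auto simp: fin_paths_iff)
    fix j assume j: "j \<in> {a + n<..b + n}"
    then have "shift_iter B a b n \<omega> (j - n + n) = edge_shift B (j - n) n (\<omega> (j - n))"
      by (intro shift_iter_apply) auto
    moreover have "edge_shift B (j - n) n (\<omega> (j - n)) = \<eta> (j - n + n)"
      using j by (intro edge) auto
    moreover have "j - n + n = j" using j by simp
    ultimately show "shift_iter B a b n \<omega> j = \<eta> j" by (simp only:)
  qed
  then show ?thesis using that in_paths sr by blast
qed

end

section \<open>The class of a distinguished vertex\<close>

text \<open>An arrow from \<open>u\<close> to \<open>v\<close> stands for an edge of the diagram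
  from \<open>u\<close> up to \<open>v\<close>; this is the graph of the transpose of
  \<open>F\<close>, restricted to \<open>V\<close>.\<close>

definition class_graph :: "nat mat \<Rightarrow> nat set \<Rightarrow> nat rel" where
  "class_graph F V = {(u, v). u \<in> V \<and> v \<in> V \<and> F $$ (v, u) > 0}"

definition class_paths :: "('v, 'e) bratteli \<Rightarrow> 'v set \<Rightarrow> nat \<Rightarrow> nat \<Rightarrow> (nat \<Rightarrow> 'e) set" where
  "class_paths B V a b = {\<omega> \<in> fin_paths B a b. passes_within B V a b \<omega>}"

lemma passes_within_append:
  assumes "passes_within B V a b x" "passes_within B V b c y"
  shows "passes_within B V a c (path_append b x y)"
  using assms by (auto simp: passes_within_def path_append_def)

lemma fin_paths_append:
  assumes "x \<in> fin_paths B a b" "y \<in> fin_paths B b c" "a \<le> b" "b \<le> c"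
    and "a < b \<Longrightarrow> b < c \<Longrightarrow> rng B b (x b) = src B (Suc b) (y (Suc b))"
  shows "path_append b x y \<in> fin_paths B a c"
  using assms path_on_append[of B a b x c y]
  by (auto simp: fin_paths_iff extensional_def path_append_def)

lemma class_paths_append:
  assumes "x \<in> class_paths B V a b" "y \<in> class_paths B V b c" "a \<le> b" "b \<le> c"
    and "a < b \<Longrightarrow> b < c \<Longrightarrow> rng B b (x b) = src B (Suc b) (y (Suc b))"
  shows "path_append b x y \<in> class_paths B V a c"
  using assms by (auto simp: class_paths_def intro: fin_paths_append passes_within_append)

context stationary_bratteli
begin

lemma edge_between:
  assumes "n \<ge> 1" "v < dim_row F" "w < dim_row F" "F $$ (v, w) > 0"
  obtains e where "e \<in> edges B (Suc n)" "src B (Suc n) e = w" "rng B (Suc n) e = v"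
proof -
  have "card {e \<in> edges_into B (Suc n) v. src B (Suc n) e = w} > 0"
    using card_edges_between[OF assms(1-3)] assms(4) by simp
  then have "{e \<in> edges_into B (Suc n) v. src B (Suc n) e = w} \<noteq> {}" by (metis card.empty less_irrefl)
  then show ?thesis using that by (auto simp: edges_into_def)
qed

lemma edge_matrix_pos:
  assumes "n \<ge> 1" "e \<in> edges B (Suc n)"
  shows "src B (Suc n) e < dim_row F" "rng B (Suc n) e < dim_row F"
    "F $$ (rng B (Suc n) e, src B (Suc n) e) > 0"
proof -
  show s: "src B (Suc n) e < dim_row F" using src_in[of "Suc n" e] verts_eq[of n] assms by simp
  show r: "rng B (Suc n) e < dim_row F" using rng_in[of "Suc n" e] verts_eq[of "Suc n"] assms by simp
  let ?S = "{d \<in> edges_into B (Suc n) (rng B (Suc n) e). src B (Suc n) d = src B (Suc n) e}"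
  have "e \<in> ?S" using assms by (simp add: edges_into_def)
  moreover have "finite ?S" by (simp add: finite_edges_into)
  ultimately have "card ?S > 0" by (metis card_gt_0_iff empty_iff)
  then show "F $$ (rng B (Suc n) e, src B (Suc n) e) > 0"
    using card_edges_between[OF assms(1) r s] by simp
qed

lemma single_edge_path:
  assumes "n \<ge> 1" "e \<in> edges B (Suc n)" "src B (Suc n) e \<in> V" "rng B (Suc n) e \<in> V"
  shows "(\<lambda>i\<in>{n<..Suc n}. e) \<in> class_paths B V n (Suc n)"
proof -
  have "{n<..Suc n} = {Suc n}" by auto
  then show ?thesis
    using assms by (auto simp: class_paths_def fin_paths_iff path_on_def passes_within_def)
qed

lemma class_path_exists:
  assumes V: "V \<subseteq> {..<dim_row F}" and n: "n \<ge> 1"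
  shows "(u, v) \<in> class_graph F V ^^ Suc K \<Longrightarrow> \<exists>p \<in> class_paths B V n (n + Suc K).
     src B (Suc n) (p (Suc n)) = u \<and> rng B (n + Suc K) (p (n + Suc K)) = v"
proof (induction K arbitrary: v)
  case 0
  then have uv: "u \<in> V" "v \<in> V" "F $$ (v, u) > 0" by (auto simp: class_graph_def)
  then obtain e where e: "e \<in> edges B (Suc n)" "src B (Suc n) e = u" "rng B (Suc n) e = v"
    using edge_between[OF n, of v u] V by auto
  then show ?case using single_edge_path[OF n e(1), of V] uv by (intro bexI) auto
next
  case (Suc K)
  then obtain w where w: "(u, w) \<in> class_graph F V ^^ Suc K" "(w, v) \<in> class_graph F V" by auto
  then obtain p where p: "p \<in> class_paths B V n (n + Suc K)" "src B (Suc n) (p (Suc n)) = u"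
    "rng B (n + Suc K) (p (n + Suc K)) = w" using Suc.IH by blast
  let ?m = "n + Suc K"
  have wv: "w \<in> V" "v \<in> V" "F $$ (v, w) > 0" using w by (auto simp: class_graph_def)
  then obtain e where e: "e \<in> edges B (Suc ?m)" "src B (Suc ?m) e = w" "rng B (Suc ?m) e = v"
    using edge_between[of ?m v w] V by auto
  have "path_append ?m p (\<lambda>i\<in>{?m<..Suc ?m}. e) \<in> class_paths B V n (Suc ?m)"
    using e wv p n by (intro class_paths_append[OF p(1)] single_edge_path) auto
  then show ?case using p e by (intro bexI) (auto simp: path_append_def)
qed

end

text \<open>The facts about a distinguished class on which the arguments about paths and measures
  rest. The support of \<xi> consists of vertices that can reach the class, and an edge that leaves
  the class ends where \<xi> vanishes; so a path inside the support that enters the class stays in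
  it.\<close>

locale class_system = stationary_bratteli B F
  for B :: "(nat, 'e) bratteli" and F :: "nat mat" +
  fixes \<alpha> :: "nat set" and \<rho> :: real and \<xi> :: "nat \<Rightarrow> real" and M :: "(nat \<Rightarrow> 'e) measure"
  assumes aperiodic: "tail_aperiodic B"
    and class_verts: "\<alpha> \<subseteq> {..<dim_row F}" "\<alpha> \<noteq> {}"
    and eigen: "w < dim_row F \<Longrightarrow> (\<Sum>v<dim_row F. real (F $$ (v, w)) * \<xi> v) = \<rho> * \<xi> w"
    and xi_nonneg: "v < dim_row F \<Longrightarrow> \<xi> v \<ge> 0"
    and xi_pos: "v \<in> \<alpha> \<Longrightarrow> \<xi> v > 0"
    and xi_stay: "u \<in> \<alpha> \<Longrightarrow> v < dim_row F \<Longrightarrow> F $$ (v, u) > 0 \<Longrightarrow> \<xi> v > 0 \<Longrightarrow> v \<in> \<alpha>"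
    and xi_access: "w < dim_row F \<Longrightarrow> \<xi> w > 0 \<Longrightarrow>
      \<exists>k. \<exists>u\<in>\<alpha>. (w, u) \<in> class_graph F {..<dim_row F} ^^ k"
    and primitive: "class_graph F \<alpha> \<noteq> {} \<Longrightarrow> \<exists>K\<ge>1. \<forall>u\<in>\<alpha>. \<forall>v\<in>\<alpha>. (u, v) \<in> class_graph F \<alpha> ^^ K"
    and xi_total: "(\<Sum>w<dim_row F. real (path_count B 1 w) * \<xi> w) = 1"
    and prob: "prob_space M"
    and sets_M: "sets M = sets (path_borel B)"
    and measure_cylinder: "n \<ge> 1 \<Longrightarrow> p \<in> fin_paths B 0 n \<Longrightarrow>
      measure M (cylinder B n p) = \<xi> (rng B n (p n)) / \<rho> ^ (n - 1)"
begin

text \<open>Up to the factor \<open>\<rho> ^ n\<close> this is the total measure 1 of the cylinders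
  of length \<open>Suc n\<close>; the eigenvector equation multiplies the sum by \<rho> at each
  level.\<close>

lemma sum_path_count: "(\<Sum>v<dim_row F. real (path_count B (Suc n) v) * \<xi> v) = \<rho> ^ n"
proof (induction n)
  case 0
  then show ?case using xi_total by simp
next
  case (Suc n)
  have "(\<Sum>v<dim_row F. real (path_count B (Suc (Suc n)) v) * \<xi> v)
      = (\<Sum>v<dim_row F. \<Sum>w<dim_row F. real (F $$ (v, w)) * real (path_count B (Suc n) w) * \<xi> v)"
  proof (rule sum.cong[OF refl])
    fix v assume "v \<in> {..<dim_row F}"
    then have "path_count B (Suc (Suc n)) v = (\<Sum>w<dim_row F. F $$ (v, w) * path_count B (Suc n) w)"
      by (intro path_count_Suc) auto
    then show "real (path_count B (Suc (Suc n)) v) * \<xi> v =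
        (\<Sum>w<dim_row F. real (F $$ (v, w)) * real (path_count B (Suc n) w) * \<xi> v)"
      by (simp add: sum_distrib_right)
  qed
  also have "\<dots> = (\<Sum>w<dim_row F. \<Sum>v<dim_row F. real (F $$ (v, w)) * real (path_count B (Suc n) w) * \<xi> v)"
    by (rule sum.swap)
  also have "\<dots> = (\<Sum>w<dim_row F. real (path_count B (Suc n) w) * (\<Sum>v<dim_row F. real (F $$ (v, w)) * \<xi> v))"
    unfolding sum_distrib_left by (simp add: mult_ac)
  also have "\<dots> = (\<Sum>w<dim_row F. real (path_count B (Suc n) w) * (\<rho> * \<xi> w))"
    by (rule sum.cong) (auto simp: eigen)
  also have "\<dots> = \<rho> * (\<Sum>w<dim_row F. real (path_count B (Suc n) w) * \<xi> w)"
    by (simp add: sum_distrib_left mult_ac)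
  finally show ?case using Suc by simp
qed

lemma path_count_bound:
  assumes "v < dim_row F"
  shows "real (path_count B (Suc n) v) * \<xi> v \<le> \<rho> ^ n"
proof -
  have "real (path_count B (Suc n) v) * \<xi> v \<le> (\<Sum>v<dim_row F. real (path_count B (Suc n) v) * \<xi> v)"
    using assms xi_nonneg by (intro member_le_sum[of v "{..<dim_row F}"]) auto
  then show ?thesis by (simp add: sum_path_count)
qed

lemma class_vertex: "v \<in> \<alpha> \<Longrightarrow> v < dim_row F"
  using class_verts by auto

lemma finite_class: "finite \<alpha>"
  using class_verts by (auto intro: finite_subset)

lemma radius_pos: "\<rho> > 0"
proof -
  obtain u where u: "u \<in> \<alpha>" using class_verts by auto
  have "path_count B (Suc 1) u > 0" by (rule path_count_pos) (use verts_eq class_vertex u in auto)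
  then have "real (path_count B (Suc 1) u) * \<xi> u > 0" using xi_pos[OF u] by simp
  then show ?thesis using path_count_bound[OF class_vertex[OF u], of 1] by simp
qed

text \<open>The right side of the eigenvector equation at \<open>u\<close> is positive, so some
  successor of \<open>u\<close> has positive \<xi>, and \<open>xi_stay\<close> puts it into the
  class.\<close>

lemma class_next:
  assumes u: "u \<in> \<alpha>"
  obtains v where "v \<in> \<alpha>" "F $$ (v, u) > 0"
proof -
  have "(\<Sum>v<dim_row F. real (F $$ (v, u)) * \<xi> v) \<noteq> 0"
    using eigen[OF class_vertex[OF u]] radius_pos xi_pos[OF u] by simp
  then obtain v where v: "v < dim_row F" "real (F $$ (v, u)) * \<xi> v \<noteq> 0"
    by (meson lessThan_iff sum.not_neutral_contains_not_neutral)
  then have "F $$ (v, u) > 0" "\<xi> v > 0" using xi_nonneg[of v] by auto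
  then show ?thesis using that xi_stay[OF u v(1)] by blast
qed

lemma class_graph_nonempty: "class_graph F \<alpha> \<noteq> {}"
proof -
  obtain u where "u \<in> \<alpha>" using class_verts by auto
  then show ?thesis using class_next[of u] by (force simp: class_graph_def)
qed

lemma exists_class_path:
  obtains x where "x \<in> inf_paths B" "\<And>n. n \<ge> 1 \<Longrightarrow> rng B n (x n) \<in> \<alpha>"
proof -
  obtain u where u: "u \<in> \<alpha>" using class_verts by auto
  define R where "R n e e' \<longleftrightarrow> e' \<in> edges B (Suc (Suc n)) \<and> src B (Suc (Suc n)) e' = rng B (Suc n) e" for n e e'
  have "\<exists>f. \<forall>n. (f n \<in> edges B (Suc n) \<and> rng B (Suc n) (f n) \<in> \<alpha>) \<and> R n (f n) (f (Suc n))"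
  proof (rule dependent_nat_choice)
    obtain e where "e \<in> edges B 1" "rng B 1 e = u"
      by (rule incoming_edge[of 1 u]) (use verts_eq class_vertex u in auto)
    then show "\<exists>e. e \<in> edges B (Suc 0) \<and> rng B (Suc 0) e \<in> \<alpha>" using u by auto
    fix e n assume e: "e \<in> edges B (Suc n) \<and> rng B (Suc n) e \<in> \<alpha>"
    then obtain v where v: "v \<in> \<alpha>" "F $$ (v, rng B (Suc n) e) > 0" using class_next by blast
    obtain e' where "e' \<in> edges B (Suc (Suc n))" "src B (Suc (Suc n)) e' = rng B (Suc n) e"
        "rng B (Suc (Suc n)) e' = v"
      by (rule edge_between[of "Suc n" v "rng B (Suc n) e"]) (use v e class_vertex in auto)
    then show "\<exists>e'. (e' \<in> edges B (Suc (Suc n)) \<and> rng B (Suc (Suc n)) e' \<in> \<alpha>) \<and> R n e e'"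
      using v by (auto simp: R_def)
  qed
  then obtain f where f: "\<And>n. f n \<in> edges B (Suc n)" "\<And>n. rng B (Suc n) (f n) \<in> \<alpha>"
    "\<And>n. src B (Suc (Suc n)) (f (Suc n)) = rng B (Suc n) (f n)" by (auto simp: R_def)
  define x where "x = (\<lambda>n\<in>{1..}. f (n - 1))"
  have x: "x (Suc n) = f n" for n by (simp add: x_def)
  have "x \<in> inf_paths B"
    unfolding inf_paths_def PiE_iff
  proof (intro CollectI conjI ballI allI impI)
    fix i :: nat assume "i \<in> {1..}"
    then show "x i \<in> edges B i" using f(1) x by (cases i) auto
  next
    fix i :: nat assume "1 \<le> i"
    then show "rng B i (x i) = src B (Suc i) (x (Suc i))" using f(3) x by (cases i) auto
  qed (simp add: x_def)
  moreover have "rng B n (x n) \<in> \<alpha>" if "n \<ge> 1" for n using that f(2) x by (cases n) auto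
  ultimately show ?thesis using that by blast
qed

text \<open>If \<open>\<rho> \<le> 1\<close>, the number of paths to a vertex of the class is bounded, and so is the size of
  the tail equivalence class of a path that stays in the class.\<close>

lemma radius_gt_1: "\<rho> > 1"
proof (rule ccontr)
  assume "\<not> \<rho> > 1"
  then have pow: "\<rho> ^ n \<le> 1" for n using radius_pos by (simp add: power_le_one)
  \<comment> \<open>With \<open>\<rho> ^ n \<le> 1\<close>, \<open>path_count_bound\<close> gives
    the bound \<open>1 / \<xi> v\<close> at the vertex \<open>v\<close>; the sum serves all vertices
    of the class at once.\<close>
  define C where "C = nat \<lceil>\<Sum>v\<in>\<alpha>. 1 / \<xi> v\<rceil>"
  have bound: "path_count B (Suc n) v \<le> C" if v: "v \<in> \<alpha>" for n v
  proof -
    have "real (path_count B (Suc n) v) \<le> 1 / \<xi> v"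
      using order_trans[OF path_count_bound[OF class_vertex[OF v]] pow[of n]] xi_pos[OF v]
      by (simp add: field_simps)
    also have "\<dots> \<le> (\<Sum>v\<in>\<alpha>. 1 / \<xi> v)"
      using v finite_class xi_pos by (intro member_le_sum) (auto simp: less_imp_le)
    finally show ?thesis unfolding C_def by linarith
  qed
  obtain x where x: "x \<in> inf_paths B" "\<And>n. n \<ge> 1 \<Longrightarrow> rng B n (x n) \<in> \<alpha>"
    using exists_class_path by blast
  have "infinite {y \<in> inf_paths B. tail_equivalent x y}"
    using aperiodic x(1) by (auto simp: tail_aperiodic_def)
  then obtain S where S: "S \<subseteq> {y \<in> inf_paths B. tail_equivalent x y}" "finite S" "card S = Suc C"
    using infinite_arbitrarily_large by blast
  have "\<forall>y\<in>S. \<exists>n. \<forall>i\<ge>n. x i = y i" using S(1) by (auto simp: tail_equivalent_def)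
  then obtain m where m: "\<And>y i. y \<in> S \<Longrightarrow> i \<ge> m y \<Longrightarrow> x i = y i" by metis
  define n where "n = Max (m ` S)"
  have n: "x i = y i" if "y \<in> S" "i \<ge> n" for y i
  proof -
    have "m y \<le> n" unfolding n_def using that S(2) by (intro Max_ge) auto
    then show ?thesis using m that by simp
  qed
  \<comment> \<open>All paths in \<open>S\<close> pass through the vertex of \<open>x\<close> at
    level \<open>Suc n\<close> and agree from there on. Their weights are distinct and below
    \<open>C\<close>, although \<open>S\<close> has \<open>Suc C\<close> elements.\<close>
  let ?w = "path_weight B 0 (Suc n)"
  have "inj_on ?w S"
  proof (rule inj_onI)
    fix y z assume y: "y \<in> S" and z: "z \<in> S" and eq: "?w y = ?w z"
    have yz: "y \<in> inf_paths B" "z \<in> inf_paths B" using S(1) y z by auto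
    show "y = z"
    proof (rule extensionalityI[of _ "{1..}"])
      fix i :: nat assume i: "i \<in> {1..}"
      have r: "rng B (Suc n) (y (Suc n)) = rng B (Suc n) (z (Suc n))"
        using n[OF y, of "Suc n"] n[OF z, of "Suc n"] by simp
      show "y i = z i"
      proof (cases "i \<le> Suc n")
        case True
        then show ?thesis
          using path_weight_inj[OF inf_path_on[OF yz(1)] inf_path_on[OF yz(2)] r eq, of i] i by simp
      next
        case False
        then show ?thesis using n[OF y, of i] n[OF z, of i] by simp
      qed
    qed (use yz in \<open>auto simp: inf_paths_iff\<close>)
  qed
  moreover have "?w ` S \<subseteq> {..<C}"
  proof (rule image_subsetI)
    fix y assume y: "y \<in> S"
    then have "y \<in> inf_paths B" using S(1) by auto
    then have "?w y < path_count B (Suc n) (rng B (Suc n) (y (Suc n)))"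
      by (intro path_weight_less_end inf_path_on)
    also have "rng B (Suc n) (y (Suc n)) = rng B (Suc n) (x (Suc n))" using n[OF y, of "Suc n"] by simp
    also have "path_count B (Suc n) (rng B (Suc n) (x (Suc n))) \<le> C" using x(2) by (intro bound) simp
    finally show "?w y \<in> {..<C}" by simp
  qed
  ultimately have "card S \<le> card {..<C}" by (intro card_inj_on_le) auto
  then show False using S(3) by simp
qed

text \<open>Primitivity gives one path length for all pairs of vertices, which makes the later
  constants uniform. The length is a successor because the end vertices are read off from
  edges.\<close>

lemma class_connected:
  obtains K where "\<And>n u v. n \<ge> 1 \<Longrightarrow> u \<in> \<alpha> \<Longrightarrow> v \<in> \<alpha> \<Longrightarrow> \<exists>p \<in> class_paths B \<alpha> n (n + Suc K).
     src B (Suc n) (p (Suc n)) = u \<and> rng B (n + Suc K) (p (n + Suc K)) = v"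
proof -
  obtain K' where K': "K' \<ge> 1" "\<And>u v. u \<in> \<alpha> \<Longrightarrow> v \<in> \<alpha> \<Longrightarrow> (u, v) \<in> class_graph F \<alpha> ^^ K'"
    using primitive[OF class_graph_nonempty] by blast
  then obtain K where K: "K' = Suc K" by (cases K') auto
  show ?thesis
  proof (rule that[of K])
    fix n u v assume "n \<ge> (1::nat)" "u \<in> \<alpha>" "v \<in> \<alpha>"
    then show "\<exists>p \<in> class_paths B \<alpha> n (n + Suc K).
        src B (Suc n) (p (Suc n)) = u \<and> rng B (n + Suc K) (p (n + Suc K)) = v"
      using K' K by (intro class_path_exists[OF class_verts(1)]) auto
  qed
qed

text \<open>If no vertex of the class had two outgoing edges within the class, then the successor of a
  vertex maximizing \<open>\<xi>\<close> would have a larger value of \<open>\<xi>\<close>.\<close>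

lemma class_diamond_exists:
  obtains b \<omega> \<omega>' where "class_diamond B \<alpha> 1 b \<omega> \<omega>'"
proof -
  obtain u where u: "u \<in> \<alpha>" "\<And>v. v \<in> \<alpha> \<Longrightarrow> \<xi> v \<le> \<xi> u"
  proof -
    have "Max (\<xi> ` \<alpha>) \<in> \<xi> ` \<alpha>" using finite_class class_verts by (intro Max_in) auto
    then obtain u where "u \<in> \<alpha>" "Max (\<xi> ` \<alpha>) = \<xi> u" by auto
    then show ?thesis using that[of u] finite_class by (metis Max_ge finite_imageI imageI)
  qed
  define E where "E = {e \<in> edges B 2. src B 2 e = u \<and> rng B 2 e \<in> \<alpha>}"
  obtain v where v: "v \<in> \<alpha>" "F $$ (v, u) > 0" using class_next[OF u(1)] by blast
  obtain e where e: "e \<in> edges B 2" "src B 2 e = u" "rng B 2 e = v"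
    using edge_between[of 1 v u] v u class_vertex by (auto simp: numeral_2_eq_2)
  have "\<exists>e'\<in>E. e' \<noteq> e"
  proof (rule ccontr)
    assume no: "\<not> (\<exists>e'\<in>E. e' \<noteq> e)"
    have "F $$ (v', u) * \<xi> v' = (if v' = v then \<xi> v else 0)" if v': "v' < dim_row F" for v'
    proof (cases "v' \<in> \<alpha>")
      case True
      have "F $$ (v', u) = card {d \<in> edges_into B 2 v'. src B 2 d = u}"
        using card_edges_between[of 1 v' u] v' class_vertex[OF u(1)] by (simp add: numeral_2_eq_2)
      also have "{d \<in> edges_into B 2 v'. src B 2 d = u} = (if v' = v then {e} else {})"
        using no e True by (auto simp: edges_into_def E_def)
      finally show ?thesis by simp
    next
      case False
      then have "F $$ (v', u) = 0 \<or> \<xi> v' = 0"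
        using xi_stay[OF u(1) v'] xi_nonneg[OF v'] by fastforce
      then show ?thesis using False v by auto
    qed
    then have "(\<Sum>v'<dim_row F. real (F $$ (v', u)) * \<xi> v') = (\<Sum>v'<dim_row F. if v' = v then \<xi> v else 0)"
      by (intro sum.cong) auto
    also have "\<dots> = \<xi> v" using class_vertex[OF v(1)] by simp
    finally have "\<rho> * \<xi> u = \<xi> v" using eigen[OF class_vertex[OF u(1)]] by simp
    moreover have "\<xi> u < \<rho> * \<xi> u" using radius_gt_1 xi_pos[OF u(1)] by simp
    ultimately show False using u(2)[OF v(1)] by simp
  qed
  then obtain e' where e': "e' \<in> edges B 2" "src B 2 e' = u" "rng B 2 e' \<in> \<alpha>" "e' \<noteq> e"
    by (auto simp: E_def)
  obtain K where K: "\<And>n u v. n \<ge> 1 \<Longrightarrow> u \<in> \<alpha> \<Longrightarrow> v \<in> \<alpha> \<Longrightarrow> \<exists>p \<in> class_paths B \<alpha> n (n + Suc K).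
     src B (Suc n) (p (Suc n)) = u \<and> rng B (n + Suc K) (p (n + Suc K)) = v"
    using class_connected by blast
  \<comment> \<open>Both edges are continued back to \<open>u\<close> by class paths of a common
    length, which closes the diamond.\<close>
  have ext: "\<exists>w. w \<in> class_paths B \<alpha> 1 (2 + Suc K) \<and> w 2 = d \<and> rng B (2 + Suc K) (w (2 + Suc K)) = u"
    if d: "d \<in> edges B 2" "src B 2 d = u" "rng B 2 d \<in> \<alpha>" for d
  proof -
    obtain p where p: "p \<in> class_paths B \<alpha> 2 (2 + Suc K)" "src B (Suc 2) (p (Suc 2)) = rng B 2 d"
      "rng B (2 + Suc K) (p (2 + Suc K)) = u"
      using K[of 2 "rng B 2 d" u] d u by auto
    have s: "(\<lambda>i\<in>{1<..2}. d) \<in> class_paths B \<alpha> 1 2"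
      using single_edge_path[of 1 d \<alpha>] d u by (simp add: numeral_2_eq_2)
    show ?thesis
    proof (intro exI conjI)
      show "path_append 2 (\<lambda>i\<in>{1<..2}. d) p \<in> class_paths B \<alpha> 1 (2 + Suc K)"
        using p(2) by (intro class_paths_append[OF s p(1)]) auto
    qed (use p in \<open>auto simp: path_append_def\<close>)
  qed
  obtain w w' where w: "w \<in> class_paths B \<alpha> 1 (2 + Suc K)" "w 2 = e" "rng B (2 + Suc K) (w (2 + Suc K)) = u"
    and w': "w' \<in> class_paths B \<alpha> 1 (2 + Suc K)" "w' 2 = e'" "rng B (2 + Suc K) (w' (2 + Suc K)) = u"
    using ext[of e] ext[of e'] e e' v by blast
  have "class_diamond B \<alpha> 1 (2 + Suc K) w w'"
    using w w' e e' by (auto simp: class_diamond_def diamond_def class_paths_def numeral_2_eq_2)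
  then show ?thesis by (rule that)
qed

end

section \<open>The measure on the path space\<close>

text \<open>Exchanges the cylinders of \<open>p\<close> and \<open>q\<close> and fixes all other
  points. These involutions are total and generate the tail equivalence, so they can stand in for
  powers of the Vershik map in questions of measure.\<close>

definition path_swap :: "nat \<Rightarrow> (nat \<Rightarrow> 'e) \<Rightarrow> (nat \<Rightarrow> 'e) \<Rightarrow> (nat \<Rightarrow> 'e) \<Rightarrow> nat \<Rightarrow> 'e" where
  "path_swap n p q x =
     (if \<forall>i\<in>{1..n}. x i = p i then path_append n q x
      else if \<forall>i\<in>{1..n}. x i = q i then path_append n p x else x)"

text \<open>The finite unions of cylinders of length \<open>m\<close>.\<close>

definition level_determined :: "('v, 'e) bratteli \<Rightarrow> nat \<Rightarrow> (nat \<Rightarrow> 'e) set \<Rightarrow> bool" where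
  "level_determined B m C \<longleftrightarrow> C \<subseteq> inf_paths B \<and>
     (\<forall>x\<in>C. \<forall>y\<in>inf_paths B. (\<forall>i\<in>{1..m}. x i = y i) \<longrightarrow> y \<in> C)"

text \<open>The lower bound on the length makes the family stable under preimages by
  \<open>path_swap m\<close>, and it still generates the Borel sets.\<close>

definition long_cylinders :: "('v, 'e) bratteli \<Rightarrow> nat \<Rightarrow> (nat \<Rightarrow> 'e) set set" where
  "long_cylinders B m = {cylinder B n p | n p. m \<le> n \<and> p \<in> fin_paths B 0 n}"

lemma path_swap_cong:
  assumes "n \<le> m" "\<forall>i\<in>{1..m}. x i = y i"
  shows "\<forall>i\<in>{1..m}. path_swap n p q x i = path_swap n p q y i"
proof -
  have "(\<forall>i\<in>{1..n}. x i = r i) \<longleftrightarrow> (\<forall>i\<in>{1..n}. y i = r i)" for r using assms by auto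
  then show ?thesis using assms by (auto simp: path_swap_def path_append_def)
qed

lemma path_swap_involution:
  "1 \<le> i \<Longrightarrow> path_swap n p q (path_swap n p q x) i = x i"
  by (auto simp: path_swap_def path_append_def)

lemma path_swap_agree_iff:
  assumes "n \<le> m"
  shows "(\<forall>i\<in>{1..m}. path_swap n p q x i = r i) \<longleftrightarrow> (\<forall>i\<in>{1..m}. x i = path_swap n p q r i)"
proof
  assume "\<forall>i\<in>{1..m}. path_swap n p q x i = r i"
  from path_swap_cong[OF assms this, of p q] show "\<forall>i\<in>{1..m}. x i = path_swap n p q r i"
    by (simp add: path_swap_involution)
next
  assume "\<forall>i\<in>{1..m}. x i = path_swap n p q r i"
  from path_swap_cong[OF assms this, of p q] show "\<forall>i\<in>{1..m}. path_swap n p q x i = r i"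
    by (simp add: path_swap_involution)
qed

lemma cylinder_subset: "cylinder B n p \<subseteq> inf_paths B"
  by (auto simp: cylinder_def)

lemma cylinder_antimono: "n \<le> m \<Longrightarrow> cylinder B m x \<subseteq> cylinder B n x"
  by (auto simp: cylinder_def)

lemma level_determined_mono: "level_determined B m C \<Longrightarrow> m \<le> m' \<Longrightarrow> level_determined B m' C"
  by (auto simp: level_determined_def)

lemma level_determined_cylinder: "level_determined B n (cylinder B n p)"
  by (auto simp: level_determined_def cylinder_def)

lemma generate_topology_cylinder:
  assumes "generate_topology_on {cylinder B n p | n p. p \<in> fin_paths B 0 n} U" "x \<in> U"
  shows "\<exists>n. cylinder B n x \<subseteq> U"
  using assms
proof induction
  case (Int a b)
  then obtain n m where "cylinder B n x \<subseteq> a" "cylinder B m x \<subseteq> b" by auto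
  moreover have "cylinder B (max n m) x \<subseteq> cylinder B n x" "cylinder B (max n m) x \<subseteq> cylinder B m x"
    by (simp_all add: cylinder_antimono)
  ultimately have "cylinder B (max n m) x \<subseteq> a \<inter> b" by blast
  then show ?case by (rule exI)
next
  case (UN K)
  then obtain k where k: "k \<in> K" "x \<in> k" by blast
  then obtain n where "cylinder B n x \<subseteq> k" using UN(2) by blast
  then have "cylinder B n x \<subseteq> \<Union>K" using k by blast
  then show ?case by (rule exI)
next
  case (Basis s)
  then obtain n p where s: "s = cylinder B n p" by blast
  have "cylinder B n x \<subseteq> s" using Basis(2) unfolding s by (simp add: cylinder_def Collect_mono_iff)
  then show ?case by (rule exI)
qed simp

context ordered_bratteli
begin

section \<open>Cylinders as generators of the Borel sets\<close>

lemma inf_path_prefix: "x \<in> inf_paths B \<Longrightarrow> restrict x {0<..n} \<in> fin_paths B 0 n"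
  using inf_path_on[of x 0 n] path_on_cong[of 0 n "restrict x {0<..n}" x B] by (simp add: fin_paths_iff)

lemma mem_own_cylinder: "x \<in> inf_paths B \<Longrightarrow> x \<in> cylinder B n (restrict x {0<..n})"
  by (auto simp: cylinder_def)

lemma cylinder_restrict: "cylinder B n (restrict x {0<..n}) = cylinder B n x"
  by (auto simp: cylinder_def)

lemma cylinder_disjoint:
  assumes "p \<in> fin_paths B 0 n" "q \<in> fin_paths B 0 n" "p \<noteq> q"
  shows "cylinder B n p \<inter> cylinder B n q = {}"
proof (rule ccontr)
  assume "\<not> ?thesis"
  then have "\<forall>i\<in>{1..n}. p i = q i" by (auto simp: cylinder_def)
  then have "p = q" using assms
    by (intro extensionalityI[of p "{0<..n}"]) (auto simp: fin_paths_iff)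
  then show False using assms by simp
qed

lemma level_determined_eq_Union:
  assumes "level_determined B m C"
  shows "C = (\<Union>p\<in>{p \<in> fin_paths B 0 m. cylinder B m p \<subseteq> C}. cylinder B m p)"
proof (intro equalityI subsetI)
  fix x assume x: "x \<in> C"
  then have xi: "x \<in> inf_paths B" using assms by (auto simp: level_determined_def)
  have "cylinder B m (restrict x {0<..m}) \<subseteq> C"
    unfolding cylinder_restrict using assms x by (auto simp: level_determined_def cylinder_def)
  then show "x \<in> (\<Union>p\<in>{p \<in> fin_paths B 0 m. cylinder B m p \<subseteq> C}. cylinder B m p)"
    using inf_path_prefix[OF xi] mem_own_cylinder[OF xi] by blast
qed auto

lemma countable_long_cylinders: "countable (long_cylinders B m)"
proof -
  have "long_cylinders B m \<subseteq> (\<Union>n. cylinder B n ` fin_paths B 0 n)" by (auto simp: long_cylinders_def)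
  moreover have "countable (\<Union>n. cylinder B n ` fin_paths B 0 n)"
    by (intro countable_UN countableI_type) (simp add: countable_finite finite_fin_paths)
  ultimately show ?thesis by (rule countable_subset)
qed

lemma long_cylinders_subset: "long_cylinders B m \<subseteq> Pow (inf_paths B)"
  using cylinder_subset by (fastforce simp: long_cylinders_def)

lemma open_cylinder: "p \<in> fin_paths B 0 n \<Longrightarrow> openin (path_topology B) (cylinder B n p)"
  unfolding path_topology_def by (rule topology_generated_by_Basis) blast

lemma open_subset: "openin (path_topology B) U \<Longrightarrow> U \<subseteq> inf_paths B"
  using openin_subset[of "path_topology B" U] cylinder_subset
  by (fastforce simp: path_topology_def topology_generated_by_topspace)

text \<open>An open set is the union of the cylinders inside it. There are only countably many
  cylinders, and around each point they can be taken as long as desired.\<close>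

lemma sets_path_borel: "sets (path_borel B) = sigma_sets (inf_paths B) (long_cylinders B m)"
proof -
  let ?O = "{U. openin (path_topology B) U}"
  have O: "?O \<subseteq> Pow (inf_paths B)" using open_subset by auto
  have "sigma_sets (inf_paths B) ?O = sigma_sets (inf_paths B) (long_cylinders B m)"
  proof (rule sigma_sets_eqI)
    fix U assume U: "U \<in> ?O"
    have "U = \<Union>{c \<in> long_cylinders B m. c \<subseteq> U}"
    proof (intro equalityI subsetI)
      fix x assume x: "x \<in> U"
      then have xi: "x \<in> inf_paths B" using O U by auto
      have "generate_topology_on {cylinder B n p | n p. p \<in> fin_paths B 0 n} U"
        using U by (simp add: path_topology_def openin_topology_generated_by_iff)
      then obtain n where n: "cylinder B n x \<subseteq> U" using generate_topology_cylinder x by blast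
      let ?c = "cylinder B (max m n) (restrict x {0<..max m n})"
      have "?c \<subseteq> cylinder B n x" unfolding cylinder_restrict by (auto simp: cylinder_def)
      moreover have "?c \<in> long_cylinders B m"
        using inf_path_prefix[OF xi] unfolding long_cylinders_def by (metis (mono_tags, lifting) max.cobounded1 mem_Collect_eq)
      ultimately show "x \<in> \<Union>{c \<in> long_cylinders B m. c \<subseteq> U}"
        using n mem_own_cylinder[OF xi] by blast
    qed auto
    moreover have "\<Union>{c \<in> long_cylinders B m. c \<subseteq> U} \<in> sigma_sets (inf_paths B) (long_cylinders B m)"
      by (rule sigma_sets_UNION)
        (auto intro: countable_subset[OF _ countable_long_cylinders[of m]] sigma_sets.Basic)
    ultimately show "U \<in> sigma_sets (inf_paths B) (long_cylinders B m)" by simp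
  next
    fix c assume "c \<in> long_cylinders B m"
    then show "c \<in> sigma_sets (inf_paths B) ?O"
      by (intro sigma_sets.Basic) (auto simp: long_cylinders_def intro: open_cylinder)
  qed
  then show ?thesis using O by (simp add: path_borel_def)
qed

lemma space_path_borel: "space (path_borel B) = inf_paths B"
  unfolding path_borel_def using open_subset by (intro space_measure_of) auto

lemma path_swap_fin:
  assumes "p \<in> fin_paths B 0 n" "q \<in> fin_paths B 0 n" "rng B n (p n) = rng B n (q n)" "1 \<le> n" "n \<le> m"
    and r: "r \<in> fin_paths B 0 m"
  shows "path_swap n p q r \<in> fin_paths B 0 m" and "rng B m (path_swap n p q r m) = rng B m (r m)"
proof -
  have app: "path_append n s r \<in> fin_paths B 0 m \<and> rng B m (path_append n s r m) = rng B m (r m)"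
    if s: "s \<in> fin_paths B 0 n" "rng B n (s n) = rng B n (r n)" for s
  proof
    have "path_on B 0 m (path_append n s r)"
    proof (rule path_on_append)
      show "path_on B 0 n s" using s by (simp add: fin_paths_iff)
      show "path_on B n m r" using r by (auto simp: fin_paths_iff elim: path_on_subset)
      show "rng B n (s n) = src B (Suc n) (r (Suc n))" if "0 < n" "n < m"
        using r s that by (simp add: fin_paths_iff path_on_def)
    qed (use assms in auto)
    then show "path_append n s r \<in> fin_paths B 0 m"
      using s r assms(5) by (auto simp: fin_paths_iff extensional_def path_append_def)
    show "rng B m (path_append n s r m) = rng B m (r m)"
      using s assms(4,5) by (cases "m = n") (auto simp: path_append_def)
  qed
  show "path_swap n p q r \<in> fin_paths B 0 m"
    using app[OF assms(1)] app[OF assms(2)] assms r by (auto simp: path_swap_def)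
  show "rng B m (path_swap n p q r m) = rng B m (r m)"
    using app[OF assms(1)] app[OF assms(2)] assms r by (auto simp: path_swap_def)
qed

lemma path_swap_inf:
  assumes "p \<in> fin_paths B 0 n" "q \<in> fin_paths B 0 n" "rng B n (p n) = rng B n (q n)" "1 \<le> n"
    and x: "x \<in> inf_paths B"
  shows "path_swap n p q x \<in> inf_paths B"
proof -
  have app: "path_append n s x \<in> inf_paths B" if s: "s \<in> fin_paths B 0 n" "rng B n (s n) = rng B n (x n)" for s
    using s x inf_path_rng[OF x assms(4)] by (intro inf_pathsI_append) (auto simp: fin_paths_iff extensional_def)
  show ?thesis
    using app[OF assms(1)] app[OF assms(2)] assms by (auto simp: path_swap_def)
qed

lemma path_swap_cylinder:
  assumes "p \<in> fin_paths B 0 n" "q \<in> fin_paths B 0 n" "rng B n (p n) = rng B n (q n)" "1 \<le> n" "n \<le> m"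
  shows "path_swap n p q -` cylinder B m r \<inter> inf_paths B = cylinder B m (path_swap n p q r)"
  using path_swap_agree_iff[OF assms(5), of p q _ r] path_swap_inf[OF assms(1-4)]
  by (auto simp: cylinder_def)

text \<open>Two cylinders are nested or disjoint; the disjoint case calls for the empty set, and the
  whole space serves as the exhausting set in the uniqueness theorem for measures.\<close>

lemma Int_stable_long_cylinders: "Int_stable (insert {} (insert (inf_paths B) (long_cylinders B m)))"
proof -
  have *: "cylinder B n p \<inter> cylinder B k q \<in> insert {} (long_cylinders B m)"
    if "m \<le> n" "n \<le> k" "p \<in> fin_paths B 0 n" "q \<in> fin_paths B 0 k" for n k p q
  proof (cases "\<forall>i\<in>{1..n}. q i = p i")
    case True
    then have "cylinder B n p \<inter> cylinder B k q = cylinder B k q" using that by (auto simp: cylinder_def)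
    then show ?thesis using that by (auto simp: long_cylinders_def)
  next
    case False
    then have "cylinder B n p \<inter> cylinder B k q = {}" using that by (auto simp: cylinder_def)
    then show ?thesis by simp
  qed
  have "a \<inter> b \<in> insert {} (long_cylinders B m)" if ab: "a \<in> long_cylinders B m" "b \<in> long_cylinders B m" for a b
  proof -
    obtain n p k q where "a = cylinder B n p" "m \<le> n" "p \<in> fin_paths B 0 n"
      "b = cylinder B k q" "m \<le> k" "q \<in> fin_paths B 0 k" using ab by (auto simp: long_cylinders_def)
    then show ?thesis using *[of n k p q] *[of k n q p] by (cases "n \<le> k") (auto simp: Int_commute)
  qed
  moreover have "inf_paths B \<inter> a = a" if "a \<in> long_cylinders B m" for a
    using that long_cylinders_subset by blast
  ultimately show ?thesis unfolding Int_stable_def by (auto simp: Int_commute)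
qed

end

sublocale class_system \<subseteq> prob_space M
  by (rule prob)

context class_system
begin

lemma space_M: "space M = inf_paths B"
  using sets_eq_imp_space_eq[OF sets_M] space_path_borel by simp

lemma sets_M_eq: "sets M = sigma_sets (inf_paths B) (long_cylinders B m)"
  using sets_M sets_path_borel by simp

lemma cylinder_in_sets: "p \<in> fin_paths B 0 n \<Longrightarrow> cylinder B n p \<in> sets M"
  unfolding sets_M_eq[of 0] by (rule sigma_sets.Basic) (auto simp: long_cylinders_def)

lemma level_determined_in_sets:
  assumes "level_determined B m C"
  shows "C \<in> sets M"
  by (subst level_determined_eq_Union[OF assms])
    (auto intro!: sets.finite_UN cylinder_in_sets simp: finite_fin_paths)

lemma measure_level_determined_Int:
  assumes C: "level_determined B m C" and A: "A \<in> sets M"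
  shows "measure M (C \<inter> A) = (\<Sum>p | p \<in> fin_paths B 0 m \<and> cylinder B m p \<subseteq> C. measure M (cylinder B m p \<inter> A))"
proof -
  let ?S = "{p \<in> fin_paths B 0 m. cylinder B m p \<subseteq> C}"
  have "C \<inter> A = (\<Union>p\<in>?S. cylinder B m p \<inter> A)" using level_determined_eq_Union[OF C] by blast
  moreover have "measure M (\<Union>p\<in>?S. cylinder B m p \<inter> A) = (\<Sum>p\<in>?S. measure M (cylinder B m p \<inter> A))"
  proof (rule finite_measure_finite_Union)
    show "finite ?S" by (simp add: finite_fin_paths)
    show "(\<lambda>p. cylinder B m p \<inter> A) ` ?S \<subseteq> sets M" using A cylinder_in_sets by auto
    show "disjoint_family_on (\<lambda>p. cylinder B m p \<inter> A) ?S"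
      using cylinder_disjoint by (fastforce simp: disjoint_family_on_def)
  qed
  ultimately show ?thesis by simp
qed

section \<open>Invariance of the measure under exchange of initial segments\<close>

lemma path_swap_measurable:
  assumes "p \<in> fin_paths B 0 n" "q \<in> fin_paths B 0 n" "rng B n (p n) = rng B n (q n)" "1 \<le> n"
  shows "path_swap n p q \<in> measurable M M"
proof (rule measurable_sigma_sets[OF sets_M_eq[of n] long_cylinders_subset])
  show "path_swap n p q \<in> space M \<rightarrow> inf_paths B" using path_swap_inf[OF assms] by (simp add: space_M)
  fix c assume "c \<in> long_cylinders B n"
  then obtain m r where c: "c = cylinder B m r" "n \<le> m" "r \<in> fin_paths B 0 m"
    by (auto simp: long_cylinders_def)
  then show "path_swap n p q -` c \<inter> space M \<in> sets M"
    using path_swap_cylinder[OF assms c(2)] cylinder_in_sets path_swap_fin(1)[OF assms c(2,3)]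
    by (simp add: space_M)
qed

text \<open>The measure of a cylinder depends only on its length and its end vertex, and a swap
  changes neither; so both measures agree on an intersection-stable generator.\<close>

lemma distr_path_swap:
  assumes "p \<in> fin_paths B 0 n" "q \<in> fin_paths B 0 n" "rng B n (p n) = rng B n (q n)" "1 \<le> n"
  shows "distr M M (path_swap n p q) = M"
proof (rule measure_eqI_generator_eq[OF Int_stable_long_cylinders[of n], where A = "\<lambda>_. inf_paths B"])
  note meas = path_swap_measurable[OF assms]
  let ?E = "insert {} (insert (inf_paths B) (long_cylinders B n))"
  show E: "?E \<subseteq> Pow (inf_paths B)" using long_cylinders_subset by auto
  have "sigma_sets (inf_paths B) ?E = sigma_sets (inf_paths B) (long_cylinders B n)"
    by (rule sigma_sets_eqI) (auto intro: sigma_sets.Basic sigma_sets.Empty sigma_sets_top)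
  then show "sets M = sigma_sets (inf_paths B) ?E" "sets (distr M M (path_swap n p q)) = sigma_sets (inf_paths B) ?E"
    using sets_M_eq[of n] by simp_all
  show main: "emeasure (distr M M (path_swap n p q)) X = emeasure M X" if X: "X \<in> ?E" for X
  proof -
    have XM: "X \<in> sets M" using X sets_M_eq[of n] sets.top[of M] by (auto simp: space_M intro: sigma_sets.Basic)
    have "emeasure (distr M M (path_swap n p q)) X = emeasure M (path_swap n p q -` X \<inter> inf_paths B)"
      using emeasure_distr[OF meas XM] by (simp add: space_M)
    also have "\<dots> = emeasure M X"
    proof (cases "X \<in> long_cylinders B n")
      case True
      then obtain m r where c: "X = cylinder B m r" "n \<le> m" "r \<in> fin_paths B 0 m"
        by (auto simp: long_cylinders_def)
      have m: "1 \<le> m" using c assms by simp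
      have "measure M (cylinder B m (path_swap n p q r)) = measure M (cylinder B m r)"
        using measure_cylinder[OF m] path_swap_fin[OF assms c(2,3)] c(3) by simp
      then show ?thesis
        using c path_swap_cylinder[OF assms c(2)] by (simp add: emeasure_eq_measure)
    next
      case False
      then have "X = {} \<or> X = inf_paths B" using X by auto
      moreover have "path_swap n p q -` inf_paths B \<inter> inf_paths B = inf_paths B"
        using path_swap_inf[OF assms] by auto
      ultimately show ?thesis by auto
    qed
    finally show ?thesis .
  qed
  show "emeasure (distr M M (path_swap n p q)) (inf_paths B) \<noteq> \<infinity>"
    using main[of "inf_paths B"] by simp
qed auto

lemma AE_path_swap:
  assumes "p \<in> fin_paths B 0 n" "q \<in> fin_paths B 0 n" "rng B n (p n) = rng B n (q n)" "1 \<le> n"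
    and "AE x in M. P x"
  shows "AE x in M. P (path_swap n p q x)"
proof (rule AE_distrD[OF path_swap_measurable[OF assms(1-4)]])
  show "AE x in distr M M (path_swap n p q). P x"
    unfolding distr_path_swap[OF assms(1-4)] by (rule assms(5))
qed

text \<open>There are countably many swaps, so a single null set serves all of them.\<close>

lemma AE_path_swap_all:
  assumes "AE x in M. P x"
  shows "AE x in M. \<forall>n\<ge>1. \<forall>p\<in>fin_paths B 0 n. \<forall>q\<in>fin_paths B 0 n.
     rng B n (p n) = rng B n (q n) \<longrightarrow> P (path_swap n p q x)"
proof -
  have "AE x in M. \<forall>p\<in>fin_paths B 0 n. \<forall>q\<in>fin_paths B 0 n.
     rng B n (p n) = rng B n (q n) \<longrightarrow> n \<ge> 1 \<longrightarrow> P (path_swap n p q x)" for n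
  proof (intro AE_finite_allI finite_fin_paths)
    fix p q assume pq: "p \<in> fin_paths B 0 n" "q \<in> fin_paths B 0 n"
    show "AE x in M. rng B n (p n) = rng B n (q n) \<longrightarrow> n \<ge> 1 \<longrightarrow> P (path_swap n p q x)"
    proof (cases "rng B n (p n) = rng B n (q n) \<and> n \<ge> 1")
      case True
      then have "AE x in M. P (path_swap n p q x)" using AE_path_swap pq assms by blast
      then show ?thesis by auto
    qed auto
  qed
  then have "AE x in M. \<forall>n. \<forall>p\<in>fin_paths B 0 n. \<forall>q\<in>fin_paths B 0 n.
     rng B n (p n) = rng B n (q n) \<longrightarrow> n \<ge> 1 \<longrightarrow> P (path_swap n p q x)"
    by (simp add: AE_all_countable)
  then show ?thesis by eventually_elim blast
qed

text \<open>A path is determined beyond level \<open>m\<close> by its vertex at a level \<open>n > m\<close>, so the number of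
  prefixes of length \<open>n\<close> stays bounded while their measures tend to \<open>0\<close>.\<close>

lemma AE_not_eventually_unique_edges:
  assumes unique: "\<And>i d e. i \<ge> 1 \<Longrightarrow> Q i d \<Longrightarrow> Q i e \<Longrightarrow> rng B i d = rng B i e \<Longrightarrow> d = e"
  shows "AE x in M. \<not> (\<forall>i>m. Q i (x i))"
proof -
  define P where "P n = {p \<in> fin_paths B 0 n. \<forall>i\<in>{m<..n}. Q i (p i)}" for n
  define U where "U n = (\<Union>p\<in>P n. cylinder B n p)" for n
  \<comment> \<open>Number of prefixes times the size of their cylinders: at most
    \<open>dim_row F * card (fin_paths B 0 m)\<close> prefixes of length \<open>Suc n\<close>, each
    of measure at most the sum of \<xi> divided by \<open>\<rho> ^ n\<close>.\<close>
  define D where "D = real (dim_row F * card (fin_paths B 0 m)) * (\<Sum>v<dim_row F. \<xi> v)"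
  have fin: "finite (P n)" for n by (simp add: P_def finite_fin_paths)
  have Us: "U n \<in> sets M" for n
    unfolding U_def using fin by (intro sets.finite_UN) (auto simp: P_def intro: cylinder_in_sets)
  \<comment> \<open>Descending from level \<open>n\<close>: the vertex at a level determines the
    edge into it, and that edge determines the vertex below.\<close>
  have det: "p i = q i"
    if p: "p \<in> P n" and q: "q \<in> P n" and r: "rng B n (p n) = rng B n (q n)" and i: "m < i" "i \<le> n" for n p q i
    using i(2,1)
  proof (induction rule: inc_induct)
    case base
    then show ?case using unique[of n "p n" "q n"] p q r by (simp add: P_def)
  next
    case (step i)
    have "rng B i (p i) = rng B i (q i)"
      using step p q by (simp add: P_def fin_paths_iff path_on_def)
    then show ?case using unique[of i "p i" "q i"] p q step by (simp add: P_def)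
  qed
  have card: "card (P n) \<le> dim_row F * card (fin_paths B 0 m)" if n: "n > m" "n \<ge> 1" for n
  proof -
    let ?f = "\<lambda>p. (rng B n (p n), restrict p {0<..m})"
    have "inj_on ?f (P n)"
    proof (rule inj_onI)
      fix p q assume p: "p \<in> P n" and q: "q \<in> P n" and eq: "?f p = ?f q"
      show "p = q"
      proof (rule extensionalityI[of _ "{0<..n}"])
        fix i assume i: "i \<in> {0<..n}"
        show "p i = q i"
        proof (cases "i \<le> m")
          case True
          then have "restrict p {0<..m} i = restrict q {0<..m} i" using eq by simp
          then show ?thesis using True i by simp
        qed (use det[OF p q] eq i in auto)
      qed (use p q in \<open>auto simp: P_def fin_paths_iff\<close>)
    qed
    moreover have "?f ` P n \<subseteq> {..<dim_row F} \<times> fin_paths B 0 m"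
    proof (rule image_subsetI)
      fix p assume "p \<in> P n"
      then have on: "path_on B 0 n p" by (simp add: P_def fin_paths_iff)
      have "rng B n (p n) \<in> verts B n" using on n by (intro rng_in) (auto simp: path_on_def)
      moreover have "path_on B 0 m (restrict p {0<..m})"
        using path_on_cong[of 0 m "restrict p {0<..m}" p B] path_on_subset[OF on, of 0 m] n by simp
      ultimately show "?f p \<in> {..<dim_row F} \<times> fin_paths B 0 m"
        using verts_eq[of n] n by (simp add: fin_paths_iff)
    qed
    ultimately have "card (P n) \<le> card ({..<dim_row F} \<times> fin_paths B 0 m)"
      by (rule card_inj_on_le) (simp add: finite_fin_paths)
    then show ?thesis by (simp add: card_cartesian_product)
  qed
  have bound: "measure M (U (Suc n)) \<le> D * (1 / \<rho>) ^ n" if n: "n \<ge> m" for n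
  proof -
    have "measure M (U (Suc n)) \<le> (\<Sum>p\<in>P (Suc n). measure M (cylinder B (Suc n) p))"
      unfolding U_def using fin by (intro finite_measure_subadditive_finite) (auto simp: P_def intro: cylinder_in_sets)
    also have "\<dots> \<le> (\<Sum>p\<in>P (Suc n). (\<Sum>v<dim_row F. \<xi> v) * (1 / \<rho>) ^ n)"
    proof (rule sum_mono)
      fix p assume p: "p \<in> P (Suc n)"
      then have "rng B (Suc n) (p (Suc n)) \<in> verts B (Suc n)"
        by (intro rng_in) (auto simp: P_def fin_paths_iff path_on_def)
      then have "rng B (Suc n) (p (Suc n)) < dim_row F" using verts_eq[of "Suc n"] by simp
      then have "\<xi> (rng B (Suc n) (p (Suc n))) \<le> (\<Sum>v<dim_row F. \<xi> v)"
        using xi_nonneg by (intro member_le_sum) auto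
      moreover have "measure M (cylinder B (Suc n) p) = \<xi> (rng B (Suc n) (p (Suc n))) * (1 / \<rho>) ^ n"
        using measure_cylinder[of "Suc n" p] p by (simp add: P_def power_one_over)
      ultimately show "measure M (cylinder B (Suc n) p) \<le> (\<Sum>v<dim_row F. \<xi> v) * (1 / \<rho>) ^ n"
        using radius_pos by (simp add: mult_right_mono)
    qed
    also have "\<dots> = real (card (P (Suc n))) * ((\<Sum>v<dim_row F. \<xi> v) * (1 / \<rho>) ^ n)" by simp
    also have "\<dots> \<le> real (dim_row F * card (fin_paths B 0 m)) * ((\<Sum>v<dim_row F. \<xi> v) * (1 / \<rho>) ^ n)"
      using card[of "Suc n"] n radius_pos xi_nonneg
      by (intro mult_right_mono mult_nonneg_nonneg sum_nonneg) (auto simp del: of_nat_mult)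
    finally show ?thesis by (simp add: D_def mult_ac)
  qed
  define Z where "Z = (\<Inter>n. U n)"
  have Zs: "Z \<in> sets M" unfolding Z_def using Us by auto
  have "measure M Z \<le> 0"
  proof (rule LIMSEQ_le_const)
    have "(\<lambda>n. D * (1 / \<rho>) ^ n) \<longlonglongrightarrow> D * 0"
      using radius_gt_1 by (intro tendsto_mult tendsto_const LIMSEQ_power_zero) simp
    then show "(\<lambda>n. D * (1 / \<rho>) ^ n) \<longlonglongrightarrow> 0" by simp
    show "\<exists>N. \<forall>n\<ge>N. measure M Z \<le> D * (1 / \<rho>) ^ n"
    proof (intro exI allI impI)
      fix n assume "n \<ge> m"
      have "measure M Z \<le> measure M (U (Suc n))"
        unfolding Z_def using Us by (intro finite_measure_mono) auto
      also note bound[OF \<open>n \<ge> m\<close>]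
      finally show "measure M Z \<le> D * (1 / \<rho>) ^ n" .
    qed
  qed
  then have "emeasure M Z = 0" by (simp add: emeasure_eq_measure measure_le_0_iff)
  then have null: "Z \<in> null_sets M" using Zs by (simp add: null_sets_def)
  have "{x \<in> space M. \<not> \<not> (\<forall>i>m. Q i (x i))} \<subseteq> Z"
  proof
    fix x assume "x \<in> {x \<in> space M. \<not> \<not> (\<forall>i>m. Q i (x i))}"
    then have x: "x \<in> inf_paths B" "\<forall>i>m. Q i (x i)" by (auto simp: space_M)
    have "x \<in> U n" for n
    proof -
      have "restrict x {0<..n} \<in> P n" using inf_path_prefix[OF x(1)] x(2) by (auto simp: P_def)
      then show ?thesis unfolding U_def using mem_own_cylinder[OF x(1)] by blast
    qed
    then show "x \<in> Z" by (simp add: Z_def)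
  qed
  then show ?thesis by (rule AE_I'[OF null])
qed

text \<open>A path tail equivalent to a maximal or minimal path has only maximal or only minimal
  edges from some level on, and such an edge is determined by its range.\<close>

lemma AE_vershik_domain: "AE x in M. x \<in> vershik_domain B"
proof -
  have "AE x in M. \<forall>m. \<not> (\<forall>i>m. max_edge B i (x i))"
    unfolding AE_all_countable by (intro allI AE_not_eventually_unique_edges max_edge_unique)
  moreover have "AE x in M. \<forall>m. \<not> (\<forall>i>m. min_edge B i (x i))"
    unfolding AE_all_countable by (intro allI AE_not_eventually_unique_edges min_edge_unique)
  moreover have "AE x in M. x \<in> inf_paths B" using AE_space[of M] by (simp add: space_M)
  ultimately show ?thesis
  proof eventually_elim
    case (elim x)
    have "False" if y: "max_path B y \<or> min_path B y" "tail_equivalent x y" for y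
    proof -
      obtain n where "\<forall>i\<ge>n. x i = y i" using y by (auto simp: tail_equivalent_def)
      then have "(\<forall>i>n. max_edge B i (x i)) \<or> (\<forall>i>n. min_edge B i (x i))"
        using y(1) by (auto simp: max_path_def min_path_def)
      then show False using elim by blast
    qed
    then show ?case using elim by (auto simp: vershik_domain_def)
  qed
qed

text \<open>At every point of the domain the Vershik map agrees with one of countably many
  measure-preserving swaps, so it pulls null sets back to null sets.\<close>

lemma AE_vershik:
  assumes "AE x in M. P x"
  shows "AE x in M. P (vershik B x)"
  using AE_vershik_domain AE_path_swap_all[OF assms]
proof eventually_elim
  case (elim x)
  obtain k where k: "k \<ge> 1" "vershik B x \<in> inf_paths B" "\<And>i. i > k \<Longrightarrow> vershik B x i = x i"
    using vershik_step[OF elim(1)] by blast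
  have x: "x \<in> inf_paths B" using elim by (simp add: vershik_domain_def)
  let ?p = "restrict x {0<..k}" and ?q = "restrict (vershik B x) {0<..k}"
  have "path_swap k ?p ?q x = path_append k ?q x" by (simp add: path_swap_def)
  also have "\<dots> = vershik B x"
  proof
    fix i
    have "vershik B x 0 = undefined" using k(2) by (simp add: inf_paths_iff extensional_def)
    then show "path_append k ?q x i = vershik B x i"
      using k(3)[of i] by (cases "i = 0") (auto simp: path_append_def)
  qed
  finally have swap: "path_swap k ?p ?q x = vershik B x" .
  have r: "rng B k (?p k) = rng B k (?q k)"
    using inf_path_rng[OF x k(1)] inf_path_rng[OF k(2,1)] k(1) k(3)[of "Suc k"] by simp
  show ?case
    using elim(2)[rule_format, OF k(1) inf_path_prefix[OF x] inf_path_prefix[OF k(2)] r]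
    unfolding swap .
qed

text \<open>The cylinders that end at a zero of \<xi> are null, and there are countably many of
  them.\<close>

lemma AE_xi_pos: "AE x in M. \<forall>n\<ge>1. \<xi> (rng B n (x n)) > 0"
proof -
  have "AE x in M. \<forall>p\<in>fin_paths B 0 n. n \<ge> 1 \<longrightarrow> x \<in> cylinder B n p \<longrightarrow> \<xi> (rng B n (p n)) > 0" for n
  proof (intro AE_finite_allI finite_fin_paths)
    fix p assume p: "p \<in> fin_paths B 0 n"
    show "AE x in M. n \<ge> 1 \<longrightarrow> x \<in> cylinder B n p \<longrightarrow> \<xi> (rng B n (p n)) > 0"
    proof (cases "n \<ge> 1 \<and> \<xi> (rng B n (p n)) \<le> 0")
      case True
      have "measure M (cylinder B n p) = \<xi> (rng B n (p n)) / \<rho> ^ (n - 1)"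
        using True p by (intro measure_cylinder) auto
      then have "measure M (cylinder B n p) \<le> 0"
        using True radius_pos by (simp add: divide_nonpos_pos)
      then have "emeasure M (cylinder B n p) = 0" by (simp add: emeasure_eq_measure measure_le_0_iff)
      then have "cylinder B n p \<in> null_sets M" using cylinder_in_sets[OF p] by (simp add: null_sets_def)
      then have "AE x in M. x \<notin> cylinder B n p" by (rule AE_not_in)
      then show ?thesis by eventually_elim simp
    next
      case False
      then show ?thesis by (intro AE_I2) auto
    qed
  qed
  then have "AE x in M. \<forall>n. \<forall>p\<in>fin_paths B 0 n. n \<ge> 1 \<longrightarrow> x \<in> cylinder B n p \<longrightarrow> \<xi> (rng B n (p n)) > 0"
    by (simp add: AE_all_countable)
  moreover have "AE x in M. x \<in> inf_paths B" using AE_space[of M] by (simp add: space_M)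
  ultimately show ?thesis
  proof eventually_elim
    case (elim x)
    show ?case
    proof (intro allI impI)
      fix n :: nat assume n: "n \<ge> 1"
      then have "\<xi> (rng B n (restrict x {0<..n} n)) > 0"
        using elim(1) inf_path_prefix[OF elim(2), of n] mem_own_cylinder[OF elim(2), of n] by blast
      then show "\<xi> (rng B n (x n)) > 0" using n by simp
    qed
  qed
qed

section \<open>Approximation of measurable sets by finite unions of cylinders\<close>

lemma approx_level_determined:
  assumes "A \<in> sets M" "e > 0"
  shows "\<exists>m\<ge>1. \<exists>C. level_determined B m C \<and> measure M (sym_diff A C) < e"
  \<comment> \<open>Generators of length at least 1 keep the level in the range where the formula
    for the measure of cylinders holds.\<close>
  using assms(1) assms(2) unfolding sets_M_eq[of 1]
proof (induction arbitrary: e rule: sigma_sets.induct)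
  case (Basic a)
  then obtain n p where "a = cylinder B n p" "1 \<le> n" by (auto simp: long_cylinders_def)
  then show ?case using Basic level_determined_cylinder[of B n p] by (intro exI[of _ n]) auto
next
  case Empty
  then show ?case by (intro exI[of _ 1] exI[of _ "{}"]) (auto simp: level_determined_def)
next
  case (Compl a)
  then obtain m C where mC: "m \<ge> 1" "level_determined B m C" "measure M (sym_diff a C) < e" by blast
  have "a \<subseteq> inf_paths B" by (rule sigma_sets_into_sp[OF long_cylinders_subset Compl(1)])
  moreover have "C \<subseteq> inf_paths B" using mC by (simp add: level_determined_def)
  ultimately have eq: "sym_diff (inf_paths B - a) (inf_paths B - C) = sym_diff a C" by blast
  have "level_determined B m (inf_paths B - C)" using mC by (auto simp: level_determined_def)
  moreover have "measure M (sym_diff (inf_paths B - a) (inf_paths B - C)) < e" unfolding eq by (rule mC(3))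
  ultimately show ?case using mC(1) by blast
next
  case (Union a)
  have aM: "a i \<in> sets M" for i using Union(1) sets_M_eq[of 1] by simp
  \<comment> \<open>A countable union is first truncated at a finite stage of nearly full measure;
    then finitely many sets are approximated at a common level.\<close>
  define b where "b k = (\<Union>i<k. a i)" for k
  have bM: "b k \<in> sets M" for k unfolding b_def using aM by auto
  have inc: "incseq b" by (rule incseq_SucI) (auto simp: b_def lessThan_Suc)
  have range: "range b \<subseteq> sets M" using bM by blast
  have Ub: "(\<Union>k. b k) = (\<Union>i. a i)"
    unfolding b_def lessThan_atLeast0 by (rule UN_UN_finite_eq)
  have lim: "(\<lambda>k. measure M (b k)) \<longlonglongrightarrow> measure M (\<Union>i. a i)"
    using finite_Lim_measure_incseq[OF range inc] unfolding Ub .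
  obtain k where "norm (measure M (b k) - measure M (\<Union>i. a i)) < e / 2"
    using LIMSEQ_D[OF lim, of "e / 2"] Union(3) by auto
  then have k: "\<bar>measure M (b k) - measure M (\<Union>i. a i)\<bar> < e / 2" by simp
  \<comment> \<open>The remaining error \<open>e / 2\<close> is shared among the \<open>k\<close>
    sets; \<open>Suc k\<close> keeps the denominator positive when \<open>k = 0\<close>.\<close>
  have "\<exists>m C. m \<ge> 1 \<and> level_determined B m C \<and> measure M (sym_diff (a i) C) < e / (2 * real (Suc k))" for i
    using Union(2)[of "e / (2 * real (Suc k))" i] Union(3) by (simp del: of_nat_Suc)
  then obtain m C where mC: "\<And>i. m i \<ge> (1::nat)" "\<And>i. level_determined B (m i) (C i)"
    "\<And>i. measure M (sym_diff (a i) (C i)) < e / (2 * real (Suc k))" by metis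
  define n where "n = Suc (\<Sum>i<k. m i)"
  have "level_determined B n (C i)" if "i < k" for i
  proof (rule level_determined_mono[OF mC(2)])
    show "m i \<le> n" unfolding n_def using that by (intro le_SucI member_le_sum) auto
  qed
  then have det: "level_determined B n (\<Union>i<k. C i)" unfolding level_determined_def by blast
  have CM: "C i \<in> sets M" for i using level_determined_in_sets mC(2) by blast
  let ?D = "(\<Union>i. a i) - b k" and ?G = "\<Union>i<k. sym_diff (a i) (C i)"
  have "sym_diff (\<Union>i. a i) (\<Union>i<k. C i) \<subseteq> ?D \<union> ?G" unfolding b_def by blast
  then have "measure M (sym_diff (\<Union>i. a i) (\<Union>i<k. C i)) \<le> measure M (?D \<union> ?G)"
    using aM bM CM by (intro finite_measure_mono) auto
  also have "\<dots> \<le> measure M ?D + measure M ?G"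
    using aM bM CM by (intro measure_Un_le) auto
  also have "measure M ?D = measure M (\<Union>i. a i) - measure M (b k)"
    using aM bM Ub by (intro finite_measure_Diff) auto
  also have "measure M ?G \<le> (\<Sum>i<k. measure M (sym_diff (a i) (C i)))"
    using aM CM by (intro finite_measure_subadditive_finite) auto
  also have "\<dots> \<le> (\<Sum>i<k. e / (2 * real (Suc k)))" by (intro sum_mono less_imp_le mC(3))
  also have "\<dots> = real k * (e / (2 * real (Suc k)))" by simp
  also have "\<dots> \<le> real (Suc k) * (e / (2 * real (Suc k)))"
    using Union(3) by (intro mult_right_mono) auto
  also have "\<dots> = e / 2" by (simp del: of_nat_Suc)
  finally have small: "measure M (sym_diff (\<Union>i. a i) (\<Union>i<k. C i)) < e" using k by linarith
  show ?case
    by (intro exI[of _ n] exI[of _ "\<Union>i<k. C i"] conjI det small) (simp add: n_def)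
qed

text \<open>Plays the part of a density theorem. If \<open>C\<close> is a union of cylinders close
  to \<open>A\<close>, the complement of \<open>A\<close> fills the proportion \<eta> of
  \<open>C\<close> as well; but \<open>C - A\<close> is small, so \<open>C\<close> and hence
  \<open>A\<close> are small.\<close>

lemma null_if_cylinders_miss:
  assumes A: "A \<in> sets M" and \<eta>: "\<eta> > 0"
    and miss: "\<And>m p. m \<ge> 1 \<Longrightarrow> p \<in> fin_paths B 0 m \<Longrightarrow>
      measure M (cylinder B m p - A) \<ge> \<eta> * measure M (cylinder B m p)"
  shows "measure M A = 0"
proof -
  have le: "\<eta> * measure M A \<le> (1 + \<eta>) * e" if e: "e > 0" for e
  proof -
    obtain m C where C: "m \<ge> 1" "level_determined B m C" "measure M (sym_diff A C) < e"
      using approx_level_determined[OF A e] by blast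
    have CM: "C \<in> sets M" by (rule level_determined_in_sets[OF C(2)])
    let ?S = "{p \<in> fin_paths B 0 m. cylinder B m p \<subseteq> C}"
    have "measure M C = measure M (C \<inter> space M)" using CM by (simp add: sets.Int_space_eq2)
    also have "\<dots> = (\<Sum>p\<in>?S. measure M (cylinder B m p \<inter> space M))"
      by (rule measure_level_determined_Int[OF C(2)]) simp
    also have "\<dots> = (\<Sum>p\<in>?S. measure M (cylinder B m p))"
      by (rule sum.cong) (auto simp: cylinder_in_sets sets.Int_space_eq2)
    finally have "\<eta> * measure M C = (\<Sum>p\<in>?S. \<eta> * measure M (cylinder B m p))" by (simp add: sum_distrib_left)
    also have "\<dots> \<le> (\<Sum>p\<in>?S. measure M (cylinder B m p \<inter> (space M - A)))"
    proof (rule sum_mono)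
      fix p assume p: "p \<in> ?S"
      have "cylinder B m p \<inter> (space M - A) = cylinder B m p - A"
        using cylinder_subset[of B m p] by (auto simp: space_M)
      then show "\<eta> * measure M (cylinder B m p) \<le> measure M (cylinder B m p \<inter> (space M - A))"
        using miss[OF C(1)] p by simp
    qed
    also have "\<dots> = measure M (C \<inter> (space M - A))"
      by (rule measure_level_determined_Int[OF C(2), symmetric]) (use A in auto)
    also have "\<dots> \<le> measure M (sym_diff A C)" using A CM by (intro finite_measure_mono) auto
    finally have "\<eta> * measure M C \<le> e" using C(3) by simp
    moreover have "measure M A \<le> measure M (C \<union> sym_diff A C)"
      using A CM by (intro finite_measure_mono) auto
    then have "measure M A \<le> measure M C + e"
      using measure_Un_le[of C M "sym_diff A C"] A CM C(3) by auto
    then have "\<eta> * measure M A \<le> \<eta> * measure M C + \<eta> * e"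
      using \<eta> by (simp add: distrib_left[symmetric])
    ultimately show ?thesis by (simp add: algebra_simps)
  qed
  have "\<eta> * measure M A \<le> 0"
  proof (rule field_le_epsilon)
    fix d :: real assume "d > 0"
    then show "\<eta> * measure M A \<le> 0 + d" using le[of "d / (1 + \<eta>)"] \<eta> by simp
  qed
  then show ?thesis using \<eta> by (simp add: mult_le_0_iff measure_le_0_iff)
qed

end

section \<open>Eigenvalues satisfy the diamond condition\<close>

context class_system
begin

text \<open>Leaving the class would lead to a zero of \<xi>, which almost every path avoids.\<close>

lemma inf_path_stays:
  assumes x: "x \<in> inf_paths B" and pos: "\<forall>n\<ge>1. \<xi> (rng B n (x n)) > 0"
    and m: "m \<ge> 1" "rng B m (x m) \<in> \<alpha>" and n: "m \<le> n"
  shows "rng B n (x n) \<in> \<alpha>"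
  using n
proof (induction rule: dec_induct)
  case (step n)
  have n1: "n \<ge> 1" using step m by simp
  note e = edge_matrix_pos[OF n1 inf_path_edge[OF x, of "Suc n"]]
  have s: "src B (Suc n) (x (Suc n)) = rng B n (x n)" using inf_path_rng[OF x n1] by simp
  show ?case
    by (rule xi_stay[OF step.IH]) (use e pos s in auto)
qed (rule m(2))

lemma AE_inf_path: "AE x in M. x \<in> inf_paths B"
  using AE_space[of M] by (simp add: space_M)

lemma measure_pos_obtain:
  assumes "measure M C > 0" "C \<in> sets M" "AE x in M. P x"
  obtains x where "x \<in> C" "P x"
proof -
  have "\<not> (AE x in M. x \<notin> C)"
  proof
    assume "AE x in M. x \<notin> C"
    then have "C \<inter> space M \<in> null_sets M"
      using assms(2) by (simp add: AE_iff_null_sets sets.Int_space_eq2)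
    then show False using assms by (simp add: measure_eq_0_null_sets sets.Int_space_eq2)
  qed
  moreover have "AE x in M. x \<notin> C" if "\<not> (\<exists>x\<in>C. P x)"
    using assms(3) by eventually_elim (use that in auto)
  ultimately show ?thesis using that by blast
qed

text \<open>The ratio depends only on the two end vertices and the difference of the lengths, so
  finitely many vertices give bounds that are uniform in the level.\<close>

lemma measure_cylinder_ext:
  assumes p: "p \<in> fin_paths B 0 m" and q: "q \<in> fin_paths B 0 n" and mn: "1 \<le> m" "m \<le> n"
    and pos: "\<xi> (rng B m (p m)) > 0"
  shows "measure M (cylinder B n q)
    = \<xi> (rng B n (q n)) / (\<xi> (rng B m (p m)) * \<rho> ^ (n - m)) * measure M (cylinder B m p)"
proof -
  have "n - 1 = (n - m) + (m - 1)" using mn by simp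
  then have "\<rho> ^ (n - 1) = \<rho> ^ (n - m) * \<rho> ^ (m - 1)" by (simp only: power_add)
  then show ?thesis
    using measure_cylinder[OF _ p] measure_cylinder[OF _ q] mn pos radius_pos by simp
qed

lemma cylinder_append_subset: "cylinder B n (path_append m p q) \<subseteq> cylinder B m p" if "m \<le> n"
  using that by (auto simp: cylinder_def path_append_def)

text \<open>If the conclusion fails for arbitrarily large levels, then every cylinder contains a cylinder
  ending in the class, which in turn is covered up to a null set by cylinders that all extend within
  a fixed number of steps to cylinders ending at the bad vertex; so the complement of \<open>A\<close> fills a
  fixed proportion of every cylinder.\<close>

lemma class_density:
  assumes A: "A \<in> sets M" "measure M A > 0" and \<delta>: "\<delta> > 0"
  shows "\<exists>n0. \<forall>n\<ge>n0. \<forall>u\<in>\<alpha>. \<exists>\<tau>\<in>fin_paths B 0 n. rng B n (\<tau> n) = u \<and>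
    measure M (cylinder B n \<tau> - A) < \<delta> * measure M (cylinder B n \<tau>)"
proof (rule ccontr)
  assume "\<not> ?thesis"
  then have bad: "\<exists>n\<ge>n0. \<exists>u\<in>\<alpha>. \<forall>\<tau>\<in>fin_paths B 0 n. rng B n (\<tau> n) = u \<longrightarrow>
      \<delta> * measure M (cylinder B n \<tau>) \<le> measure M (cylinder B n \<tau> - A)" for n0
    by (fastforce simp: not_less)
  obtain K where K: "\<And>n u v. n \<ge> 1 \<Longrightarrow> u \<in> \<alpha> \<Longrightarrow> v \<in> \<alpha> \<Longrightarrow> \<exists>p \<in> class_paths B \<alpha> n (n + Suc K).
     src B (Suc n) (p (Suc n)) = u \<and> rng B (n + Suc K) (p (n + Suc K)) = v"
    using class_connected by blast
  have "\<exists>k. \<exists>u\<in>\<alpha>. \<xi> w > 0 \<longrightarrow> w < dim_row F \<longrightarrow> (w, u) \<in> class_graph F {..<dim_row F} ^^ k" for w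
    using xi_access[of w] class_verts(2) by blast
  then obtain k t where kt: "\<And>w. t w \<in> \<alpha>"
    "\<And>w. \<xi> w > 0 \<Longrightarrow> w < dim_row F \<Longrightarrow> (w, t w) \<in> class_graph F {..<dim_row F} ^^ k w" by metis
  define W where "W = {w. w < dim_row F \<and> \<xi> w > 0}"
  \<comment> \<open>Lower bounds for the proportion of a cylinder kept by an extension:
    \<open>c\<close> for extensions from the support of \<xi> into the class, \<kappa> for
    extensions by \<open>Suc K\<close> edges between vertices of the class.\<close>
  define c where "c = Min ((\<lambda>w. \<xi> (t w) / (\<xi> w * \<rho> ^ k w)) ` W)"
  define \<kappa> where "\<kappa> = Min ((\<lambda>(u, v). \<xi> v / (\<xi> u * \<rho> ^ Suc K)) ` (\<alpha> \<times> \<alpha>))"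
  have W: "finite W" "W \<noteq> {}" using class_verts xi_pos by (auto simp: W_def)
  have c: "c > 0" unfolding c_def using W kt(1) xi_pos radius_pos
    by (subst Min_gr_iff) (auto simp: W_def)
  have \<kappa>: "\<kappa> > 0" unfolding \<kappa>_def using finite_class class_verts xi_pos radius_pos
    by (subst Min_gr_iff) auto
  have c_le: "c \<le> \<xi> (t w) / (\<xi> w * \<rho> ^ k w)" if "w \<in> W" for w
    unfolding c_def using W that by (intro Min_le) auto
  have \<kappa>_le: "\<kappa> \<le> \<xi> v / (\<xi> u * \<rho> ^ Suc K)" if "u \<in> \<alpha>" "v \<in> \<alpha>" for u v
    unfolding \<kappa>_def using finite_class that by (intro Min_le) (auto intro!: image_eqI[of _ _ "(u, v)"])
  have class_ending: "\<delta> * \<kappa> * measure M (cylinder B m p) \<le> measure M (cylinder B m p - A)"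
    if m: "m \<ge> 1" and p: "p \<in> fin_paths B 0 m" and end_p: "rng B m (p m) \<in> \<alpha>" for m p
  proof -
    obtain n u where n: "n \<ge> m + Suc K" and u: "u \<in> \<alpha>" and
      n_bad: "\<And>\<tau>. \<tau> \<in> fin_paths B 0 n \<Longrightarrow> rng B n (\<tau> n) = u \<Longrightarrow>
        \<delta> * measure M (cylinder B n \<tau>) \<le> measure M (cylinder B n \<tau> - A)"
      using bad[of "m + Suc K"] by blast
    \<comment> \<open>From every class vertex at this level the bad vertex \<open>u\<close> at level
      \<open>n\<close> is reached in exactly \<open>Suc K\<close> steps.\<close>
    define l where "l = n - Suc K"
    have l: "m \<le> l" "l + Suc K = n" "l \<ge> 1" using n m by (auto simp: l_def)
    have det: "level_determined B l (cylinder B m p)"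
      using level_determined_mono[OF level_determined_cylinder l(1)] .
    let ?S = "{r \<in> fin_paths B 0 l. cylinder B l r \<subseteq> cylinder B m p}"
    \<comment> \<open>A subcylinder of positive measure contains a path that avoids the zeros of
      \<xi>; that path has entered the class by level \<open>m\<close>, so the subcylinder ends in
      the class. Null subcylinders satisfy the bound trivially.\<close>
    have each: "\<delta> * \<kappa> * measure M (cylinder B l r) \<le> measure M (cylinder B l r \<inter> (space M - A))"
      if r: "r \<in> ?S" for r
    proof (cases "measure M (cylinder B l r) > 0")
      case True
      have rl: "r \<in> fin_paths B 0 l" using r by simp
      have "AE x in M. x \<in> inf_paths B \<and> (\<forall>n\<ge>1. \<xi> (rng B n (x n)) > 0)"
        using AE_inf_path AE_xi_pos by eventually_elim simp
      then obtain x where x: "x \<in> cylinder B l r" "x \<in> inf_paths B" "\<forall>n\<ge>1. \<xi> (rng B n (x n)) > 0"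
        using measure_pos_obtain[OF True cylinder_in_sets[OF rl]] by blast
      have "x \<in> cylinder B m p" using x r by blast
      then have "rng B m (x m) \<in> \<alpha>" using end_p m by (simp add: cylinder_def)
      then have "rng B l (x l) \<in> \<alpha>" using inf_path_stays[OF x(2,3) m] l by blast
      then have end_r: "rng B l (r l) \<in> \<alpha>" using x(1) l by (simp add: cylinder_def)
      obtain \<pi> where \<pi>: "\<pi> \<in> class_paths B \<alpha> l n" "src B (Suc l) (\<pi> (Suc l)) = rng B l (r l)"
          "rng B n (\<pi> n) = u"
        using K[OF l(3) end_r u] l(2) by auto
      define \<tau> where "\<tau> = path_append l r \<pi>"
      have ln: "l < n" using l(2) by simp
      have \<tau>: "\<tau> \<in> fin_paths B 0 n" unfolding \<tau>_def
        using \<pi> rl ln by (intro fin_paths_append) (auto simp: class_paths_def)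
      have \<tau>n: "rng B n (\<tau> n) = u" using \<pi>(3) ln by (simp add: \<tau>_def path_append_def)
      have sub: "cylinder B n \<tau> \<subseteq> cylinder B l r"
        unfolding \<tau>_def using ln by (intro cylinder_append_subset) simp
      have "\<kappa> * measure M (cylinder B l r) \<le> \<xi> u / (\<xi> (rng B l (r l)) * \<rho> ^ Suc K) * measure M (cylinder B l r)"
        using \<kappa>_le[OF end_r u] by (intro mult_right_mono) auto
      also have "\<dots> = measure M (cylinder B n \<tau>)"
        using measure_cylinder_ext[OF rl \<tau> l(3) less_imp_le[OF ln] xi_pos[OF end_r]] l(2) \<tau>n
        by (metis add_diff_cancel_left')
      finally have "\<delta> * (\<kappa> * measure M (cylinder B l r)) \<le> \<delta> * measure M (cylinder B n \<tau>)"
        using \<delta> by (intro mult_left_mono) auto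
      also have "\<dots> \<le> measure M (cylinder B n \<tau> - A)" by (rule n_bad[OF \<tau> \<tau>n])
      also have "\<dots> \<le> measure M (cylinder B l r \<inter> (space M - A))"
      proof (rule finite_measure_mono)
        show "cylinder B n \<tau> - A \<subseteq> cylinder B l r \<inter> (space M - A)"
          using sub cylinder_subset[of B l r] by (auto simp: space_M)
      qed (use A cylinder_in_sets[OF rl] in auto)
      finally show ?thesis by (simp add: mult.assoc)
    next
      case False
      then have "measure M (cylinder B l r) = 0" using measure_nonneg[of M "cylinder B l r"] by linarith
      then show ?thesis by simp
    qed
    have pM: "cylinder B m p \<in> sets M" by (rule cylinder_in_sets[OF p])
    have "measure M (cylinder B m p) = measure M (cylinder B m p \<inter> space M)"
      using pM by (simp add: sets.Int_space_eq2)
    also have "\<dots> = (\<Sum>r\<in>?S. measure M (cylinder B l r \<inter> space M))"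
      by (rule measure_level_determined_Int[OF det]) simp
    also have "\<dots> = (\<Sum>r\<in>?S. measure M (cylinder B l r))"
      by (rule sum.cong) (auto simp: cylinder_in_sets sets.Int_space_eq2)
    finally have "\<delta> * \<kappa> * measure M (cylinder B m p) = (\<Sum>r\<in>?S. \<delta> * \<kappa> * measure M (cylinder B l r))"
      by (simp add: sum_distrib_left)
    also have "\<dots> \<le> (\<Sum>r\<in>?S. measure M (cylinder B l r \<inter> (space M - A)))"
      by (rule sum_mono) (rule each)
    also have "\<dots> = measure M (cylinder B m p \<inter> (space M - A))"
      by (rule measure_level_determined_Int[OF det, symmetric]) (use A in auto)
    also have "cylinder B m p \<inter> (space M - A) = cylinder B m p - A"
      using cylinder_subset[of B m p] by (auto simp: space_M)
    finally show ?thesis .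
  qed
  have "measure M A = 0"
  proof (rule null_if_cylinders_miss[OF A(1)])
    \<comment> \<open>The proportions of three passages: \<open>c\<close> into the class, \<kappa>
      on to a bad vertex, and \<delta> outside \<open>A\<close> there.\<close>
    show "\<delta> * \<kappa> * c > 0" using \<delta> \<kappa> c by simp
    fix m p assume m: "m \<ge> (1::nat)" and p: "p \<in> fin_paths B 0 m"
    define w where "w = rng B m (p m)"
    have "p m \<in> edges B m" using p m by (simp add: fin_paths_iff path_on_def)
    then have wN: "w < dim_row F" using rng_in[OF m, of "p m"] verts_eq[OF m] by (simp add: w_def)
    show "\<delta> * \<kappa> * c * measure M (cylinder B m p) \<le> measure M (cylinder B m p - A)"
    proof (cases "\<xi> w > 0")
      case True
      have "\<exists>q. q \<in> fin_paths B 0 (m + k w) \<and> rng B (m + k w) (q (m + k w)) = t w \<and>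
          cylinder B (m + k w) q \<subseteq> cylinder B m p"
      proof (cases "k w")
        case 0
        then have "t w = w" using kt(2)[OF True wN] by simp
        then show ?thesis using 0 p w_def by auto
      next
        case (Suc j)
        obtain \<pi> where \<pi>: "\<pi> \<in> class_paths B {..<dim_row F} m (m + Suc j)"
          "src B (Suc m) (\<pi> (Suc m)) = w" "rng B (m + Suc j) (\<pi> (m + Suc j)) = t w"
          using class_path_exists[OF order_refl m, of w "t w" j] kt(2)[OF True wN] Suc by auto
        have "path_append m p \<pi> \<in> fin_paths B 0 (m + Suc j)"
          using \<pi> p w_def by (intro fin_paths_append) (auto simp: class_paths_def)
        moreover have "rng B (m + Suc j) (path_append m p \<pi> (m + Suc j)) = t w"
          using \<pi>(3) by (simp add: path_append_def)
        moreover have "cylinder B (m + Suc j) (path_append m p \<pi>) \<subseteq> cylinder B m p"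
          by (intro cylinder_append_subset) simp
        ultimately show ?thesis unfolding Suc by blast
      qed
      then obtain q where q: "q \<in> fin_paths B 0 (m + k w)" "rng B (m + k w) (q (m + k w)) = t w"
        "cylinder B (m + k w) q \<subseteq> cylinder B m p" by blast
      have "c * measure M (cylinder B m p) \<le> \<xi> (t w) / (\<xi> w * \<rho> ^ k w) * measure M (cylinder B m p)"
        using c_le[of w] True wN by (intro mult_right_mono) (auto simp: W_def)
      also have "\<dots> = measure M (cylinder B (m + k w) q)"
        using measure_cylinder_ext[OF p q(1) m] True q(2) by (simp add: w_def)
      finally have "\<delta> * \<kappa> * (c * measure M (cylinder B m p)) \<le> \<delta> * \<kappa> * measure M (cylinder B (m + k w) q)"
        using \<delta> \<kappa> by (intro mult_left_mono) auto
      also have "\<dots> \<le> measure M (cylinder B (m + k w) q - A)"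
        using m q kt(1) by (intro class_ending) auto
      also have "\<dots> \<le> measure M (cylinder B m p - A)"
        using q(3) A cylinder_in_sets[OF p] by (intro finite_measure_mono) auto
      finally show ?thesis by (simp add: mult.assoc)
    next
      case False
      then have "\<xi> w = 0" using xi_nonneg[OF wN] by simp
      then have "measure M (cylinder B m p) = 0" using measure_cylinder[OF m p] by (simp add: w_def)
      then show ?thesis by simp
    qed
  qed
  then show False using A by simp
qed

text \<open>Since the Vershik map pulls null sets back to null sets, the eigenvalue equation holds
  along the whole forward orbit of almost every point.\<close>

lemma AE_eigen_iterate:
  fixes f :: "_ \<Rightarrow> complex"
  assumes "AE x in M. f (vershik B x) = \<gamma> * f x"
  shows "AE x in M. \<forall>d. f ((vershik B ^^ d) x) = \<gamma> ^ d * f x"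
proof -
  have "AE x in M. f (vershik B ((vershik B ^^ d) x)) = \<gamma> * f ((vershik B ^^ d) x)" for d
  proof (induction d)
    case (Suc d)
    from AE_vershik[OF Suc] show ?case by (simp add: funpow_swap1)
  qed (use assms in simp)
  then have "AE x in M. \<forall>d. f (vershik B ((vershik B ^^ d) x)) = \<gamma> * f ((vershik B ^^ d) x)"
    by (simp add: AE_all_countable)
  then show ?thesis
  proof eventually_elim
    case (elim x)
    have "f ((vershik B ^^ d) x) = \<gamma> ^ d * f x" for d
      by (induction d) (use elim in auto)
    then show ?case by blast
  qed
qed

text \<open>Neither the modulus of \<open>f\<close> nor a bound on it is given, so closeness has to
  be relative. The nonzero values are covered by balls with radius proportional to the distance of
  the centre from 0; countably many of them suffice, and one has a preimage of positive
  measure.\<close>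

lemma almost_constant_set:
  fixes f :: "_ \<Rightarrow> complex"
  assumes f: "f \<in> borel_measurable M" "\<not> (AE x in M. f x = 0)" and \<epsilon>: "\<epsilon> > 0"
  obtains A where "A \<in> sets M" "measure M A > 0"
    "\<And>x. x \<in> A \<Longrightarrow> f x \<noteq> 0" "\<And>x y. x \<in> A \<Longrightarrow> y \<in> A \<Longrightarrow> norm (f y - f x) \<le> \<epsilon> * norm (f x)"
proof -
  \<comment> \<open>The bound \<open>1/2\<close> gives \<open>norm z \<le> 2 * norm (f x)\<close> on
    the ball; then two values differ by at most
    \<open>2 * \<delta> * norm z \<le> 4 * \<delta> * norm (f x)\<close>.\<close>
  define \<delta> where "\<delta> = min (1/2) (\<epsilon> / 4)"
  have \<delta>: "\<delta> > 0" "\<delta> \<le> 1/2" "4 * \<delta> \<le> \<epsilon>" using \<epsilon> by (auto simp: \<delta>_def)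
  let ?G = "(\<lambda>z::complex. ball z (\<delta> * norm z)) ` (- {0})"
  obtain G where G: "G \<subseteq> ?G" "countable G" "\<Union>G = \<Union>?G"
    by (rule Lindelof[of ?G]) auto
  have "\<exists>U\<in>G. \<not> (AE x in M. f x \<notin> U)"
  proof (rule ccontr)
    assume "\<not> ?thesis"
    then have "AE x in M. \<forall>U\<in>G. f x \<notin> U" using G(2) by (auto simp: AE_ball_countable)
    then have "AE x in M. f x = 0"
    proof eventually_elim
      case (elim x)
      have "f x \<in> \<Union>?G" if "f x \<noteq> 0"
        by (rule UnionI[of "ball (f x) (\<delta> * norm (f x))"]) (use that \<delta>(1) in auto)
      then show ?case using elim G(3) by blast
    qed
    then show False using f by simp
  qed
  then obtain z where z: "z \<noteq> 0" "\<not> (AE x in M. f x \<notin> ball z (\<delta> * norm z))" using G(1) by blast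
  define A where "A = f -` ball z (\<delta> * norm z) \<inter> space M"
  have A: "A \<in> sets M" unfolding A_def using f(1) by (intro measurable_sets) auto
  have "measure M A \<noteq> 0"
  proof
    assume "measure M A = 0"
    then have "A \<in> null_sets M" using A by (simp add: null_sets_def emeasure_eq_measure)
    then have "AE x in M. x \<notin> A" by (rule AE_not_in)
    moreover have "AE x in M. x \<in> space M" by (rule AE_space)
    ultimately have "AE x in M. f x \<notin> ball z (\<delta> * norm z)"
      by eventually_elim (auto simp: A_def)
    then show False using z by simp
  qed
  then have pos: "measure M A > 0" using measure_nonneg[of M A] by linarith
  have near: "norm (f x - z) < \<delta> * norm z" if "x \<in> A" for x
    using that by (simp add: A_def dist_norm norm_minus_commute)
  have big: "norm z \<le> 2 * norm (f x)" if "x \<in> A" for x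
  proof -
    have "norm z \<le> norm (f x) + norm (f x - z)"
      using norm_triangle_ineq4[of "f x" "f x - z"] by simp
    also have "norm (f x - z) \<le> 1/2 * norm z"
      using near[OF that] \<delta>(2) by (intro order_trans[OF less_imp_le mult_right_mono]) auto
    finally show ?thesis by simp
  qed
  show ?thesis
  proof (rule that[OF A pos])
    fix x assume "x \<in> A"
    then show "f x \<noteq> 0" using big[of x] z by auto
  next
    fix x y assume xy: "x \<in> A" "y \<in> A"
    have "norm (f y - f x) \<le> norm (f y - z) + norm (f x - z)"
      using norm_triangle_ineq4[of "f y - z" "f x - z"] by simp
    also have "\<dots> \<le> (2 * \<delta>) * norm z" using near[OF xy(1)] near[OF xy(2)] by simp
    also have "\<dots> \<le> (2 * \<delta>) * (2 * norm (f x))" using big[OF xy(1)] \<delta> by (intro mult_left_mono) auto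
    also have "\<dots> = (4 * \<delta>) * norm (f x)" by simp
    also have "\<dots> \<le> \<epsilon> * norm (f x)" using \<delta>(3) by (intro mult_right_mono) auto
    finally show "norm (f y - f x) \<le> \<epsilon> * norm (f x)" .
  qed
qed

text \<open>The cylinders of \<tau> followed by either side of the shifted diamond occupy the same
  proportion \<kappa> of the cylinder of \<tau>. If \<open>A\<close> misses less than
  \<open>\<kappa> / 2\<close> of the latter, it meets more than half of each, so the swap takes some
  point of \<open>A\<close> to a point of \<open>A\<close>.\<close>

lemma eigenvalue_imp_diamond_condition:
  assumes eig: "vershik_eigenvalue B M \<gamma>" and d: "class_diamond B \<alpha> a b \<omega> \<omega>'"
  shows "(\<lambda>n. \<gamma> powi pair_steps B a b \<omega> \<omega>' n) \<longlonglongrightarrow> 1"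
proof (rule LIMSEQ_I)
  fix \<epsilon>0 :: real assume "\<epsilon>0 > 0"
  \<comment> \<open>The estimate through \<open>f\<close> ends in a weak inequality, while the limit
    needs a strict one.\<close>
  define \<epsilon> where "\<epsilon> = \<epsilon>0 / 2"
  have \<epsilon>: "\<epsilon> > 0" "\<epsilon> < \<epsilon>0" using \<open>\<epsilon>0 > 0\<close> by (auto simp: \<epsilon>_def)
  obtain f where f: "f \<in> borel_measurable M" "\<not> (AE x in M. f x = 0)"
      "AE x in M. f (vershik B x) = \<gamma> * f x"
    using eig by (auto simp: vershik_eigenvalue_def)
  obtain A where A: "A \<in> sets M" "measure M A > 0" "\<And>x. x \<in> A \<Longrightarrow> f x \<noteq> 0"
    "\<And>x y. x \<in> A \<Longrightarrow> y \<in> A \<Longrightarrow> norm (f y - f x) \<le> \<epsilon> * norm (f x)"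
    using almost_constant_set[OF f(1,2) \<epsilon>(1)] by blast
  define u where "u = src B (Suc a) (\<omega> (Suc a))"
  define v where "v = rng B b (\<omega> b)"
  have ab: "1 \<le> a" "a < b" and w: "\<omega> \<in> fin_paths B a b" "\<omega>' \<in> fin_paths B a b"
    and u': "src B (Suc a) (\<omega>' (Suc a)) = u" and v': "rng B b (\<omega>' b) = v"
    using d by (auto simp: class_diamond_def diamond_def u_def v_def)
  have uv: "u \<in> \<alpha>" "v \<in> \<alpha>"
    using d ab by (auto simp: class_diamond_def passes_within_def u_def v_def)
  \<comment> \<open>The ratio of \<open>measure_cylinder_ext\<close> for an extension from
    \<open>u\<close> to \<open>v\<close> by \<open>b - a\<close> edges; the shift does not change
    it.\<close>
  define \<kappa> where "\<kappa> = \<xi> v / (\<xi> u * \<rho> ^ (b - a))"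
  have \<kappa>: "\<kappa> > 0" using xi_pos uv radius_pos by (simp add: \<kappa>_def)
  obtain n0 where n0: "\<And>n. n \<ge> n0 \<Longrightarrow> \<exists>\<tau>\<in>fin_paths B 0 n. rng B n (\<tau> n) = u \<and>
      measure M (cylinder B n \<tau> - A) < \<kappa> / 2 * measure M (cylinder B n \<tau>)"
    using class_density[OF A(1,2), of "\<kappa> / 2"] \<kappa> uv by auto
  have good: "AE x in M. x \<in> vershik_domain B \<and> (\<forall>d. f ((vershik B ^^ d) x) = \<gamma> ^ d * f x)"
    using AE_vershik_domain AE_eigen_iterate[OF f(3)] by eventually_elim simp
  have "norm (\<gamma> powi pair_steps B a b \<omega> \<omega>' n - 1) < \<epsilon>0" if n: "n \<ge> n0" for n
  proof -
    define l m where "l = a + n" and "m = b + n"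
    have lm: "1 \<le> l" "l < m" "1 \<le> m" "m - l = b - a" using ab by (auto simp: l_def m_def)
    define \<eta> where "\<eta> = shift_iter B a b n \<omega>"
    define \<eta>' where "\<eta>' = shift_iter B a b n \<omega>'"
    have \<eta>: "\<eta> \<in> fin_paths B l m" "\<eta>' \<in> fin_paths B l m"
      using shift_iter_in[OF ab(1) w(1), of n] shift_iter_in[OF ab(1) w(2), of n]
      by (simp_all add: \<eta>_def \<eta>'_def l_def m_def)
    note sr = shift_iter_ends[OF ab, of _ n, folded l_def m_def]
    obtain \<tau> where \<tau>: "\<tau> \<in> fin_paths B 0 l" "rng B l (\<tau> l) = u"
      "measure M (cylinder B l \<tau> - A) < \<kappa> / 2 * measure M (cylinder B l \<tau>)"
      using n0[of l] n by (auto simp: l_def)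
    define p where "p = path_append l \<tau> \<eta>"
    define q where "q = path_append l \<tau> \<eta>'"
    have app: "path_append l \<tau> \<zeta> \<in> fin_paths B 0 m" "rng B m (path_append l \<tau> \<zeta> m) = v"
      if "\<zeta> \<in> fin_paths B l m" "src B (Suc l) (\<zeta> (Suc l)) = u" "rng B m (\<zeta> m) = v" for \<zeta>
    proof -
      show "path_append l \<tau> \<zeta> \<in> fin_paths B 0 m"
        using that \<tau>(2) lm by (intro fin_paths_append[OF \<tau>(1)]) auto
      show "rng B m (path_append l \<tau> \<zeta> m) = v" using that lm by (simp add: path_append_def)
    qed
    have p: "p \<in> fin_paths B 0 m" "rng B m (p m) = v"
      using app[OF \<eta>(1)] sr[OF w(1)] unfolding p_def by (simp_all add: u_def v_def \<eta>_def)
    have q: "q \<in> fin_paths B 0 m" "rng B m (q m) = v"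
      using app[OF \<eta>(2)] sr[OF w(2)] u' v' unfolding q_def by (simp_all add: \<eta>'_def)
    note swap = p(1) q(1) trans[OF p(2) q(2)[symmetric]] lm(3)
    let ?s = "path_swap m p q"
    have Mr: "measure M (cylinder B m r) = \<kappa> * measure M (cylinder B l \<tau>)"
      if r: "r \<in> fin_paths B 0 m" "rng B m (r m) = v" for r
      using measure_cylinder_ext[OF \<tau>(1) r(1) lm(1) less_imp_le[OF lm(2)]] \<tau>(2) r(2) xi_pos[OF uv(1)] lm(4)
      by (simp add: \<kappa>_def)
    have sub: "cylinder B m p \<subseteq> cylinder B l \<tau>" "cylinder B m q \<subseteq> cylinder B l \<tau>"
      unfolding p_def q_def using lm by (auto intro!: cylinder_append_subset)
    have half: "measure M (C - A) < measure M (cylinder B m p) / 2"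
      if "C \<subseteq> cylinder B l \<tau>" "C \<in> sets M" for C
    proof -
      have "measure M (C - A) \<le> measure M (cylinder B l \<tau> - A)"
        using that A(1) cylinder_in_sets[OF \<tau>(1)] by (intro finite_measure_mono) auto
      also have "\<dots> < measure M (cylinder B m p) / 2" using \<tau>(3) Mr[OF p] by simp
      finally show ?thesis .
    qed
    have pM: "cylinder B m p \<in> sets M" and qM: "cylinder B m q \<in> sets M"
      using p q by (auto intro: cylinder_in_sets)
    have pre: "?s -` X \<inter> space M \<in> sets M" "measure M (?s -` X \<inter> space M) = measure M X" if X: "X \<in> sets M" for X
    proof -
      show "?s -` X \<inter> space M \<in> sets M" by (rule measurable_sets[OF path_swap_measurable[OF swap] X])
      have "measure M X = measure (distr M M ?s) X" by (simp only: distr_path_swap[OF swap])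
      also have "\<dots> = measure M (?s -` X \<inter> space M)"
        by (rule measure_distr[OF path_swap_measurable[OF swap] X])
      finally show "measure M (?s -` X \<inter> space M) = measure M X" by simp
    qed
    define X where "X = cylinder B m p - A"
    define Y where "Y = ?s -` (cylinder B m q - A) \<inter> space M"
    have XM: "X \<in> sets M" unfolding X_def using pM A(1) by (rule sets.Diff)
    have qA: "cylinder B m q - A \<in> sets M" using qM A(1) by (rule sets.Diff)
    have YM: "Y \<in> sets M" unfolding Y_def by (rule pre(1)[OF qA])
    \<comment> \<open>Points of the cylinder of \<open>p\<close> that lie in \<open>A\<close>
      together with their image under the swap. The two removed sets each have measure less than
      half of the cylinder.\<close>
    define D where "D = cylinder B m p - X - Y"
    have DM: "D \<in> sets M" unfolding D_def by (intro sets.Diff pM XM YM)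
    have "measure M (cylinder B m p) \<le> measure M (D \<union> (X \<union> Y))"
      by (rule finite_measure_mono) (use DM XM YM in \<open>auto simp: D_def\<close>)
    also have "\<dots> \<le> measure M D + measure M (X \<union> Y)"
      by (rule measure_Un_le) (use DM XM YM in auto)
    also have "measure M (X \<union> Y) \<le> measure M X + measure M Y"
      by (rule measure_Un_le) (use XM YM in auto)
    also have "measure M Y = measure M (cylinder B m q - A)" unfolding Y_def by (rule pre(2)[OF qA])
    finally have Dpos: "measure M D > 0"
      using half[OF sub(1) pM] half[OF sub(2) qM] unfolding X_def by linarith
    have both: "AE x in M. (x \<in> vershik_domain B \<and> (\<forall>d. f ((vershik B ^^ d) x) = \<gamma> ^ d * f x)) \<and>
        (?s x \<in> vershik_domain B \<and> (\<forall>d. f ((vershik B ^^ d) (?s x)) = \<gamma> ^ d * f (?s x)))"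
      using good AE_path_swap[OF swap good] by (rule eventually_conj)
    obtain x where xD: "x \<in> D" and x: "x \<in> vershik_domain B" "\<And>d. f ((vershik B ^^ d) x) = \<gamma> ^ d * f x"
      "?s x \<in> vershik_domain B" "\<And>d. f ((vershik B ^^ d) (?s x)) = \<gamma> ^ d * f (?s x)"
      by (rule measure_pos_obtain[OF Dpos DM both]) blast
    define y where "y = ?s x"
    have xp: "x \<in> cylinder B m p" "x \<in> A" using xD by (auto simp: D_def X_def)
    have xi: "x \<in> inf_paths B" and yi: "y \<in> inf_paths B" using x by (auto simp: vershik_domain_def y_def)
    have y_app: "y = path_append m q x"
      using xp(1) by (simp add: y_def path_swap_def cylinder_def)
    have yq: "y \<in> cylinder B m q" using yi by (simp add: y_app cylinder_def path_append_def)
    have "y \<in> A"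
    proof (rule ccontr)
      assume "y \<notin> A"
      then have "x \<in> ?s -` (cylinder B m q - A) \<inter> space M" using yq xi by (simp add: y_def space_M)
      then show False using xD by (simp add: D_def Y_def)
    qed
    define P where "P = pair_steps B a b \<omega> \<omega>' n"
    have "path_weight B 0 m x = path_weight B 0 m p" "path_weight B 0 m y = path_weight B 0 m q"
      using xp(1) yq by (intro path_weight_cong; simp add: cylinder_def)+
    then have P: "int (path_weight B 0 m y) - int (path_weight B 0 m x) = P"
      unfolding p_def q_def path_weight_append[OF less_imp_le[OF lm(2)]] by (simp add: P_def pair_steps_def \<eta>_def \<eta>'_def l_def m_def)
    have tail: "y i = x i" if "i > m" for i using that by (simp add: y_app path_append_def)
    have fx: "f x \<noteq> 0" "f y \<noteq> 0" using A(3) xp(2) \<open>y \<in> A\<close> by auto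
    \<comment> \<open>The sign of \<open>P\<close> tells which of the two points lies ahead on the
      orbit. If \<open>y\<close> precedes \<open>x\<close>, then \<open>f x \<noteq> 0\<close> shows
      that the power of \<gamma> can be inverted.\<close>
    have fy: "f y = \<gamma> powi P * f x"
    proof (cases "P \<ge> 0")
      case True
      have "(vershik B ^^ nat P) x = y"
        by (rule vershik_iterate_eq[OF x(1) yi, of m]) (use tail P True in auto)
      then show ?thesis using x(2)[of "nat P"] True by (simp add: power_int_def)
    next
      case False
      have "(vershik B ^^ nat (- P)) y = x"
        by (rule vershik_iterate_eq[OF _ xi, of _ m]) (use tail P False x in \<open>auto simp: y_def\<close>)
      then have fx': "f x = \<gamma> ^ nat (- P) * f y" using x(4)[of "nat (- P)"] by (simp add: y_def)
      then have "\<gamma> ^ nat (- P) \<noteq> 0" using fx by auto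
      then show ?thesis using fx' False by (simp add: power_int_def field_simps power_inverse)
    qed
    have "norm (\<gamma> powi P - 1) * norm (f x) = norm (f y - f x)"
      unfolding fy by (simp add: norm_mult[symmetric] algebra_simps)
    also have "\<dots> \<le> \<epsilon> * norm (f x)" using A(4) xp(2) \<open>y \<in> A\<close> by blast
    finally have "norm (\<gamma> powi P - 1) \<le> \<epsilon>" using fx by simp
    then show ?thesis using \<epsilon> by (simp add: P_def)
  qed
  then show "\<exists>no. \<forall>n\<ge>no. norm (\<gamma> powi pair_steps B a b \<omega> \<omega>' n - 1) < \<epsilon>0" by blast
qed

end

section \<open>The diamond condition gives an eigenfunction\<close>

text \<open>The logarithm of the modulus, multiplied by integers of absolute value at least 1, tends
  to 0 and so must be 0 itself. For \<gamma> = 0 all the powers would be 0.\<close>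

lemma norm_eq_1_if_powi_tendsto_1:
  fixes \<gamma> :: complex and d :: "nat \<Rightarrow> int"
  assumes lim: "(\<lambda>n. \<gamma> powi d n) \<longlonglongrightarrow> 1" and d: "\<And>n. d n \<noteq> 0"
  shows "norm \<gamma> = 1"
proof (cases "\<gamma> = 0")
  case True
  then have "(\<lambda>n. \<gamma> powi d n) = (\<lambda>_. 0)" using d by auto
  then have "(\<lambda>_::nat. 0::complex) \<longlonglongrightarrow> 1" using lim by simp
  then show ?thesis by (simp add: LIMSEQ_const_iff)
next
  case False
  define g where "g = ln (norm \<gamma>)"
  have \<gamma>: "norm \<gamma> = exp g" using False by (simp add: g_def)
  have "(\<lambda>n. norm (\<gamma> powi d n)) \<longlonglongrightarrow> norm (1::complex)" by (rule tendsto_norm[OF lim])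
  then have "(\<lambda>n. exp (of_int (d n) * g)) \<longlonglongrightarrow> 1"
    by (simp add: norm_power_int \<gamma> exp_power_int)
  then have "(\<lambda>n. ln (exp (of_int (d n) * g))) \<longlonglongrightarrow> ln 1" by (intro tendsto_ln) auto
  then have lim0: "(\<lambda>n. of_int (d n) * g) \<longlonglongrightarrow> 0" by simp
  have "g = 0"
  proof (rule ccontr)
    assume g: "g \<noteq> 0"
    then obtain n where n: "norm (of_int (d n) * g) < \<bar>g\<bar>"
      using LIMSEQ_D[OF lim0, of "\<bar>g\<bar>"] by auto
    have "1 \<le> \<bar>d n\<bar>" using d[of n] by linarith
    then have "1 \<le> \<bar>real_of_int (d n)\<bar>" by linarith
    then have "1 * \<bar>g\<bar> \<le> \<bar>real_of_int (d n)\<bar> * \<bar>g\<bar>" by (intro mult_right_mono) auto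
    then show False using n by (simp add: abs_mult)
  qed
  then show ?thesis using \<gamma> by simp
qed

lemma convergent_if_summable_diff:
  fixes a :: "nat \<Rightarrow> complex"
  assumes s: "summable s" and le: "\<And>n. n \<ge> m \<Longrightarrow> norm (a (Suc n) - a n) \<le> s n"
  shows "convergent a"
proof -
  have "summable (\<lambda>n. a (Suc n) - a n)"
    by (rule summable_comparison_test[OF _ s]) (use le in blast)
  then have "(\<lambda>n. \<Sum>k<n. a (Suc k) - a k) \<longlonglongrightarrow> (\<Sum>k. a (Suc k) - a k)" by (rule summable_LIMSEQ)
  then have "(\<lambda>n. (\<Sum>k<n. a (Suc k) - a k) + a 0) \<longlonglongrightarrow> (\<Sum>k. a (Suc k) - a k) + a 0"
    by (intro tendsto_add tendsto_const)
  moreover have "(\<Sum>k<n. a (Suc k) - a k) + a 0 = a n" for n by (simp add: sum_lessThan_telescope)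
  ultimately show ?thesis by (auto simp: convergent_def)
qed

lemma summable_if_geometric_decay:
  assumes "geometric_decay s"
  shows "summable (\<lambda>n. norm (s n))"
proof -
  obtain C r where r: "0 < r" "r < 1" "\<And>n. norm (s n) \<le> C * r ^ n"
    using assms by (auto simp: geometric_decay_def)
  have "summable (\<lambda>n. C * r ^ n)" using r by (intro summable_mult summable_geometric) auto
  then show ?thesis by (rule summable_comparison_test[rotated]) (use r in auto)
qed

context stationary_bratteli
begin

text \<open>Preceded by a common path from the root, the two shifted sides are different paths with
  the same end, and the weight separates them.\<close>

lemma pair_steps_nonzero:
  assumes "diamond B a b \<omega> \<omega>'"
  shows "pair_steps B a b \<omega> \<omega>' n \<noteq> 0"
proof
  assume zero: "pair_steps B a b \<omega> \<omega>' n = 0"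
  have d: "1 \<le> a" "a < b" and w: "\<omega> \<in> fin_paths B a b" "\<omega>' \<in> fin_paths B a b" "\<omega> \<noteq> \<omega>'"
    and sr: "src B (Suc a) (\<omega> (Suc a)) = src B (Suc a) (\<omega>' (Suc a))" "rng B b (\<omega> b) = rng B b (\<omega>' b)"
    using assms by (auto simp: diamond_def)
  let ?l = "a + n" and ?m = "b + n"
  let ?s = "shift_iter B a b n"
  have e: "\<zeta> i \<in> edges B i" if "\<zeta> \<in> fin_paths B a b" "a < i" "i \<le> b" for \<zeta> i
    using that by (auto simp: fin_paths_iff path_on_def)
  note ends = shift_iter_ends[OF d, of _ n]
  have "src B (Suc a) (\<omega> (Suc a)) \<in> verts B a"
    using src_in[of "Suc a" "\<omega> (Suc a)"] e[OF w(1), of "Suc a"] d by simp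
  then have "src B (Suc a) (\<omega> (Suc a)) \<in> verts B ?l" using verts_eq[of a] verts_eq[of ?l] d by simp
  then obtain \<tau> where "\<tau> \<in> paths_to B ?l (src B (Suc a) (\<omega> (Suc a)))" by (rule exists_path_to)
  then have \<tau>: "\<tau> \<in> fin_paths B 0 ?l" "rng B ?l (\<tau> ?l) = src B (Suc a) (\<omega> (Suc a))"
    using d by (auto simp: paths_to_def)
  have on: "path_on B 0 ?m (path_append ?l \<tau> (?s \<zeta>))" and end_p: "rng B ?m (path_append ?l \<tau> (?s \<zeta>) ?m) = rng B b (\<zeta> b)"
    and wt: "path_weight B 0 ?m (path_append ?l \<tau> (?s \<zeta>)) = path_weight B 0 ?l \<tau> + path_weight B ?l ?m (?s \<zeta>)"
    if z: "\<zeta> \<in> fin_paths B a b" "src B (Suc a) (\<zeta> (Suc a)) = src B (Suc a) (\<omega> (Suc a))" for \<zeta>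
  proof -
    have "path_append ?l \<tau> (?s \<zeta>) \<in> fin_paths B 0 ?m"
      using z \<tau> d ends(1)[OF z(1)] by (intro fin_paths_append shift_iter_in) auto
    then show "path_on B 0 ?m (path_append ?l \<tau> (?s \<zeta>))" by (simp add: fin_paths_iff)
    show "rng B ?m (path_append ?l \<tau> (?s \<zeta>) ?m) = rng B b (\<zeta> b)"
      using ends(2)[OF z(1)] d by (simp add: path_append_def)
    show "path_weight B 0 ?m (path_append ?l \<tau> (?s \<zeta>)) = path_weight B 0 ?l \<tau> + path_weight B ?l ?m (?s \<zeta>)"
      using d by (intro path_weight_append) simp
  qed
  have "\<omega> = \<omega>'"
  proof (rule extensionalityI[of _ "{a<..b}"])
    fix i assume i: "i \<in> {a<..b}"
    have "path_append ?l \<tau> (?s \<omega>) (i + n) = path_append ?l \<tau> (?s \<omega>') (i + n)"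
    proof (rule path_weight_inj[of ?m])
      show "path_weight B 0 ?m (path_append ?l \<tau> (?s \<omega>)) = path_weight B 0 ?m (path_append ?l \<tau> (?s \<omega>'))"
        using zero wt[OF w(1) refl] wt[OF w(2) sr(1)[symmetric]] by (simp add: pair_steps_def)
      show "rng B ?m (path_append ?l \<tau> (?s \<omega>) ?m) = rng B ?m (path_append ?l \<tau> (?s \<omega>') ?m)"
        using end_p[OF w(1) refl] end_p[OF w(2) sr(1)[symmetric]] sr(2) by simp
    qed (use on[OF w(1) refl] on[OF w(2) sr(1)[symmetric]] i in auto)
    then have "edge_shift B i n (\<omega> i) = edge_shift B i n (\<omega>' i)"
      using i shift_iter_apply[of a i b B n] by (simp add: path_append_def)
    moreover have "inj_on (edge_shift B i n) (edges B i)"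
      using edge_shift_iso[of i n] i d by (simp add: bij_betw_def)
    ultimately show "\<omega> i = \<omega>' i" using e[OF w(1), of i] e[OF w(2), of i] i by (simp add: inj_on_eq_iff)
  qed (use w in \<open>auto simp: fin_paths_iff\<close>)
  then show False using w by simp
qed

text \<open>Level 1 is the lowest level at which diamonds start, and \<open>n - 1\<close> shifts
  lead from there to level \<open>n\<close>.\<close>

lemma class_pair_lift:
  assumes "n \<ge> 1" "L \<ge> 1" "\<eta> \<in> class_paths B V n (n + L)"
  obtains \<omega> where "\<omega> \<in> class_paths B V 1 (1 + L)" "shift_iter B 1 (1 + L) (n - 1) \<omega> = \<eta>"
    "src B 2 (\<omega> 2) = src B (Suc n) (\<eta> (Suc n))" "rng B (1 + L) (\<omega> (1 + L)) = rng B (n + L) (\<eta> (n + L))"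
proof -
  have "\<eta> \<in> fin_paths B (1 + (n - 1)) (1 + L + (n - 1))"
  proof -
    have "1 + (n - 1) = n" "1 + L + (n - 1) = n + L" using assms by auto
    then show ?thesis using assms(3) by (simp only: class_paths_def) simp
  qed
  then obtain \<omega> where w: "\<omega> \<in> fin_paths B 1 (1 + L)" "shift_iter B 1 (1 + L) (n - 1) \<omega> = \<eta>"
    and sr: "\<And>i. 1 < i \<Longrightarrow> i \<le> 1 + L \<Longrightarrow> src B i (\<omega> i) = src B (i + (n - 1)) (\<eta> (i + (n - 1))) \<and>
       rng B i (\<omega> i) = rng B (i + (n - 1)) (\<eta> (i + (n - 1)))"
    by (rule shift_iter_surj[OF order_refl]) blast
  have "passes_within B V 1 (1 + L) \<omega>"
    unfolding passes_within_def
  proof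
    fix i assume i: "i \<in> {1<..1 + L}"
    then have "i + (n - 1) \<in> {n<..n + L}" using assms(1) by auto
    then show "src B i (\<omega> i) \<in> V \<and> rng B i (\<omega> i) \<in> V"
      using sr[of i] i assms(3) unfolding class_paths_def passes_within_def by auto
  qed
  moreover have "src B 2 (\<omega> 2) = src B (Suc n) (\<eta> (Suc n))"
    using sr[of 2] assms by simp
  moreover have "rng B (1 + L) (\<omega> (1 + L)) = rng B (n + L) (\<eta> (n + L))"
    using sr[of "1 + L"] assms by (simp add: add.commute)
  ultimately show ?thesis using that w by (simp add: class_paths_def)
qed

end

context class_system
begin

text \<open>Only finitely many pairs of length \<open>L\<close> start at level 1, and all pairs at
  higher levels are their shifts; the sum of the finitely many decaying sequences bounds them
  all.\<close>

lemma class_pair_bound: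
  fixes \<gamma> :: complex
  assumes cond: "\<And>a b \<omega> \<omega>'. class_diamond B \<alpha> a b \<omega> \<omega>' \<Longrightarrow> (\<lambda>n. \<gamma> powi pair_steps B a b \<omega> \<omega>' n) \<longlonglongrightarrow> 1"
    and \<gamma>: "\<gamma> \<noteq> 0" and L: "L \<ge> 1"
  obtains s where "summable s"
    "\<And>n \<eta> \<eta>'. n \<ge> 1 \<Longrightarrow> \<eta> \<in> class_paths B \<alpha> n (n + L) \<Longrightarrow> \<eta>' \<in> class_paths B \<alpha> n (n + L) \<Longrightarrow>
       src B (Suc n) (\<eta> (Suc n)) = src B (Suc n) (\<eta>' (Suc n)) \<Longrightarrow>
       rng B (n + L) (\<eta> (n + L)) = rng B (n + L) (\<eta>' (n + L)) \<Longrightarrow>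
       norm (\<gamma> powi (int (path_weight B n (n + L) \<eta>') - int (path_weight B n (n + L) \<eta>)) - 1) \<le> s n"
proof -
  let ?P = "class_paths B \<alpha> 1 (1 + L)"
  define Q where "Q = {(\<omega>, \<omega>'). \<omega> \<in> ?P \<and> \<omega>' \<in> ?P \<and> src B 2 (\<omega> 2) = src B 2 (\<omega>' 2) \<and>
      rng B (1 + L) (\<omega> (1 + L)) = rng B (1 + L) (\<omega>' (1 + L))}"
  define t where "t = (\<lambda>n. \<Sum>(\<omega>, \<omega>')\<in>Q. norm (\<gamma> powi pair_steps B 1 (1 + L) \<omega> \<omega>' n - 1))"
  have "finite ?P" by (rule finite_subset[OF _ finite_fin_paths[of 1 "1 + L"]]) (auto simp: class_paths_def)
  then have "finite (?P \<times> ?P)" by simp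
  then have finQ: "finite Q" by (rule finite_subset[rotated]) (auto simp: Q_def)
  have decay: "geometric_decay (\<lambda>n. \<gamma> powi pair_steps B 1 (1 + L) \<omega> \<omega>' n - 1)" if q: "(\<omega>, \<omega>') \<in> Q" for \<omega> \<omega>'
  proof (rule powi_geometric_decay[OF char_poly_nonzero _ \<gamma>])
    show "seq_apply (char_poly (map_mat int F)) (pair_steps B 1 (1 + L) \<omega> \<omega>') n = 0" for n
      using q by (intro seq_apply_pair_steps) (auto simp: Q_def class_paths_def)
    show "(\<lambda>n. \<gamma> powi pair_steps B 1 (1 + L) \<omega> \<omega>' n) \<longlonglongrightarrow> 1"
    proof (cases "\<omega> = \<omega>'")
      case True
      then show ?thesis by (simp add: pair_steps_def)
    next
      case False
      then have "class_diamond B \<alpha> 1 (1 + L) \<omega> \<omega>'"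
        using q L by (auto simp: Q_def class_diamond_def diamond_def class_paths_def numeral_2_eq_2)
      then show ?thesis by (rule cond)
    qed
  qed
  have sum_t: "summable t"
    unfolding t_def by (rule summable_sum) (use summable_if_geometric_decay[OF decay] in auto)
  \<comment> \<open>Reindexes from the number of shifts to the level reached.\<close>
  define s where "s = (\<lambda>n. t (n - 1))"
  have "summable (\<lambda>n. s (Suc n))" using sum_t by (simp add: s_def)
  then have sum_s: "summable s" by (simp only: summable_Suc_iff)
  have bound: "norm (\<gamma> powi (int (path_weight B n (n + L) \<eta>') - int (path_weight B n (n + L) \<eta>)) - 1) \<le> s n"
    if n: "n \<ge> 1" and \<eta>: "\<eta> \<in> class_paths B \<alpha> n (n + L)" "\<eta>' \<in> class_paths B \<alpha> n (n + L)"
       and sr: "src B (Suc n) (\<eta> (Suc n)) = src B (Suc n) (\<eta>' (Suc n))"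
       "rng B (n + L) (\<eta> (n + L)) = rng B (n + L) (\<eta>' (n + L))" for n \<eta> \<eta>'
  proof -
    obtain \<omega> where w: "\<omega> \<in> ?P" "shift_iter B 1 (1 + L) (n - 1) \<omega> = \<eta>"
      "src B 2 (\<omega> 2) = src B (Suc n) (\<eta> (Suc n))" "rng B (1 + L) (\<omega> (1 + L)) = rng B (n + L) (\<eta> (n + L))"
      using class_pair_lift[OF n L \<eta>(1)] by blast
    obtain \<omega>' where w': "\<omega>' \<in> ?P" "shift_iter B 1 (1 + L) (n - 1) \<omega>' = \<eta>'"
      "src B 2 (\<omega>' 2) = src B (Suc n) (\<eta>' (Suc n))" "rng B (1 + L) (\<omega>' (1 + L)) = rng B (n + L) (\<eta>' (n + L))"
      using class_pair_lift[OF n L \<eta>(2)] by blast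
    have q: "(\<omega>, \<omega>') \<in> Q" using w w' sr by (simp add: Q_def)
    have n': "1 + (n - 1) = n" "1 + L + (n - 1) = n + L" using n by auto
    have "pair_steps B 1 (1 + L) \<omega> \<omega>' (n - 1) = int (path_weight B n (n + L) \<eta>') - int (path_weight B n (n + L) \<eta>)"
      unfolding pair_steps_def n' w(2) w'(2) ..
    moreover have "norm (\<gamma> powi pair_steps B 1 (1 + L) \<omega> \<omega>' (n - 1) - 1) \<le> t (n - 1)"
    proof -
      let ?h = "\<lambda>(\<omega>, \<omega>'). norm (\<gamma> powi pair_steps B 1 (1 + L) \<omega> \<omega>' (n - 1) - 1)"
      have "?h (\<omega>, \<omega>') \<le> (\<Sum>q\<in>Q. ?h q)" by (rule member_le_sum) (use q finQ in auto)
      then show ?thesis by (simp add: t_def)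
    qed
    ultimately show ?thesis by (simp add: s_def)
  qed
  show ?thesis by (rule that[OF sum_s bound])
qed

lemma level_determined_vertex:
  "level_determined B (Suc i) {x \<in> inf_paths B. rng B (Suc i) (x (Suc i)) \<in> V}"
  by (auto simp: level_determined_def)

lemma measurable_level_determined:
  fixes h :: "_ \<Rightarrow> 'b::topological_space"
  assumes "\<And>x y. x \<in> inf_paths B \<Longrightarrow> y \<in> inf_paths B \<Longrightarrow> \<forall>i\<in>{1..m}. x i = y i \<Longrightarrow> h x = h y"
  shows "h \<in> borel_measurable M"
proof (rule measurableI)
  fix S :: "'b set"
  have "level_determined B m (h -` S \<inter> space M)"
    unfolding level_determined_def
  proof (intro conjI ballI impI)
    fix x y assume x: "x \<in> h -` S \<inter> space M" and y: "y \<in> inf_paths B" and eq: "\<forall>i\<in>{1..m}. x i = y i"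
    have "h x = h y" by (rule assms[OF _ y eq]) (use x in \<open>simp add: space_M\<close>)
    then show "y \<in> h -` S \<inter> space M" using x y by (simp add: space_M)
  qed (simp add: space_M)
  then show "h -` S \<inter> space M \<in> sets M" by (rule level_determined_in_sets)
qed simp

text \<open>The eigenfunction is the limit of \<open>\<gamma> ^ r\<^sub>n(x)\<close>, where \<open>r\<^sub>n(x)\<close> is the signed number of
  steps from a reference path to \<open>x\<close> at level \<open>n + K + 1\<close>. The reference path follows a fixed
  infinite path \<open>z\<close> in the class up to level \<open>n\<close> and then a path in the class to the vertex of
  \<open>x\<close>. Passing from \<open>n\<close> to \<open>n + 1\<close> changes \<open>r\<^sub>n(x)\<close> by \<open>P\<close> of a pair of class paths of length
  \<open>K + 2\<close> that starts at the vertex of \<open>z\<close> at level \<open>n\<close>.\<close>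

lemma diamond_condition_imp_eigenvalue:
  fixes \<gamma> :: complex
  assumes cond: "\<And>a b \<omega> \<omega>'. class_diamond B \<alpha> a b \<omega> \<omega>' \<Longrightarrow> (\<lambda>n. \<gamma> powi pair_steps B a b \<omega> \<omega>' n) \<longlonglongrightarrow> 1"
  shows "vershik_eigenvalue B M \<gamma>"
proof -
  \<comment> \<open>A single diamond of the class suffices to force the modulus of \<gamma> to be
    1.\<close>
  obtain b0 \<omega>0 \<omega>0' where d0: "class_diamond B \<alpha> 1 b0 \<omega>0 \<omega>0'" using class_diamond_exists by blast
  then have "diamond B 1 b0 \<omega>0 \<omega>0'" by (simp add: class_diamond_def)
  then have \<gamma>1: "norm \<gamma> = 1"
    using norm_eq_1_if_powi_tendsto_1[OF cond[OF d0]] pair_steps_nonzero by blast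
  then have \<gamma>0: "\<gamma> \<noteq> 0" by auto
  have powi1: "norm (\<gamma> powi j) = 1" for j by (simp add: norm_power_int \<gamma>1)
  obtain K where K: "\<And>n u v. n \<ge> 1 \<Longrightarrow> u \<in> \<alpha> \<Longrightarrow> v \<in> \<alpha> \<Longrightarrow> \<exists>p \<in> class_paths B \<alpha> n (n + Suc K).
     src B (Suc n) (p (Suc n)) = u \<and> rng B (n + Suc K) (p (n + Suc K)) = v"
    using class_connected by blast
  obtain z where z: "z \<in> inf_paths B" "\<And>n. n \<ge> 1 \<Longrightarrow> rng B n (z n) \<in> \<alpha>"
    using exists_class_path by blast
  obtain s where s: "summable s" and s_bound:
    "\<And>n \<eta> \<eta>'. n \<ge> 1 \<Longrightarrow> \<eta> \<in> class_paths B \<alpha> n (n + Suc (Suc K)) \<Longrightarrow> \<eta>' \<in> class_paths B \<alpha> n (n + Suc (Suc K)) \<Longrightarrow>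
       src B (Suc n) (\<eta> (Suc n)) = src B (Suc n) (\<eta>' (Suc n)) \<Longrightarrow>
       rng B (n + Suc (Suc K)) (\<eta> (n + Suc (Suc K))) = rng B (n + Suc (Suc K)) (\<eta>' (n + Suc (Suc K))) \<Longrightarrow>
       norm (\<gamma> powi (int (path_weight B n (n + Suc (Suc K)) \<eta>') - int (path_weight B n (n + Suc (Suc K)) \<eta>)) - 1) \<le> s n"
    using class_pair_bound[of \<gamma> "Suc (Suc K)", OF cond \<gamma>0] by (metis le_add1 plus_1_eq_Suc)
  have "\<exists>p. p \<in> class_paths B \<alpha> n (n + Suc K) \<and> src B (Suc n) (p (Suc n)) = rng B n (z n) \<and>
      rng B (n + Suc K) (p (n + Suc K)) = v" if "n \<ge> 1" "v \<in> \<alpha>" for n v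
    using K[OF that(1) z(2)[OF that(1)] that(2)] by blast
  then obtain \<pi> where \<pi>: "\<And>n v. n \<ge> 1 \<Longrightarrow> v \<in> \<alpha> \<Longrightarrow> \<pi> n v \<in> class_paths B \<alpha> n (n + Suc K)"
    "\<And>n v. n \<ge> 1 \<Longrightarrow> v \<in> \<alpha> \<Longrightarrow> src B (Suc n) (\<pi> n v (Suc n)) = rng B n (z n)"
    "\<And>n v. n \<ge> 1 \<Longrightarrow> v \<in> \<alpha> \<Longrightarrow> rng B (n + Suc K) (\<pi> n v (n + Suc K)) = v"
    by metis
  define V where "V n x = rng B (n + Suc K) (x (n + Suc K))" for n and x :: "nat \<Rightarrow> 'e"
  define E where "E n x = int (path_weight B 0 (n + Suc K) x) - int (path_weight B 0 n z)
      - int (path_weight B n (n + Suc K) (\<pi> n (V n x)))" for n x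
  \<comment> \<open>The reference path is available only for paths that are eventually in the class.
    Elsewhere \<open>f\<close> is 0, which is consistent with the eigenvalue equation because
    \<open>X\<close> is invariant.\<close>
  define X where "X = {x \<in> inf_paths B. \<exists>m. \<forall>i\<ge>m. rng B (Suc i) (x (Suc i)) \<in> \<alpha>}"
  define g where "g n x = (if x \<in> X then \<gamma> powi E n x else 0)" for n x
  define f where "f x = lim (\<lambda>n. g n x)" for x
  have step: "norm (\<gamma> powi E (Suc n) x - \<gamma> powi E n x) \<le> s n"
    if x: "x \<in> inf_paths B" and n: "n \<ge> 1" and V: "V n x \<in> \<alpha>" "V (Suc n) x \<in> \<alpha>" for x n
  proof -
    let ?k = "n + Suc K"
    have V': "rng B ?k (x ?k) \<in> \<alpha>" "rng B (Suc ?k) (x (Suc ?k)) \<in> \<alpha>" using V by (simp_all add: V_def)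
    \<comment> \<open>The two references, both completed to the vertex of \<open>x\<close> at level
      \<open>n + K + 2\<close>: \<eta> follows \<open>z\<close> for one more edge and then the path
      chosen for \<open>Suc n\<close>, while \<eta>' follows the path chosen for \<open>n\<close>
      and then the next edge of \<open>x\<close>.\<close>
    define \<eta> where "\<eta> = path_append (Suc n) (\<lambda>i\<in>{n<..Suc n}. z (Suc n)) (\<pi> (Suc n) (V (Suc n) x))"
    define \<eta>' where "\<eta>' = path_append ?k (\<pi> n (V n x)) (\<lambda>i\<in>{?k<..Suc ?k}. x (Suc ?k))"
    note \<pi>n = \<pi>[OF n V(1)]
    have n1: "Suc n \<ge> 1" by simp
    note \<pi>n' = \<pi>[OF n1 V(2)]
    have sz: "src B (Suc n) (z (Suc n)) = rng B n (z n)" using inf_path_rng[OF z(1) n] by simp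
    have sx: "src B (Suc ?k) (x (Suc ?k)) = rng B ?k (x ?k)" using inf_path_rng[OF x, of ?k] by simp
    have z1: "(\<lambda>i\<in>{n<..Suc n}. z (Suc n)) \<in> class_paths B \<alpha> n (Suc n)"
      using n z sz inf_path_edge[OF z(1), of "Suc n"] by (intro single_edge_path) auto
    have x1: "(\<lambda>i\<in>{?k<..Suc ?k}. x (Suc ?k)) \<in> class_paths B \<alpha> ?k (Suc ?k)"
      using n V' sx inf_path_edge[OF x, of "Suc ?k"] by (intro single_edge_path) auto
    have \<eta>: "\<eta> \<in> class_paths B \<alpha> n (n + Suc (Suc K))"
      unfolding \<eta>_def using \<pi>n' by (intro class_paths_append[OF z1]) auto
    have \<eta>': "\<eta>' \<in> class_paths B \<alpha> n (n + Suc (Suc K))"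
      unfolding \<eta>'_def using \<pi>n x1 sx
      by (intro class_paths_append[OF \<pi>n(1)]) (auto simp: V_def)
    have src_eq: "src B (Suc n) (\<eta> (Suc n)) = src B (Suc n) (\<eta>' (Suc n))"
      using \<pi>n(2) sz by (simp add: \<eta>_def \<eta>'_def path_append_def)
    have rng_eq: "rng B (n + Suc (Suc K)) (\<eta> (n + Suc (Suc K))) = rng B (n + Suc (Suc K)) (\<eta>' (n + Suc (Suc K)))"
      using \<pi>n'(3) by (simp add: \<eta>_def \<eta>'_def path_append_def V_def)
    have w1: "path_weight B n (n + Suc (Suc K)) \<eta> =
        edge_weight B (Suc n) (z (Suc n)) + path_weight B (Suc n) (Suc n + Suc K) (\<pi> (Suc n) (V (Suc n) x))"
    proof -
      have "path_weight B n (Suc n) \<eta> = edge_weight B (Suc n) (z (Suc n))"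
        by (simp add: path_weight_Suc \<eta>_def path_append_def)
      moreover have "path_weight B (Suc n) (Suc n + Suc K) \<eta> =
          path_weight B (Suc n) (Suc n + Suc K) (\<pi> (Suc n) (V (Suc n) x))"
        by (rule path_weight_cong) (simp add: \<eta>_def path_append_def)
      ultimately show ?thesis using path_weight_split[of n "Suc n" "Suc n + Suc K" B \<eta>] by simp
    qed
    have w2: "path_weight B n (n + Suc (Suc K)) \<eta>' =
        path_weight B n ?k (\<pi> n (V n x)) + edge_weight B (Suc ?k) (x (Suc ?k))"
    proof -
      have "path_weight B n ?k \<eta>' = path_weight B n ?k (\<pi> n (V n x))"
        by (rule path_weight_cong) (simp add: \<eta>'_def path_append_def)
      then show ?thesis using path_weight_Suc[of n ?k B \<eta>'] by (simp add: \<eta>'_def path_append_def)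
    qed
    have w3: "path_weight B 0 (Suc n + Suc K) x = path_weight B 0 ?k x + edge_weight B (Suc ?k) (x (Suc ?k))"
      using path_weight_Suc[of 0 ?k B x] by simp
    have w4: "path_weight B 0 (Suc n) z = path_weight B 0 n z + edge_weight B (Suc n) (z (Suc n))"
      by (simp add: path_weight_Suc)
    define d where "d = int (path_weight B n (n + Suc (Suc K)) \<eta>') - int (path_weight B n (n + Suc (Suc K)) \<eta>)"
    have "E (Suc n) x = E n x + d"
      unfolding E_def d_def w1 w2 w3 w4 by simp
    then have "\<gamma> powi E (Suc n) x - \<gamma> powi E n x = \<gamma> powi E n x * (\<gamma> powi d - 1)"
      using \<gamma>0 by (simp add: power_int_add algebra_simps)
    then have "norm (\<gamma> powi E (Suc n) x - \<gamma> powi E n x) = norm (\<gamma> powi d - 1)"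
      by (simp add: norm_mult powi1)
    also have "\<dots> \<le> s n" unfolding d_def by (rule s_bound[OF n \<eta> \<eta>' src_eq rng_eq])
    finally show ?thesis .
  qed
  have conv: "convergent (\<lambda>n. g n x)" for x
  proof (cases "x \<in> X")
    case True
    then obtain m where x: "x \<in> inf_paths B" and m: "\<And>i. i \<ge> m \<Longrightarrow> rng B (Suc i) (x (Suc i)) \<in> \<alpha>"
      by (auto simp: X_def)
    show ?thesis
    proof (rule convergent_if_summable_diff[OF s])
      fix n assume n: "n \<ge> Suc m"
      have "V n x \<in> \<alpha>" "V (Suc n) x \<in> \<alpha>" using m[of "n + K"] m[of "n + Suc K"] n by (simp_all add: V_def)
      then show "norm (g (Suc n) x - g n x) \<le> s n" using step[OF x, of n] n True by (simp add: g_def)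
    qed
  next
    case False
    then show ?thesis by (simp add: g_def convergent_const)
  qed
  then have lim: "(\<lambda>n. g n x) \<longlonglongrightarrow> f x" for x by (simp add: f_def convergent_LIMSEQ_iff)
  have f_norm: "norm (f x) = 1" if "x \<in> X" for x
  proof -
    have "(\<lambda>n. norm (g n x)) \<longlonglongrightarrow> norm (f x)" by (rule tendsto_norm[OF lim])
    moreover have "(\<lambda>n. norm (g n x)) = (\<lambda>_. 1)" using that powi1 by (simp add: g_def)
    ultimately show ?thesis by (simp add: LIMSEQ_const_iff)
  qed
  have XM: "X \<in> sets M"
  proof -
    have "{x \<in> inf_paths B. rng B (Suc i) (x (Suc i)) \<in> \<alpha>} \<in> sets M" for i
      by (rule level_determined_in_sets[OF level_determined_vertex])
    then have "(\<Inter>i\<in>{m..}. {x \<in> inf_paths B. rng B (Suc i) (x (Suc i)) \<in> \<alpha>}) \<in> sets M" for m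
      by (intro sets.countable_INT) auto
    then have "(\<Union>m. \<Inter>i\<in>{m..}. {x \<in> inf_paths B. rng B (Suc i) (x (Suc i)) \<in> \<alpha>}) \<in> sets M"
      by (intro sets.countable_UN) blast
    moreover have "X = (\<Union>m. \<Inter>i\<in>{m..}. {x \<in> inf_paths B. rng B (Suc i) (x (Suc i)) \<in> \<alpha>})"
      by (auto simp: X_def)
    ultimately show ?thesis by simp
  qed
  have fM: "f \<in> borel_measurable M"
    unfolding f_def[abs_def]
  proof (rule borel_measurable_lim_metric)
    fix n
    have "(\<lambda>x. \<gamma> powi E n x) \<in> borel_measurable M"
    proof (rule measurable_level_determined[of "n + Suc K"])
      fix x y :: "nat \<Rightarrow> 'e" assume "\<forall>i\<in>{1..n + Suc K}. x i = y i"
      then have "path_weight B 0 (n + Suc K) x = path_weight B 0 (n + Suc K) y" "V n x = V n y"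
        by (auto simp: V_def intro: path_weight_cong)
      then show "\<gamma> powi E n x = \<gamma> powi E n y" by (simp add: E_def)
    qed
    moreover have "Measurable.pred M (\<lambda>x. x \<in> X)" using XM by simp
    ultimately show "g n \<in> borel_measurable M" unfolding g_def by (intro measurable_If) auto
  qed
  have nonzero: "\<not> (AE x in M. f x = 0)"
  proof
    assume zero: "AE x in M. f x = 0"
    \<comment> \<open>Almost every path through \<open>u\<close> at level 1 stays in the class and
      hence lies in \<open>X\<close>; these paths have positive measure.\<close>
    obtain u where u: "u \<in> \<alpha>" using class_verts by auto
    then have "u \<in> verts B 1" using verts_eq[of 1] class_vertex by simp
    then obtain p where "p \<in> paths_to B 1 u" by (rule exists_path_to)
    then have p: "p \<in> fin_paths B 0 1" "rng B 1 (p 1) = u" by (auto simp: paths_to_def)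
    have pos: "measure M (cylinder B 1 p) > 0" using measure_cylinder[OF order_refl p(1)] p(2) xi_pos[OF u] by simp
    have all: "AE x in M. f x = 0 \<and> x \<in> inf_paths B \<and> (\<forall>n\<ge>1. \<xi> (rng B n (x n)) > 0)"
      using zero AE_inf_path AE_xi_pos by eventually_elim simp
    obtain x where x: "x \<in> cylinder B 1 p" "f x = 0" "x \<in> inf_paths B"
      "\<forall>n\<ge>1. \<xi> (rng B n (x n)) > 0"
      by (rule measure_pos_obtain[OF pos cylinder_in_sets[OF p(1)] all]) blast
    have "rng B 1 (x 1) \<in> \<alpha>" using x(1) p(2) u by (simp add: cylinder_def)
    then have "rng B (Suc i) (x (Suc i)) \<in> \<alpha>" for i
      using inf_path_stays[OF x(3,4) order_refl, of "Suc i"] by simp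
    then have "x \<in> X" using x(3) by (auto simp: X_def)
    then show False using f_norm[of x] x(2) by simp
  qed
  have "AE x in M. f (vershik B x) = \<gamma> * f x"
    using AE_vershik_domain
  proof eventually_elim
    case (elim x)
    then have x: "x \<in> inf_paths B" by (simp add: vershik_domain_def)
    obtain k where k: "k \<ge> 1" "vershik B x \<in> inf_paths B" "\<And>i. i > k \<Longrightarrow> vershik B x i = x i"
      "path_weight B 0 k (vershik B x) = Suc (path_weight B 0 k x)"
      using vershik_step[OF elim] by blast
    have X_iff: "vershik B x \<in> X \<longleftrightarrow> x \<in> X"
    proof -
      have "(\<exists>m. \<forall>i\<ge>m. rng B (Suc i) (y (Suc i)) \<in> \<alpha>) \<Longrightarrow> (\<exists>m. \<forall>i\<ge>m. rng B (Suc i) (y' (Suc i)) \<in> \<alpha>)"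
        if "\<And>i. i > k \<Longrightarrow> y i = y' i" for y y' :: "nat \<Rightarrow> 'e"
      proof -
        assume "\<exists>m. \<forall>i\<ge>m. rng B (Suc i) (y (Suc i)) \<in> \<alpha>"
        then obtain m where m: "\<And>i. i \<ge> m \<Longrightarrow> rng B (Suc i) (y (Suc i)) \<in> \<alpha>" by blast
        have "rng B (Suc i) (y' (Suc i)) \<in> \<alpha>" if "i \<ge> max m k" for i
          using m[of i] \<open>\<And>i. i > k \<Longrightarrow> y i = y' i\<close>[of "Suc i"] that by simp
        then show ?thesis by blast
      qed
      from this[of "vershik B x" x] this[of x "vershik B x"] show ?thesis
        using k(2,3) x by (auto simp: X_def)
    qed
    show ?case
    proof (cases "x \<in> X")
      case False
      then have "f x = 0" "f (vershik B x) = 0"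
        using lim[of x] lim[of "vershik B x"] X_iff by (simp_all add: g_def LIMSEQ_const_iff)
      then show ?thesis by simp
    next
      case True
      \<comment> \<open>Above the changed edges the vertex of \<open>x\<close> and therefore the
        reference path are the same, so only the weight of \<open>x\<close> changes, by 1.\<close>
      have "g n (vershik B x) = \<gamma> * g n x" if n: "n \<ge> k" for n
      proof -
        have "path_weight B k (n + Suc K) (vershik B x) = path_weight B k (n + Suc K) x"
          by (rule path_weight_cong) (use k(3) in auto)
        then have "path_weight B 0 (n + Suc K) (vershik B x) = Suc (path_weight B 0 (n + Suc K) x)"
          using k(4) path_weight_split[of 0 k "n + Suc K" B] n by simp
        moreover have "V n (vershik B x) = V n x" using k(3)[of "n + Suc K"] n by (simp add: V_def)
        ultimately have "E n (vershik B x) = E n x + 1" by (simp add: E_def)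
        then show ?thesis using True X_iff \<gamma>0 by (simp add: g_def power_int_add)
      qed
      then have "\<forall>n\<ge>k. \<gamma> * g n x = g n (vershik B x)" by simp
      then have ev: "\<forall>\<^sub>F n in sequentially. \<gamma> * g n x = g n (vershik B x)"
        unfolding eventually_sequentially by (rule exI)
      have "(\<lambda>n. \<gamma> * g n x) \<longlonglongrightarrow> \<gamma> * f x" by (intro tendsto_mult tendsto_const lim)
      then have "(\<lambda>n. g n (vershik B x)) \<longlonglongrightarrow> \<gamma> * f x" by (rule Lim_transform_eventually[OF _ ev])
      then show ?thesis by (rule LIMSEQ_unique[OF lim])
    qed
  qed
  then show ?thesis using fM nonzero unfolding vershik_eigenvalue_def by blast
qed

end

section \<open>Diamonds of length at most two\<close>

text \<open>For \<gamma> = 0 powers are not multiplicative in general; but powers that tend to 1 are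
  eventually nonzero, so the exponents are eventually 0.\<close>

lemma powi_tendsto_1_add:
  fixes \<gamma> :: complex
  assumes x: "(\<lambda>n. \<gamma> powi x n) \<longlonglongrightarrow> 1" and y: "(\<lambda>n. \<gamma> powi y n) \<longlonglongrightarrow> 1"
  shows "(\<lambda>n. \<gamma> powi (x n + y n)) \<longlonglongrightarrow> 1"
proof -
  have "\<forall>\<^sub>F n in sequentially. \<gamma> powi x n \<noteq> 0" by (rule tendsto_imp_eventually_ne[OF x]) simp
  moreover have "\<forall>\<^sub>F n in sequentially. \<gamma> powi y n \<noteq> 0" by (rule tendsto_imp_eventually_ne[OF y]) simp
  ultimately have ev: "\<forall>\<^sub>F n in sequentially. \<gamma> powi x n * \<gamma> powi y n = \<gamma> powi (x n + y n)"
  proof eventually_elim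
    case (elim n)
    show ?case
    proof (cases "\<gamma> = 0")
      case True
      then have "x n = 0" "y n = 0" using elim by auto
      then show ?thesis by simp
    qed (simp add: power_int_add)
  qed
  have "(\<lambda>n. \<gamma> powi x n * \<gamma> powi y n) \<longlonglongrightarrow> 1 * 1" by (intro tendsto_mult x y)
  then have "(\<lambda>n. \<gamma> powi x n * \<gamma> powi y n) \<longlonglongrightarrow> 1" by simp
  then show ?thesis by (rule Lim_transform_eventually[OF _ ev])
qed

text \<open>As a sum over edges, the steps of a pair can be split by levels and ignore levels on
  which the two paths agree.\<close>

lemma pair_steps_eq_sum:
  "pair_steps B a b \<omega> \<omega>' n = (\<Sum>i\<in>{a<..b}. int (edge_weight B (i + n) (edge_shift B i n (\<omega>' i))) -
     int (edge_weight B (i + n) (edge_shift B i n (\<omega> i))))"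
  by (simp add: pair_steps_def path_weight_shift_iter sum_subtractf)

lemma pair_steps_cong:
  assumes "\<And>i. a < i \<Longrightarrow> i \<le> b \<Longrightarrow> \<omega> i = \<eta> i" "\<And>i. a < i \<Longrightarrow> i \<le> b \<Longrightarrow> \<omega>' i = \<eta>' i"
  shows "pair_steps B a b \<omega> \<omega>' = pair_steps B a b \<eta> \<eta>'"
  using assms by (intro ext) (simp add: pair_steps_eq_sum)

lemma pair_steps_add: "pair_steps B a b \<omega> \<omega>'' n = pair_steps B a b \<omega> \<omega>' n + pair_steps B a b \<omega>' \<omega>'' n"
  by (simp add: pair_steps_def)

lemma pair_steps_split:
  assumes "a \<le> b" "b \<le> c"
  shows "pair_steps B a c \<omega> \<omega>' n = pair_steps B a b \<omega> \<omega>' n + pair_steps B b c \<omega> \<omega>' n"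
proof -
  have "{a<..c} = {a<..b} \<union> {b<..c}" using assms by auto
  then show ?thesis unfolding pair_steps_eq_sum by (simp add: sum.union_disjoint)
qed

lemma pair_steps_eq_0:
  assumes "\<And>i. a < i \<Longrightarrow> i \<le> b \<Longrightarrow> \<omega> i = \<omega>' i"
  shows "pair_steps B a b \<omega> \<omega>' n = 0"
  using assms by (simp add: pair_steps_eq_sum)

lemma class_paths_restrict:
  assumes "path_on B a b x" "passes_within B V a b x" "a \<le> a'" "b' \<le> b"
  shows "restrict x {a'<..b'} \<in> class_paths B V a' b'"
proof -
  have "path_on B a' b' (restrict x {a'<..b'}) = path_on B a' b' x" by (rule path_on_cong) simp
  then show ?thesis
    using assms path_on_subset[of B a b x a' b'] by (auto simp: class_paths_def fin_paths_iff passes_within_def)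
qed

context stationary_bratteli
begin

text \<open>A pair \<open>(\<omega>, \<omega>')\<close> of length at least three is split at the path that takes the first edge of
  \<open>\<omega>'\<close> and then joins \<open>\<omega>\<close> after one further edge.\<close>

lemma short_diamonds_suffice:
  fixes \<gamma> :: complex
  assumes V: "V \<subseteq> {..<dim_row F}" and full: "\<And>u v. u \<in> V \<Longrightarrow> v \<in> V \<Longrightarrow> F $$ (v, u) > 0"
    and short: "\<And>a b \<omega> \<omega>'. class_diamond B V a b \<omega> \<omega>' \<Longrightarrow> b - a \<le> 2 \<Longrightarrow>
      (\<lambda>n. \<gamma> powi pair_steps B a b \<omega> \<omega>' n) \<longlonglongrightarrow> 1"
  shows "1 \<le> a \<Longrightarrow> a < b \<Longrightarrow> \<omega> \<in> class_paths B V a b \<Longrightarrow> \<omega>' \<in> class_paths B V a b \<Longrightarrow>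
    src B (Suc a) (\<omega> (Suc a)) = src B (Suc a) (\<omega>' (Suc a)) \<Longrightarrow> rng B b (\<omega> b) = rng B b (\<omega>' b) \<Longrightarrow>
    (\<lambda>n. \<gamma> powi pair_steps B a b \<omega> \<omega>' n) \<longlonglongrightarrow> 1"
proof (induction "b - a" arbitrary: a b \<omega> \<omega>' rule: less_induct)
  case less
  note ab = less.prems(1,2) and w = less.prems(3,4) and src_eq = less.prems(5) and rng_eq = less.prems(6)
  show ?case
  proof (cases "b - a \<le> 2")
    case True
    show ?thesis
    proof (cases "\<omega> = \<omega>'")
      case True
      then show ?thesis by (simp add: pair_steps_eq_0)
    next
      case False
      then have "class_diamond B V a b \<omega> \<omega>'"
        using less.prems by (auto simp: class_diamond_def diamond_def class_paths_def)
      then show ?thesis using True by (rule short)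
    qed
  next
    case False
    define c d where "c = Suc a" and "d = Suc c"
    have cd: "a < c" "c < d" "d < b" "c \<ge> 1" "d - a \<le> 2" using False ab by (auto simp: c_def d_def)
    have on: "path_on B a b \<omega>" "path_on B a b \<omega>'" and within: "passes_within B V a b \<omega>" "passes_within B V a b \<omega>'"
      using w by (auto simp: class_paths_def fin_paths_iff)
    have u: "rng B c (\<omega>' c) \<in> V" and v: "rng B d (\<omega> d) \<in> V"
      using within cd by (auto simp: passes_within_def)
    obtain g where g: "g \<in> edges B d" "src B d g = rng B c (\<omega>' c)" "rng B d g = rng B d (\<omega> d)"
      unfolding d_def
      by (rule edge_between[OF cd(4), of "rng B (Suc c) (\<omega> (Suc c))" "rng B c (\<omega>' c)"])
        (use u v V full in \<open>auto simp: d_def\<close>)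
    define \<eta> where "\<eta> = path_append d (path_append c \<omega>' (\<lambda>_. g)) \<omega>"
    have \<eta>_at: "\<eta> i = \<omega>' i" if "i \<le> c" for i using that cd by (simp add: \<eta>_def path_append_def)
    have \<eta>_d: "\<eta> d = g" using cd by (simp add: \<eta>_def path_append_def)
    have \<eta>_after: "\<eta> i = \<omega> i" if "d < i" for i using that by (simp add: \<eta>_def path_append_def)
    have g_path: "path_on B c d (\<lambda>_. g)" using g by (auto simp: path_on_def d_def less_Suc_eq_le)
      (metis Suc_leI le_antisym)
    have "path_on B a d (path_append c \<omega>' (\<lambda>_. g))"
      using on cd g by (intro path_on_append g_path path_on_subset[OF on(2)]) (auto simp: d_def)
    then have on_\<eta>: "path_on B a b \<eta>"
      unfolding \<eta>_def
    proof (rule path_on_append)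
      show "path_on B d b \<omega>" using path_on_subset[OF on(1), of d b] cd by simp
      have "rng B d (\<omega> d) = src B (Suc d) (\<omega> (Suc d))" using on(1) cd by (simp add: path_on_def)
      then show "rng B d (path_append c \<omega>' (\<lambda>_. g) d) = src B (Suc d) (\<omega> (Suc d))"
        using g cd by (simp add: path_append_def)
    qed (use cd in auto)
    have within_\<eta>: "passes_within B V a b \<eta>"
      unfolding passes_within_def
    proof
      fix i assume i: "i \<in> {a<..b}"
      consider "i \<le> c" | "i = d" | "i > d" unfolding d_def by linarith
      then show "src B i (\<eta> i) \<in> V \<and> rng B i (\<eta> i) \<in> V"
      proof cases
        case 1
        then show ?thesis using \<eta>_at[of i] within i by (simp add: passes_within_def)
      next
        case 2
        then show ?thesis using g u v by (simp add: \<eta>_d)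
      next
        case 3
        then show ?thesis using \<eta>_after[of i] within i by (simp add: passes_within_def)
      qed
    qed
    \<comment> \<open>Above \<open>d\<close> the paths \<omega> and \<eta> agree, so this pair has
      length 2, less than the length of the original one.\<close>
    have first: "(\<lambda>n. \<gamma> powi pair_steps B a d \<omega> \<eta> n) \<longlonglongrightarrow> 1"
    proof -
      let ?x = "restrict \<omega> {a<..d}" and ?y = "restrict \<eta> {a<..d}"
      have "(\<lambda>n. \<gamma> powi pair_steps B a d ?x ?y n) \<longlonglongrightarrow> 1"
      proof (rule less.hyps)
        show "d - a < b - a" using cd ab by linarith
        show "?x \<in> class_paths B V a d" "?y \<in> class_paths B V a d"
          using class_paths_restrict[OF on(1) within(1)] class_paths_restrict[OF on_\<eta> within_\<eta>] cd by auto
        show "src B (Suc a) (?x (Suc a)) = src B (Suc a) (?y (Suc a))"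
          using src_eq \<eta>_at[of c] cd by (simp add: c_def)
        show "rng B d (?x d) = rng B d (?y d)" using g cd by (simp add: \<eta>_d)
      qed (use ab cd in auto)
      moreover have "pair_steps B a d ?x ?y = pair_steps B a d \<omega> \<eta>" by (rule pair_steps_cong) auto
      ultimately show ?thesis by simp
    qed
    \<comment> \<open>Up to \<open>c\<close> the paths \<eta> and \<omega>' agree, so this pair is
      shorter by one level.\<close>
    have second: "(\<lambda>n. \<gamma> powi pair_steps B c b \<eta> \<omega>' n) \<longlonglongrightarrow> 1"
    proof -
      let ?x = "restrict \<eta> {c<..b}" and ?y = "restrict \<omega>' {c<..b}"
      have "(\<lambda>n. \<gamma> powi pair_steps B c b ?x ?y n) \<longlonglongrightarrow> 1"
      proof (rule less.hyps)
        show "b - c < b - a" using cd ab by linarith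
        show "?x \<in> class_paths B V c b" "?y \<in> class_paths B V c b"
          using class_paths_restrict[OF on(2) within(2)] class_paths_restrict[OF on_\<eta> within_\<eta>] cd by auto
        have "rng B c (\<omega>' c) = src B (Suc c) (\<omega>' (Suc c))" using on(2) cd by (simp add: path_on_def)
        then show "src B (Suc c) (?x (Suc c)) = src B (Suc c) (?y (Suc c))"
          using g cd \<eta>_d by (simp add: d_def)
        show "rng B b (?x b) = rng B b (?y b)" using rng_eq \<eta>_after[of b] cd by simp
      qed (use ab cd in auto)
      moreover have "pair_steps B c b ?x ?y = pair_steps B c b \<eta> \<omega>'" by (rule pair_steps_cong) auto
      ultimately show ?thesis by simp
    qed
    have "pair_steps B a b \<omega> \<omega>' n = pair_steps B a d \<omega> \<eta> n + pair_steps B c b \<eta> \<omega>' n" for n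
    proof -
      have "pair_steps B a b \<omega> \<eta> n = pair_steps B a d \<omega> \<eta> n"
        using pair_steps_split[of a d b B \<omega> \<eta> n] pair_steps_eq_0[of d b \<omega> \<eta> B n] \<eta>_after cd by simp
      moreover have "pair_steps B a b \<eta> \<omega>' n = pair_steps B c b \<eta> \<omega>' n"
        using pair_steps_split[of a c b B \<eta> \<omega>' n] pair_steps_eq_0[of a c \<eta> \<omega>' B n] \<eta>_at cd by simp
      ultimately show ?thesis using pair_steps_add[of B a b \<omega> \<omega>' n \<eta>] by simp
    qed
    then show ?thesis using powi_tendsto_1_add[OF first second] by simp
  qed
qed

end

section \<open>Matrices in block form\<close>

lemma mat_graph_transpose:
  assumes "square_mat F"
  shows "mat_graph (transpose_mat F) = class_graph F {..<dim_row F}"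
  using assms by (auto simp: mat_graph_def class_graph_def)

lemma equiv_vertex_equiv: "equiv {..<dim_row A} (vertex_equiv A)"
proof (rule equivI)
  show "vertex_equiv A \<subseteq> {..<dim_row A} \<times> {..<dim_row A}" by (auto simp: vertex_equiv_def)
  show "refl_on {..<dim_row A} (vertex_equiv A)" by (auto simp: refl_on_def vertex_equiv_def)
  show "sym (vertex_equiv A)" by (auto simp: sym_def vertex_equiv_def)
  show "trans (vertex_equiv A)"
    unfolding trans_def vertex_equiv_def by (auto intro: trancl_trans)
qed

lemma pick_interval:
  assumes "i < h - l"
  shows "pick {l..<h} i = l + (i::nat)"
proof -
  have "{a \<in> {l..<h}. a < l + i} = {l..<l + i}" using assms by auto
  then have "card {a \<in> {l..<h}. a < l + i} = i" by simp
  moreover have "pick {l..<h} (card {a \<in> {l..<h}. a < l + i}) = l + i"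
    by (rule pick_card_in_set) (use assms in auto)
  ultimately show ?thesis by simp
qed

lemma class_block_interval:
  assumes "square_mat F" "h \<le> dim_row F"
  shows "class_block F {l..<h} \<in> carrier_mat (h - l) (h - l)"
    and "\<And>i j. i < h - l \<Longrightarrow> j < h - l \<Longrightarrow> class_block F {l..<h} $$ (i, j) = F $$ (l + i, l + j)"
proof -
  have "{i. i < dim_row F \<and> i \<in> {l..<h}} = {l..<h}" "{i. i < dim_col F \<and> i \<in> {l..<h}} = {l..<h}"
    using assms by auto
  then have eq: "class_block F {l..<h} = mat (h - l) (h - l) (\<lambda>(i, j). F $$ (pick {l..<h} i, pick {l..<h} j))"
    unfolding class_block_def submatrix_def by simp
  show "class_block F {l..<h} \<in> carrier_mat (h - l) (h - l)" unfolding eq by simp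
  show "class_block F {l..<h} $$ (i, j) = F $$ (l + i, l + j)" if "i < h - l" "j < h - l" for i j
    unfolding eq using that by (simp add: pick_interval)
qed

text \<open>Rows are ranges and columns are sources, which reverses the pair. The last factor of the
  power contributes the first arrow of the path.\<close>

lemma block_power_graph:
  assumes sq: "square_mat F" and h: "h \<le> dim_row F"
  shows "i < h - l \<Longrightarrow> j < h - l \<Longrightarrow> (class_block F {l..<h} ^\<^sub>m k) $$ (i, j) > 0 \<Longrightarrow>
    (l + j, l + i) \<in> class_graph F {l..<h} ^^ k"
proof (induction k arbitrary: j)
  case 0
  let ?A = "class_block F {l..<h}"
  have A: "?A \<in> carrier_mat (h - l) (h - l)" by (rule class_block_interval[OF sq h])
  then have "dim_row ?A = h - l" by simp
  then show ?case using 0 by (auto split: if_splits)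
next
  case (Suc k)
  let ?A = "class_block F {l..<h}"
  have A: "?A \<in> carrier_mat (h - l) (h - l)" by (rule class_block_interval[OF sq h])
  have Ak: "?A ^\<^sub>m k \<in> carrier_mat (h - l) (h - l)" using A by simp
  have "(?A ^\<^sub>m Suc k) $$ (i, j) = (\<Sum>t<h - l. (?A ^\<^sub>m k) $$ (i, t) * ?A $$ (t, j))"
    using A Ak Suc.prems by (simp add: scalar_prod_def atLeast0LessThan)
  then have "(\<Sum>t<h - l. (?A ^\<^sub>m k) $$ (i, t) * ?A $$ (t, j)) > 0" using Suc.prems(3) by (simp only:)
  then have "(\<Sum>t<h - l. (?A ^\<^sub>m k) $$ (i, t) * ?A $$ (t, j)) \<noteq> 0" by (rule gr_implies_not0)
  then obtain t where t: "t < h - l" "(?A ^\<^sub>m k) $$ (i, t) * ?A $$ (t, j) \<noteq> 0"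
    by (meson lessThan_iff sum.not_neutral_contains_not_neutral)
  then have "(l + t, l + i) \<in> class_graph F {l..<h} ^^ k" using Suc.IH[OF Suc.prems(1) t(1)] by simp
  moreover have "(l + j, l + t) \<in> class_graph F {l..<h}"
    using t Suc.prems class_block_interval(2)[OF sq h, of t l j] by (auto simp: class_graph_def)
  ultimately show ?case by (rule relpow_Suc_I2[rotated])
qed

lemma positive_matD:
  "positive_mat A \<Longrightarrow> A \<in> carrier_mat n m \<Longrightarrow> i < n \<Longrightarrow> j < m \<Longrightarrow> A $$ (i, j) > 0"
  by (auto simp: positive_mat_def)

text \<open>A nonempty class graph says that the diagonal block is nonzero, the case in which the
  block form imposes \<open>Q\<close>.\<close>

lemma class_form_block:
  assumes "class_form Q F" "\<alpha> \<in> vertex_classes (transpose_mat F)" "square_mat F" "class_graph F \<alpha> \<noteq> {}"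
  obtains l h where "\<alpha> = {l..<h}" "h \<le> dim_row F" "Q (class_block F \<alpha>)"
proof -
  show ?thesis
    using assms(1) unfolding class_form_def Let_def
  proof (elim exE conjE, goal_cases)
    case (1 m s b)
    obtain i where i: "i < m" "\<alpha> = {b i..<b (Suc i)}" using assms(2) unfolding 1(5) by auto
    have "b (Suc i) \<le> b m"
    proof (rule inc_induct[of "Suc i" m])
      show "Suc i \<le> m" using i by simp
      fix n assume "n < m" "b (Suc n) \<le> b m"
      then show "b n \<le> b m" using 1(3) by (meson less_imp_le order_trans)
    qed simp
    moreover have "\<exists>v\<in>\<alpha>. \<exists>w\<in>\<alpha>. F $$ (v, w) \<noteq> 0"
      using assms(4) unfolding class_graph_def by fastforce
    then have "Q (class_block F \<alpha>)" using 1(8) i by blast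
    ultimately show ?thesis using that[of "b i" "b (Suc i)"] i(2) 1(2) by simp
  qed
qed

lemma class_system_intro:
  assumes so: "stationary_ordered B F" and ap: "tail_aperiodic B" and P: "condition_P F"
    and dist: "distinguished F \<alpha>" and meas: "class_measure B F \<alpha> M"
  obtains \<rho> \<xi> where "class_system B F \<alpha> \<rho> \<xi> M"
proof -
  interpret stationary_bratteli B F by unfold_locales (rule so)
  have sq: "square_mat F" using stationary by (simp add: stationary_def)
  let ?A = "transpose_mat F" and ?N = "dim_row F"
  have dimA: "dim_row ?A = ?N" by simp
  have G: "mat_graph ?A = class_graph F {..<?N}" by (rule mat_graph_transpose[OF sq])
  have eqv: "equiv {..<?N} (vertex_equiv ?A)" using equiv_vertex_equiv[of ?A] by simp
  have \<alpha>: "\<alpha> \<in> {..<?N} // vertex_equiv ?A"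
    using dist by (simp add: distinguished_def vertex_classes_def)
  define \<rho> where "\<rho> = class_radius F \<alpha>"
  obtain x where prob: "prob_space M" and sets: "sets M = sets (path_borel B)"
    and ev: "class_eigenvector B F \<alpha> x"
    and cyl: "\<And>n p. n \<ge> 1 \<Longrightarrow> p \<in> fin_paths B 0 n \<Longrightarrow>
      measure M (cylinder B n p) = vec_index x (rng B n (p n)) / \<rho> ^ (n - 1)"
    using meas unfolding class_measure_def \<rho>_def by blast
  define \<xi> where "\<xi> = vec_index x"
  have eig: "eigenvector (map_mat real ?A) x \<rho>" and nonneg: "\<And>i. i < ?N \<Longrightarrow> \<xi> i \<ge> 0"
    and pos: "\<And>\<beta> i. \<beta> \<in> {..<?N} // vertex_equiv ?A \<Longrightarrow> i \<in> \<beta> \<Longrightarrow> \<xi> i > 0 \<longleftrightarrow> has_access ?A \<beta> \<alpha>"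
    and total: "(\<Sum>w\<in>verts B 1. real (root_edges B w) * \<xi> w) = 1"
    using ev by (auto simp: class_eigenvector_def \<rho>_def \<xi>_def vertex_classes_def)
  have class_of: "\<exists>\<beta>. \<beta> \<in> {..<?N} // vertex_equiv ?A \<and> v \<in> \<beta>" if "v < ?N" for v
    using quotientI[of v "{..<?N}" "vertex_equiv ?A"] equiv_class_self[OF eqv, of v] that by blast
  have same: "(i, j) \<in> (class_graph F {..<?N})\<^sup>*" if "\<beta> \<in> {..<?N} // vertex_equiv ?A" "i \<in> \<beta>" "j \<in> \<beta>" for \<beta> i j
  proof -
    have "(i, j) \<in> vertex_equiv ?A" using quotient_eq_iff[OF eqv that(1,1,2,3)] by simp
    then show ?thesis unfolding vertex_equiv_def G by (auto intro: trancl_into_rtrancl)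
  qed
  \<comment> \<open>Access may start at another vertex of the class of \<open>w\<close>; a path
    inside that class leads there from \<open>w\<close>.\<close>
  have access: "\<exists>j\<in>\<alpha>. (w, j) \<in> (class_graph F {..<?N})\<^sup>*" if w: "w < ?N" "\<xi> w > 0" for w
  proof -
    obtain \<beta> where \<beta>: "\<beta> \<in> {..<?N} // vertex_equiv ?A" "w \<in> \<beta>" using class_of[OF w(1)] by blast
    then have "has_access ?A \<beta> \<alpha>" using pos w by blast
    then consider "\<beta> = \<alpha>" | i j where "i \<in> \<beta>" "j \<in> \<alpha>" "(i, j) \<in> (class_graph F {..<?N})\<^sup>+"
      unfolding has_access_def G by blast
    then show ?thesis
    proof cases
      case 1
      then show ?thesis using \<beta> by blast
    next
      case 2
      have "(w, j) \<in> (class_graph F {..<?N})\<^sup>*"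
        by (rule rtrancl_trans[OF same[OF \<beta>(1,2) 2(1)] trancl_into_rtrancl[OF 2(3)]])
      then show ?thesis using 2 by blast
    qed
  qed
  have "class_system B F \<alpha> \<rho> \<xi> M"
  proof (intro class_system.intro class_system_axioms.intro)
    show "stationary_bratteli B F" by unfold_locales
    show "tail_aperiodic B" by (rule ap)
    show sub: "\<alpha> \<subseteq> {..<?N}" using \<alpha> eqv by (rule in_quotient_imp_subset[rotated])
    show "\<alpha> \<noteq> {}" using eqv \<alpha> by (rule in_quotient_imp_non_empty)
    show "(\<Sum>v<?N. real (F $$ (v, w)) * \<xi> v) = \<rho> * \<xi> w" if w: "w < ?N" for w
    proof -
      have x: "x \<in> carrier_vec ?N" "map_mat real ?A *\<^sub>v x = \<rho> \<cdot>\<^sub>v x"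
        using eig by (auto simp: eigenvector_def)
      then have dx: "dim_vec x = ?N" by simp
      have "(\<rho> \<cdot>\<^sub>v x) $ w = (map_mat real ?A *\<^sub>v x) $ w" using x(2) by simp
      also have "\<dots> = (\<Sum>v<?N. real (F $$ (v, w)) * x $ v)"
        using w dx by (simp add: scalar_prod_def atLeast0LessThan)
      finally show ?thesis using w dx by (simp add: \<xi>_def)
    qed
    show "\<xi> v \<ge> 0" if "v < ?N" for v using nonneg that by blast
    show "\<xi> v > 0" if "v \<in> \<alpha>" for v using pos[OF \<alpha> that] by (simp add: has_access_def)
    \<comment> \<open>Positive \<xi> gives \<open>v\<close> a path back to the class and thus to
      \<open>u\<close>, and the edge leads from \<open>u\<close> to \<open>v\<close>; so the two
      vertices are equivalent.\<close>
    show "v \<in> \<alpha>" if u: "u \<in> \<alpha>" and v: "v < ?N" "F $$ (v, u) > 0" "\<xi> v > 0" for u v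
    proof -
      obtain j where j: "j \<in> \<alpha>" "(v, j) \<in> (class_graph F {..<?N})\<^sup>*" using access v by blast
      have "(v, u) \<in> (class_graph F {..<?N})\<^sup>*" using rtrancl_trans[OF j(2) same[OF \<alpha> j(1) u]] .
      moreover have uN: "u < ?N" using sub u by auto
      then have "(u, v) \<in> class_graph F {..<?N}" using v by (simp add: class_graph_def)
      ultimately have "(u, v) \<in> vertex_equiv ?A"
        unfolding vertex_equiv_def G using uN v(1) by (auto simp: rtrancl_eq_or_trancl)
      moreover have "\<alpha> = vertex_equiv ?A `` {u}"
        using eqv \<alpha> u by (metis Image_singleton_iff equiv_class_eq_iff quotientE)
      ultimately show ?thesis by blast
    qed
    show "\<exists>k. \<exists>u\<in>\<alpha>. (w, u) \<in> class_graph F {..<?N} ^^ k" if "w < ?N" "\<xi> w > 0" for w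
      using access[OF that] rtrancl_imp_relpow by blast
    show "\<exists>K\<ge>1. \<forall>u\<in>\<alpha>. \<forall>v\<in>\<alpha>. (u, v) \<in> class_graph F \<alpha> ^^ K" if ne: "class_graph F \<alpha> \<noteq> {}"
    proof -
      obtain l h where lh: "\<alpha> = {l..<h}" "h \<le> ?N" "primitive_mat (class_block F \<alpha>)"
        using class_form_block[OF _ _ sq ne] P dist unfolding condition_P_def distinguished_def by blast
      then obtain K where K: "K \<ge> 1" "positive_mat (class_block F \<alpha> ^\<^sub>m K)"
        by (auto simp: primitive_mat_def)
      have A: "class_block F \<alpha> \<in> carrier_mat (h - l) (h - l)"
        unfolding lh(1) by (rule class_block_interval(1)[OF sq lh(2)])
      have AK: "class_block F \<alpha> ^\<^sub>m K \<in> carrier_mat (h - l) (h - l)" using A by simp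
      have "(u, v) \<in> class_graph F \<alpha> ^^ K" if "u \<in> \<alpha>" "v \<in> \<alpha>" for u v
      proof -
        have uv: "u - l < h - l" "v - l < h - l" "l + (u - l) = u" "l + (v - l) = v" using that lh(1) by auto
        have "(class_block F \<alpha> ^\<^sub>m K) $$ (v - l, u - l) > 0"
          by (rule positive_matD[OF K(2) AK uv(2,1)])
        then show ?thesis
          using block_power_graph[OF sq lh(2) uv(2,1), of K] uv(3,4) unfolding lh(1) by simp
      qed
      then show ?thesis using K(1) by blast
    qed
    have "path_count B 1 w = root_edges B w" for w by (simp add: root_edges_def path_count.simps)
    then show "(\<Sum>w<?N. real (path_count B 1 w) * \<xi> w) = 1"
      using total unfolding verts_eq[OF order_refl] by (simp only:)
    show "prob_space M" by (rule prob)
    show "sets M = sets (path_borel B)" by (rule sets)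
    show "measure M (cylinder B n p) = \<xi> (rng B n (p n)) / \<rho> ^ (n - 1)"
      if "1 \<le> n" "p \<in> fin_paths B 0 n" for n p
      using cyl[OF that] by (simp add: \<xi>_def)
  qed
  then show ?thesis by (rule that)
qed

theorem theorem6p3:
  fixes B :: "(nat, 'e) bratteli"
    and F :: "nat mat"
    and \<alpha> :: "nat set"
    and M :: "(nat \<Rightarrow> 'e) measure"
    and \<gamma> :: complex
  assumes "stationary_ordered B F"
    and "no_isolated_points B"
    and "tail_aperiodic B"
    and "condition_P F"
    and "distinguished F \<alpha>"
    and "class_measure B F \<alpha> M"
  shows "(vershik_eigenvalue B M \<gamma> \<longleftrightarrow>
            (\<forall>a b \<omega> \<omega>'. class_diamond B \<alpha> a b \<omega> \<omega>' \<longrightarrow>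
               (\<lambda>n. \<gamma> powi diamond_steps_shift B n a b \<omega> \<omega>') \<longlonglongrightarrow> 1)) \<and>
         (condition_P' F \<longrightarrow>
            (\<forall>a b \<omega> \<omega>'. class_diamond B \<alpha> a b \<omega> \<omega>' \<and> b - a \<le> 2 \<longrightarrow>
               (\<lambda>n. \<gamma> powi diamond_steps_shift B n a b \<omega> \<omega>') \<longlonglongrightarrow> 1) \<longrightarrow>
            vershik_eigenvalue B M \<gamma>)"
proof -
  obtain \<rho> \<xi> where "class_system B F \<alpha> \<rho> \<xi> M"
    using class_system_intro[OF assms(1,3-6)] by blast
  then interpret class_system B F \<alpha> \<rho> \<xi> M .
  have sq: "square_mat F" using stationary by (simp add: stationary_def)
  have steps: "(\<lambda>n. \<gamma> powi diamond_steps_shift B n a b \<omega> \<omega>') = (\<lambda>n. \<gamma> powi pair_steps B a b \<omega> \<omega>' n)"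
    if "class_diamond B \<alpha> a b \<omega> \<omega>'" for a b \<omega> \<omega>'
    using that by (simp add: class_diamond_def diamond_steps_shift_eq)
  have main: "vershik_eigenvalue B M \<gamma> \<longleftrightarrow>
      (\<forall>a b \<omega> \<omega>'. class_diamond B \<alpha> a b \<omega> \<omega>' \<longrightarrow> (\<lambda>n. \<gamma> powi pair_steps B a b \<omega> \<omega>' n) \<longlonglongrightarrow> 1)"
    using eigenvalue_imp_diamond_condition diamond_condition_imp_eigenvalue by blast
  have "vershik_eigenvalue B M \<gamma>"
    if P': "condition_P' F"
      and short: "\<And>a b \<omega> \<omega>'. class_diamond B \<alpha> a b \<omega> \<omega>' \<Longrightarrow> b - a \<le> 2 \<Longrightarrow>
        (\<lambda>n. \<gamma> powi pair_steps B a b \<omega> \<omega>' n) \<longlonglongrightarrow> 1"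
  proof -
    \<comment> \<open>The block of the class is nonzero by \<open>class_graph_nonempty\<close>, so
      condition (P') makes it strictly positive, as required for splitting long diamonds.\<close>
    obtain l h where lh: "\<alpha> = {l..<h}" "h \<le> dim_row F" "positive_mat (class_block F \<alpha>)"
      using class_form_block[OF _ _ sq class_graph_nonempty] P' assms(5)
      unfolding condition_P'_def distinguished_def by blast
    have A: "class_block F \<alpha> \<in> carrier_mat (h - l) (h - l)"
      unfolding lh(1) by (rule class_block_interval(1)[OF sq lh(2)])
    have full: "F $$ (v, u) > 0" if "u \<in> \<alpha>" "v \<in> \<alpha>" for u v
    proof -
      have uv: "u - l < h - l" "v - l < h - l" "l + (u - l) = u" "l + (v - l) = v" using that lh(1) by auto
      have "class_block F \<alpha> $$ (v - l, u - l) > 0" by (rule positive_matD[OF lh(3) A uv(2,1)])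
      then show ?thesis using class_block_interval(2)[OF sq lh(2) uv(2,1)] uv(3,4) lh(1) by simp
    qed
    have "(\<lambda>n. \<gamma> powi pair_steps B a b \<omega> \<omega>' n) \<longlonglongrightarrow> 1" if d: "class_diamond B \<alpha> a b \<omega> \<omega>'" for a b \<omega> \<omega>'
      by (rule short_diamonds_suffice[OF class_verts(1) full short])
        (use d in \<open>auto simp: class_diamond_def diamond_def class_paths_def\<close>)
    then show ?thesis by (rule diamond_condition_imp_eigenvalue)
  qed
  then show ?thesis using main steps by (metis (no_types, lifting))
qed

end
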